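(* Let $\theta(z)=\phi(z_1)\psi(z_2)$, where $\phi$ and $\psi$ are one variable inner functions on $\mathbb{D}$. Then $S_{z_1}$ on $\mathcal{K}_\theta$ is essentially normal if and only if $\psi$ is a finite Blaschke product and $\phi$ is a single Blaschke factor. Similarly, $S_{z_2}$ on $\mathcal{K}_\theta$ is essentially normal if and only if $\phi$ is a finite Blaschke product and $\psi$ is a single Blaschke factor.
   Context: $H^2(\mathbb{D}^2)$ is the Hardy space on the bidisk with variables $z=(z_1,z_2)$. For an inner function $\theta$ on $\mathbb{D}^2$ (bounded holomorphic with unimodular boundary values a.e. on $\mathbb{T}^2$), $\mathcal{K}_\theta = H^2(\mathbb{D}^2)\ominus\theta H^2(\mathbb{D}^2)$, $P_\theta$ is the orthogonal projection of $H^2(\mathbb{D}^2)$ onto $\mathcal{K}_\theta$, $T_{z_j}$ is multiplication by $z_j$ on $H^2(\mathbb{D}^2)$, and $S_{z_j}=P_\theta T_{z_j}|_{\mathcal{K}_\theta}$ for $j=1,2$. An operator $S$ is essentially normal if the commutator $[S^*,S]=S^*S-SS^*$ is compact. A single Blaschke factor is a function $\lambda\,\frac{z-a}{1-\bar a z}$ with $a\in\mathbb{D}$, $|\lambda|=1$; a finite Blaschke product is a unimodular constant times a finite product of such factors.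
   Formalization: The claim for S_{z_1} is proved for non-constant φ and the claim for S_{z_2} for non-constant ψ; for constant φ the first claim fails, e.g. φ = 1 and ψ(z) = z, where S_{z_1} is essentially normal but φ is not a Blaschke factor. *)

theory Defs
  imports "HOL-Analysis.Analysis"
begin

definition bidisk :: "(complex \<times> complex) set" where
  "bidisk = ball 0 1 \<times> ball 0 1"

text \<open>Power series on the bidisk with square-summable coefficients. Elements of the Hardy
  space are normalised to vanish off the bidisk, so that equality of functions on
  \<^typ>\<open>complex \<times> complex\<close> is equality in the Hardy space.\<close>

definition h2_expansion :: "(nat \<times> nat \<Rightarrow> complex) \<Rightarrow> (complex \<times> complex \<Rightarrow> complex) \<Rightarrow> bool" where
  "h2_expansion a f \<longleftrightarrow>
     (\<lambda>k. (norm (a k))\<^sup>2) summable_on UNIV \<and>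
     (\<forall>z\<in>bidisk. ((\<lambda>(m, n). a (m, n) * fst z ^ m * snd z ^ n) has_sum f z) UNIV)"

definition hardy2 :: "(complex \<times> complex \<Rightarrow> complex) set" where
  "hardy2 = {f. (\<exists>a. h2_expansion a f) \<and> (\<forall>z. z \<notin> bidisk \<longrightarrow> f z = 0)}"

definition h2_coeff :: "(complex \<times> complex \<Rightarrow> complex) \<Rightarrow> nat \<times> nat \<Rightarrow> complex" where
  "h2_coeff f = (THE a. h2_expansion a f)"

definition h2_inner ::
  "(complex \<times> complex \<Rightarrow> complex) \<Rightarrow> (complex \<times> complex \<Rightarrow> complex) \<Rightarrow> complex" where
  "h2_inner f g = (\<Sum>\<^sub>\<infinity>k. h2_coeff f k * cnj (h2_coeff g k))"

definition h2_norm :: "(complex \<times> complex \<Rightarrow> complex) \<Rightarrow> real" where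
  "h2_norm f = sqrt (Re (h2_inner f f))"

definition model_space ::
  "(complex \<times> complex \<Rightarrow> complex) \<Rightarrow> (complex \<times> complex \<Rightarrow> complex) set" where
  "model_space \<theta> = {f \<in> hardy2. \<forall>g\<in>hardy2. h2_inner f (\<lambda>z. \<theta> z * g z) = 0}"

text \<open>In the following definitions \<open>K\<close> is meant to be a closed subspace of \<^const>\<open>hardy2\<close>, and
  \<open>A\<close> a bounded linear operator on \<open>K\<close>; only the values of \<open>A\<close> on \<open>K\<close> matter.\<close>

definition orth_proj ::
  "(complex \<times> complex \<Rightarrow> complex) set \<Rightarrow> (complex \<times> complex \<Rightarrow> complex)
     \<Rightarrow> (complex \<times> complex \<Rightarrow> complex)" where
  "orth_proj K f = (THE g. g \<in> K \<and> (\<forall>h\<in>K. h2_inner (\<lambda>z. f z - g z) h = 0))"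

definition adjoint_on ::
  "(complex \<times> complex \<Rightarrow> complex) set
     \<Rightarrow> ((complex \<times> complex \<Rightarrow> complex) \<Rightarrow> (complex \<times> complex \<Rightarrow> complex))
     \<Rightarrow> ((complex \<times> complex \<Rightarrow> complex) \<Rightarrow> (complex \<times> complex \<Rightarrow> complex))" where
  "adjoint_on K A g = (THE h. h \<in> K \<and> (\<forall>f\<in>K. h2_inner (A f) g = h2_inner f h))"

definition compact_operator_on ::
  "(complex \<times> complex \<Rightarrow> complex) set
     \<Rightarrow> ((complex \<times> complex \<Rightarrow> complex) \<Rightarrow> (complex \<times> complex \<Rightarrow> complex)) \<Rightarrow> bool" where
  "compact_operator_on K A \<longleftrightarrow>
     (\<forall>X :: nat \<Rightarrow> complex \<times> complex \<Rightarrow> complex.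
        range X \<subseteq> K \<and> (\<exists>C. \<forall>n. h2_norm (X n) \<le> C) \<longrightarrow>
        (\<exists>r g. strict_mono r \<and> g \<in> K \<and>
           (\<lambda>n. h2_norm (\<lambda>z. A (X (r n)) z - g z)) \<longlonglongrightarrow> 0))"

definition essentially_normal_on ::
  "(complex \<times> complex \<Rightarrow> complex) set
     \<Rightarrow> ((complex \<times> complex \<Rightarrow> complex) \<Rightarrow> (complex \<times> complex \<Rightarrow> complex)) \<Rightarrow> bool" where
  "essentially_normal_on K S \<longleftrightarrow>
     compact_operator_on K
       (\<lambda>f z. adjoint_on K S (S f) z - S (adjoint_on K S f) z)"

definition S_z1 ::
  "(complex \<times> complex \<Rightarrow> complex) \<Rightarrow> (complex \<times> complex \<Rightarrow> complex)
     \<Rightarrow> (complex \<times> complex \<Rightarrow> complex)" where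
  "S_z1 \<theta> f = orth_proj (model_space \<theta>) (\<lambda>z. fst z * f z)"

definition S_z2 ::
  "(complex \<times> complex \<Rightarrow> complex) \<Rightarrow> (complex \<times> complex \<Rightarrow> complex)
     \<Rightarrow> (complex \<times> complex \<Rightarrow> complex)" where
  "S_z2 \<theta> f = orth_proj (model_space \<theta>) (\<lambda>z. snd z * f z)"

text \<open>Boundary values are taken as radial limits. One-variable functions are only looked at
  inside the open unit disk; their values elsewhere are irrelevant.\<close>

definition inner_function :: "(complex \<Rightarrow> complex) \<Rightarrow> bool" where
  "inner_function \<phi> \<longleftrightarrow>
     \<phi> holomorphic_on ball 0 1 \<and>
     bounded (\<phi> ` ball 0 1) \<and>
     (AE t in lebesgue_on {0..2 * pi}.
        \<exists>l. norm l = 1 \<and> ((\<lambda>r. \<phi> (of_real r * cis t)) \<longlongrightarrow> l) (at_left 1))"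

definition single_blaschke_factor :: "(complex \<Rightarrow> complex) \<Rightarrow> bool" where
  "single_blaschke_factor \<phi> \<longleftrightarrow>
     (\<exists>c a. norm c = 1 \<and> norm a < 1 \<and>
        (\<forall>z\<in>ball 0 1. \<phi> z = c * ((z - a) / (1 - cnj a * z))))"

text \<open>The empty product is allowed: unimodular constants are finite Blaschke products.\<close>

definition finite_blaschke_product :: "(complex \<Rightarrow> complex) \<Rightarrow> bool" where
  "finite_blaschke_product \<phi> \<longleftrightarrow>
     (\<exists>c Bs. norm c = 1 \<and> (\<forall>B\<in>set Bs. single_blaschke_factor B) \<and>
        (\<forall>z\<in>ball 0 1. \<phi> z = c * (\<Prod>B\<leftarrow>Bs. B z)))"

end

theory Submission
  imports Defs "HOL-Complex_Analysis.Complex_Analysis"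
begin

text \<open>
  In coefficients, \<open>K\<^sub>\<theta>\<close> is the orthogonal sum of \<open>H\<^sup>2 \<otimes> K\<^sub>\<psi>\<close> and \<open>K\<^sub>\<phi> \<otimes> \<psi> H\<^sup>2\<close>. Both
  summands reduce \<open>S\<^sub>z\<^sub>1\<close>, which acts on them as \<open>T\<^sub>z \<otimes> I\<close> and \<open>S\<^sub>\<phi> \<otimes> I\<close>. Hence the self-commutator
  is \<open>E\<^sub>0 \<otimes> I\<close> on the first summand, with \<open>E\<^sub>0\<close> the projection onto the constants, and
  \<open>[S\<^sub>\<phi>\<^sup>*, S\<^sub>\<phi>] \<otimes> I\<close> on the second. It is compact iff the unit ball of \<open>K\<^sub>\<psi>\<close> is compact and \<open>S\<^sub>\<phi>\<close> is
  normal. Moreover \<open>[S\<^sub>\<phi>\<^sup>*, S\<^sub>\<phi>]\<close> is the difference of the rank one operators given by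
  \<open>1 - cnj (\<phi> 0) \<phi>\<close> and \<open>(\<phi> - \<phi> 0) / z\<close>, which have the same norm, so it vanishes iff the two
  functions agree up to a unimodular constant, that is, iff \<open>\<phi>\<close> is a Blaschke factor.
\<close>

section \<open>Square-summable sequences\<close>

text \<open>Of the boundary values of an inner function one fact is kept, \<open>inner_seq\<close>:
  the translates of its coefficient sequence are orthonormal. Sequences are indexed by any
  cancellative commutative monoid, so one development serves the disk (\<open>nat\<close>) and the
  bidisk (\<open>nat \<times> nat\<close>). Finite dimension is never mentioned. It appears as
  compactness of the identity on a model space, which is what test sequences for the commutator
  yield directly and what can be compared with the boundary behaviour of psi. The case that shapes
  the statement is a constant phi. Then the model space of phi is zero, the second summand
  disappears, and the commutator is compact for every finite Blaschke product psi although phi is no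
  Blaschke factor. Hence the nonconstancy hypotheses; they enter as
  \<open>norm (\<alpha> 0) < 1\<close>, which makes 1 - cnj (phi 0) phi nonzero and usable as a test
  vector.\<close>

definition l2 :: "('k \<Rightarrow> complex) \<Rightarrow> bool" where
  "l2 a \<longleftrightarrow> (\<lambda>k. (norm (a k))\<^sup>2) summable_on UNIV"

definition ip :: "('k \<Rightarrow> complex) \<Rightarrow> ('k \<Rightarrow> complex) \<Rightarrow> complex" where
  "ip a b = (\<Sum>\<^sub>\<infinity>k. a k * cnj (b k))"

definition nrm :: "('k \<Rightarrow> complex) \<Rightarrow> real" where
  "nrm a = sqrt (\<Sum>\<^sub>\<infinity>k. (norm (a k))\<^sup>2)"

lemma nrm_nonneg [simp]: "0 \<le> nrm a"
  unfolding nrm_def by (simp add: infsum_nonneg)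

lemma nrm_sq: "(nrm a)\<^sup>2 = (\<Sum>\<^sub>\<infinity>k. (norm (a k))\<^sup>2)"
  unfolding nrm_def by (simp add: infsum_nonneg)

lemma L2_set_le_nrm:
  assumes "l2 a" "finite F"
  shows "L2_set (\<lambda>k. norm (a k)) F \<le> nrm a"
  unfolding L2_set_def nrm_def
  by (intro real_sqrt_le_mono finite_sum_le_infsum) (use assms in \<open>auto simp: l2_def\<close>)

lemma norm_le_nrm: "l2 a \<Longrightarrow> norm (a k) \<le> nrm a"
  using L2_set_le_nrm[of a "{k}"] by simp

text \<open>A bound on all finite sections gives membership and the norm estimate at once; the
  boundedness of \<open>analysis\<close>, \<open>bshift\<close> and \<open>pin\<close> is obtained
  in this way.\<close>

lemma l2I_L2_set:
  assumes "\<And>F. finite F \<Longrightarrow> L2_set (\<lambda>k. norm (a k)) F \<le> B"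
  shows "l2 a" "nrm a \<le> B"
proof -
  have B: "0 \<le> B" using assms[of "{}"] by simp
  have *: "(\<Sum>k\<in>F. (norm (a k))\<^sup>2) \<le> B\<^sup>2" if "finite F" for F
    using assms[OF that] unfolding L2_set_def by (simp add: sqrt_le_D)
  show l: "l2 a"
    unfolding l2_def by (rule nonneg_bdd_above_summable_on) (auto intro!: bdd_aboveI[of _ "B\<^sup>2"] *)
  have "(nrm a)\<^sup>2 \<le> B\<^sup>2"
    unfolding nrm_sq by (rule infsum_le_finite_sums) (use l * in \<open>auto simp: l2_def\<close>)
  then show "nrm a \<le> B" using B by (simp add: power2_le_iff_abs_le)
qed

lemma l2_add [intro]: "l2 a \<Longrightarrow> l2 b \<Longrightarrow> l2 (\<lambda>k. a k + b k)"
  and nrm_triangle: "l2 a \<Longrightarrow> l2 b \<Longrightarrow> nrm (\<lambda>k. a k + b k) \<le> nrm a + nrm b"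
proof -
  have *: "L2_set (\<lambda>k. norm (a k + b k)) F \<le> nrm a + nrm b" if "l2 a" "l2 b" "finite F" for F
  proof -
    have "L2_set (\<lambda>k. norm (a k + b k)) F \<le> L2_set (\<lambda>k. norm (a k) + norm (b k)) F"
      by (rule L2_set_mono) (auto simp: norm_triangle_ineq)
    also have "\<dots> \<le> L2_set (\<lambda>k. norm (a k)) F + L2_set (\<lambda>k. norm (b k)) F"
      by (rule L2_set_triangle_ineq)
    finally show ?thesis using L2_set_le_nrm[of a F] L2_set_le_nrm[of b F] that by linarith
  qed
  show "l2 a \<Longrightarrow> l2 b \<Longrightarrow> l2 (\<lambda>k. a k + b k)"
    "l2 a \<Longrightarrow> l2 b \<Longrightarrow> nrm (\<lambda>k. a k + b k) \<le> nrm a + nrm b"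
    using l2I_L2_set[of "\<lambda>k. a k + b k"] * by blast+
qed

lemma l2_cmult [intro]: "l2 a \<Longrightarrow> l2 (\<lambda>k. c * a k)"
  unfolding l2_def norm_mult power_mult_distrib by (rule summable_on_cmult_right)

lemma nrm_cmult: "nrm (\<lambda>k. c * a k) = norm c * nrm a"
  unfolding nrm_def norm_mult power_mult_distrib infsum_cmult_right'
  by (simp add: real_sqrt_mult)

lemma l2_uminus [intro]: "l2 a \<Longrightarrow> l2 (\<lambda>k. - a k)"
  by (simp add: l2_def)

lemma nrm_uminus [simp]: "nrm (\<lambda>k. - a k) = nrm a"
  by (simp add: nrm_def)

lemma nrm_commute: "nrm (\<lambda>k. a k - b k) = nrm (\<lambda>k. b k - a k)"
  by (simp add: nrm_def norm_minus_commute)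

lemma l2_diff [intro]: "l2 a \<Longrightarrow> l2 b \<Longrightarrow> l2 (\<lambda>k. a k - b k)"
  using l2_add[of a "\<lambda>k. - b k"] l2_uminus[of b] by simp

lemma nrm_triangle_diff: "l2 a \<Longrightarrow> l2 b \<Longrightarrow> nrm (\<lambda>k. a k - b k) \<le> nrm a + nrm b"
  using nrm_triangle[of a "\<lambda>k. - b k"] l2_uminus[of b] by simp

lemma nrm_dist_triangle:
  "l2 a \<Longrightarrow> l2 b \<Longrightarrow> l2 c \<Longrightarrow> nrm (\<lambda>k. a k - c k) \<le> nrm (\<lambda>k. a k - b k) + nrm (\<lambda>k. b k - c k)"
  using nrm_triangle[of "\<lambda>k. a k - b k" "\<lambda>k. b k - c k"] by (simp add: l2_diff)

lemma l2_zero [intro, simp]: "l2 (\<lambda>k. 0)"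
  by (simp add: l2_def)

lemma nrm_zero [simp]: "nrm (\<lambda>k. 0) = 0"
  by (simp add: nrm_def)

lemma l2_finite_support: "finite {k. a k \<noteq> 0} \<Longrightarrow> l2 a"
  unfolding l2_def by (rule finite_nonzero_values_imp_summable_on) auto

lemma l2_sum [intro]: "(\<And>i. i \<in> F \<Longrightarrow> l2 (a i)) \<Longrightarrow> l2 (\<lambda>k. \<Sum>i\<in>F. a i k)"
  by (induction F rule: infinite_finite_induct) auto

lemma l2_comp_inj:
  assumes "l2 a" "inj h" shows "l2 (\<lambda>k. a (h k))"
proof -
  have "(\<lambda>k. (norm (a k))\<^sup>2) summable_on range h"
    using assms summable_on_subset_banach unfolding l2_def by blast
  then show ?thesis
    using summable_on_reindex[OF assms(2), of "\<lambda>k. (norm (a k))\<^sup>2"] by (simp add: l2_def o_def)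
qed

lemma nrm_comp_bij: assumes "bij h" shows "nrm (\<lambda>k. a (h k)) = nrm a"
  unfolding nrm_def using infsum_reindex_bij_betw[OF assms, of "\<lambda>k. (norm (a k))\<^sup>2"] by simp

lemma ip_comp_bij: assumes "bij h" shows "ip (\<lambda>k. a (h k)) (\<lambda>k. b (h k)) = ip a b"
  unfolding ip_def using infsum_reindex_bij_betw[OF assms, of "\<lambda>k. a k * cnj (b k)"] by simp

lemma nrm_eq_0: assumes "l2 a" "nrm a = 0" shows "a = (\<lambda>k. 0)"
proof
  show "a k = 0" for k using norm_le_nrm[OF assms(1), of k] assms(2) by simp
qed

lemma Cauchy_Schwarz_abs:
  assumes "l2 a" "l2 b"
  shows "(\<lambda>k. norm (a k * cnj (b k))) summable_on UNIV"
    and "(\<Sum>\<^sub>\<infinity>k. norm (a k * cnj (b k))) \<le> nrm a * nrm b"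
proof -
  have *: "(\<Sum>k\<in>F. norm (a k * cnj (b k))) \<le> nrm a * nrm b" if "finite F" for F
  proof -
    have "(\<Sum>k\<in>F. norm (a k * cnj (b k))) \<le> L2_set (\<lambda>k. norm (a k)) F * L2_set (\<lambda>k. norm (b k)) F"
      using L2_set_mult_ineq[of "\<lambda>k. norm (a k)" "\<lambda>k. norm (b k)" F] by (simp add: norm_mult)
    also have "\<dots> \<le> nrm a * nrm b"
      by (intro mult_mono L2_set_le_nrm assms that) auto
    finally show ?thesis .
  qed
  show s: "(\<lambda>k. norm (a k * cnj (b k))) summable_on UNIV"
    by (rule nonneg_bdd_above_summable_on) (auto intro!: bdd_aboveI[of _ "nrm a * nrm b"] *)
  show "(\<Sum>\<^sub>\<infinity>k. norm (a k * cnj (b k))) \<le> nrm a * nrm b"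
    by (rule infsum_le_finite_sums) (use s * in auto)
qed

lemma ip_summable: "l2 a \<Longrightarrow> l2 b \<Longrightarrow> (\<lambda>k. a k * cnj (b k)) summable_on UNIV"
  by (rule abs_summable_summable) (rule Cauchy_Schwarz_abs(1))

lemma ip_has_sum: "l2 a \<Longrightarrow> l2 b \<Longrightarrow> ((\<lambda>k. a k * cnj (b k)) has_sum ip a b) UNIV"
  unfolding ip_def by (simp add: ip_summable)

lemma norm_ip_le: "l2 a \<Longrightarrow> l2 b \<Longrightarrow> norm (ip a b) \<le> nrm a * nrm b"
  unfolding ip_def
  by (rule order_trans[OF norm_infsum_bound[OF Cauchy_Schwarz_abs(1)] Cauchy_Schwarz_abs(2)])

lemma ip_cnj: "cnj (ip a b) = ip b a"
  unfolding ip_def infsum_cnj[symmetric] by (simp add: mult.commute)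

lemma ip_add_left: "l2 a \<Longrightarrow> l2 b \<Longrightarrow> l2 c \<Longrightarrow> ip (\<lambda>k. a k + b k) c = ip a c + ip b c"
  unfolding ip_def distrib_right by (intro infsum_add ip_summable)

lemma ip_diff_left: "l2 a \<Longrightarrow> l2 b \<Longrightarrow> l2 c \<Longrightarrow> ip (\<lambda>k. a k - b k) c = ip a c - ip b c"
  using ip_add_left[of "\<lambda>k. a k - b k" b c] by (auto simp: l2_diff)

lemma ip_cmult_left: "ip (\<lambda>k. x * a k) c = x * ip a c"
  unfolding ip_def by (simp add: mult.assoc infsum_cmult_right')

lemma ip_cmult_right: "ip a (\<lambda>k. x * c k) = cnj x * ip a c"
  unfolding ip_def by (simp add: mult.left_commute infsum_cmult_right')

lemma ip_add_right: "l2 a \<Longrightarrow> l2 b \<Longrightarrow> l2 c \<Longrightarrow> ip a (\<lambda>k. b k + c k) = ip a b + ip a c"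
  using ip_add_left[of b c a] by (simp add: ip_cnj[of _ a, symmetric])

lemma ip_diff_right: "l2 a \<Longrightarrow> l2 b \<Longrightarrow> l2 c \<Longrightarrow> ip a (\<lambda>k. b k - c k) = ip a b - ip a c"
  using ip_diff_left[of b c a] by (simp add: ip_cnj[of _ a, symmetric])

lemma ip_zero [simp]: "ip (\<lambda>k. 0) a = 0" "ip a (\<lambda>k. 0) = 0"
  by (simp_all add: ip_def)

lemma ip_sum_right: "l2 a \<Longrightarrow> (\<And>i. i \<in> F \<Longrightarrow> l2 (b i)) \<Longrightarrow> ip a (\<lambda>k. \<Sum>i\<in>F. b i k) = (\<Sum>i\<in>F. ip a (b i))"
  by (induction F rule: infinite_finite_induct) (auto simp: ip_add_right l2_sum)

lemma ip_sum_left: "l2 a \<Longrightarrow> (\<And>i. i \<in> F \<Longrightarrow> l2 (b i)) \<Longrightarrow> ip (\<lambda>k. \<Sum>i\<in>F. b i k) a = (\<Sum>i\<in>F. ip (b i) a)"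
  by (induction F rule: infinite_finite_induct) (auto simp: ip_add_left l2_sum)

lemma ip_self: "ip a a = of_real ((nrm a)\<^sup>2)"
proof (cases "l2 a")
  case True
  then have "((\<lambda>k. (norm (a k))\<^sup>2) has_sum (nrm a)\<^sup>2) UNIV"
    by (simp add: nrm_sq l2_def)
  then have "((\<lambda>k. complex_of_real ((norm (a k))\<^sup>2)) has_sum of_real ((nrm a)\<^sup>2)) UNIV"
    by (simp only: has_sum_of_real_iff)
  then show ?thesis
    unfolding ip_def by (intro infsumI) (simp add: complex_norm_square del: of_real_power)
next
  case False
  then have "\<not> (\<lambda>k. complex_of_real ((norm (a k))\<^sup>2)) summable_on UNIV"
    unfolding l2_def using summable_on_Re by force
  then have "\<not> (\<lambda>k. a k * cnj (a k)) summable_on UNIV"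
    by (simp add: complex_norm_square del: of_real_power)
  \<comment> \<open>Neither sum exists here, so both take the default value 0; the identity thus
    becomes an unconditional rewrite rule.\<close>
  then show ?thesis
    using False by (simp add: ip_def nrm_def l2_def infsum_not_exists)
qed

lemma nrm_sq_diff:
  assumes "l2 a" "l2 b"
  shows "(nrm (\<lambda>k. a k - b k))\<^sup>2 = (nrm a)\<^sup>2 + (nrm b)\<^sup>2 - 2 * Re (ip a b)"
proof -
  have "ip (\<lambda>k. a k - b k) (\<lambda>k. a k - b k) = ip a a - ip b a - (ip a b - ip b b)"
    using assms by (simp add: ip_diff_right ip_diff_left l2_diff algebra_simps)
  moreover have "Re (ip b a) = Re (ip a b)"
    by (simp flip: ip_cnj[of a b])
  ultimately show ?thesis
    by (simp add: ip_self complex_eq_iff del: of_real_power)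
qed

text \<open>A Fatou argument: each finite section of the limit inherits the bound, so pointwise
  convergence suffices. The filter is general because the lemma is used along sequences and along
  finite index sets.\<close>

lemma l2_limit:
  assumes "F \<noteq> bot" "\<And>k. ((\<lambda>n. X n k) \<longlongrightarrow> g k) F"
    and "\<forall>\<^sub>F n in F. l2 (X n) \<and> nrm (X n) \<le> B"
  shows "l2 g" "nrm g \<le> B"
proof -
  have *: "L2_set (\<lambda>k. norm (g k)) A \<le> B" if "finite A" for A
  proof (rule tendsto_upperbound)
    show "((\<lambda>n. L2_set (\<lambda>k. norm (X n k)) A) \<longlongrightarrow> L2_set (\<lambda>k. norm (g k)) A) F"
      unfolding L2_set_def by (intro tendsto_intros assms)
    show "\<forall>\<^sub>F n in F. L2_set (\<lambda>k. norm (X n k)) A \<le> B"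
      using assms(3) by eventually_elim (use L2_set_le_nrm \<open>finite A\<close> in \<open>auto intro: order_trans\<close>)
  qed (fact assms(1))
  show "l2 g" "nrm g \<le> B" by (rule l2I_L2_set[OF *]; assumption)+
qed

lemma l2_complete:
  assumes X: "\<And>n. l2 (X n)"
    and C: "\<And>e. e > 0 \<Longrightarrow> \<exists>N. \<forall>m\<ge>N. \<forall>n\<ge>N. nrm (\<lambda>k. X m k - X n k) \<le> e"
  shows "\<exists>g. l2 g \<and> (\<lambda>n. nrm (\<lambda>k. X n k - g k)) \<longlonglongrightarrow> 0"
proof -
  have "\<exists>l. (\<lambda>n. X n k) \<longlonglongrightarrow> l" for k
  proof -
    have "Cauchy (\<lambda>n. X n k)"
    proof (rule CauchyI)
      fix e :: real assume "e > 0"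
      then obtain N where N: "\<forall>m\<ge>N. \<forall>n\<ge>N. nrm (\<lambda>k. X m k - X n k) \<le> e / 2"
        using C[of "e/2"] by auto
      have "norm (X m k - X n k) < e" if "m \<ge> N" "n \<ge> N" for m n
        using N that norm_le_nrm[OF l2_diff[OF X[of m] X[of n]], of k] \<open>e > 0\<close> by fastforce
      then show "\<exists>M. \<forall>m\<ge>M. \<forall>n\<ge>M. norm (X m k - X n k) < e" by blast
    qed
    then show ?thesis using Cauchy_convergent_iff convergent_def by blast
  qed
  then obtain g where g: "\<And>k. (\<lambda>n. X n k) \<longlonglongrightarrow> g k" by metis
  \<comment> \<open>Let the second index tend to infinity in the Cauchy estimate;
    \<open>l2_limit\<close> turns coordinatewise limits into norm control.\<close>
  have *: "\<exists>N. \<forall>n\<ge>N. l2 (\<lambda>k. X n k - g k) \<and> nrm (\<lambda>k. X n k - g k) \<le> e" if "e > 0" for e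
  proof -
    obtain N where N: "\<forall>m\<ge>N. \<forall>n\<ge>N. nrm (\<lambda>k. X m k - X n k) \<le> e"
      using C[of e] \<open>e > 0\<close> by auto
    have "l2 (\<lambda>k. X m k - g k) \<and> nrm (\<lambda>k. X m k - g k) \<le> e" if "m \<ge> N" for m
    proof -
      have t: "\<And>k. (\<lambda>n. X m k - X n k) \<longlonglongrightarrow> X m k - g k" by (intro tendsto_intros g)
      have e: "\<forall>\<^sub>F n in sequentially. l2 (\<lambda>k. X m k - X n k) \<and> nrm (\<lambda>k. X m k - X n k) \<le> e"
        using eventually_ge_at_top[of N] by eventually_elim (use N that X in auto)
      from l2_limit[OF sequentially_bot t e] show ?thesis by blast
    qed
    then show ?thesis by blast
  qed
  obtain N where "l2 (\<lambda>k. X N k - g k)" using *[of 1] by auto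
  then have "l2 (\<lambda>k. X N k - (X N k - g k))" by (rule l2_diff[OF X])
  then have "l2 g" by simp
  moreover have "(\<lambda>n. nrm (\<lambda>k. X n k - g k)) \<longlonglongrightarrow> 0"
  proof (rule LIMSEQ_I)
    fix e :: real assume "e > 0"
    then obtain N where "\<forall>n\<ge>N. nrm (\<lambda>k. X n k - g k) \<le> e / 2" using *[of "e/2"] by auto
    then show "\<exists>N. \<forall>n\<ge>N. norm (nrm (\<lambda>k. X n k - g k) - 0) < e" using \<open>e > 0\<close> by fastforce
  qed
  ultimately show ?thesis by blast
qed

section \<open>Orthonormal families\<close>

definition unit_seq :: "'k \<Rightarrow> 'k \<Rightarrow> complex" where
  "unit_seq k j = (if j = k then 1 else 0)"

lemma l2_unit [simp, intro]: "l2 (unit_seq k)"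
  by (rule l2_finite_support) (auto simp: unit_seq_def)

lemma ip_unit_right [simp]: "ip a (unit_seq k) = a k"
proof -
  have "((\<lambda>j. a j * cnj (unit_seq k j)) has_sum a k) UNIV"
    by (rule has_sum_finite_neutralI[of "{k}"]) (auto simp: unit_seq_def)
  then show ?thesis unfolding ip_def by (rule infsumI)
qed

lemma ip_unit_left [simp]: "ip (unit_seq k) a = cnj (a k)"
  by (simp flip: ip_cnj[of a])

definition orthonormal :: "('k \<Rightarrow> 'l \<Rightarrow> complex) \<Rightarrow> bool" where
  "orthonormal e \<longleftrightarrow> (\<forall>k. l2 (e k)) \<and> (\<forall>j k. ip (e j) (e k) = (if j = k then 1 else 0))"

text \<open>The series is summed in each coordinate, so its norm convergence need not be discussed;
  \<open>ip_synthesis_right\<close> identifies the result as the adjoint of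
  \<open>analysis\<close>.\<close>

definition synthesis :: "('k \<Rightarrow> 'l \<Rightarrow> complex) \<Rightarrow> ('k \<Rightarrow> complex) \<Rightarrow> 'l \<Rightarrow> complex" where
  "synthesis e g l = (\<Sum>\<^sub>\<infinity>k. g k * e k l)"

definition analysis :: "('k \<Rightarrow> 'l \<Rightarrow> complex) \<Rightarrow> ('l \<Rightarrow> complex) \<Rightarrow> 'k \<Rightarrow> complex" where
  "analysis e f k = ip f (e k)"

lemma eventually_finite_subset: "\<forall>\<^sub>F F in finite_subsets_at_top UNIV. finite F"
  by (rule eventually_finite_subsets_at_top_weakI)

lemma analysis_diff: "l2 f \<Longrightarrow> l2 g \<Longrightarrow> orthonormal e \<Longrightarrow> analysis e (\<lambda>k. f k - g k) = (\<lambda>k. analysis e f k - analysis e g k)"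
  by (auto simp: analysis_def orthonormal_def ip_diff_left fun_eq_iff)

lemma analysis_cmult: "analysis e (\<lambda>k. c * f k) = (\<lambda>k. c * analysis e f k)"
  by (auto simp: analysis_def ip_cmult_left fun_eq_iff)

lemma analysis_zero [simp]: "analysis e (\<lambda>k. 0) = (\<lambda>k. 0)"
  by (auto simp: analysis_def fun_eq_iff)

lemma orthonormal_finite_sum:
  assumes e: "orthonormal e" and F: "finite F"
  shows "l2 (\<lambda>l. \<Sum>k\<in>F. g k * e k l)"
    and "nrm (\<lambda>l. \<Sum>k\<in>F. g k * e k l) = L2_set (\<lambda>k. norm (g k)) F"
    and "l2 f \<Longrightarrow> ip f (\<lambda>l. \<Sum>k\<in>F. g k * e k l) = (\<Sum>k\<in>F. analysis e f k * cnj (g k))"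
proof -
  have l: "l2 (\<lambda>l. g k * e k l)" for k using e by (auto simp: orthonormal_def)
  then show s: "l2 (\<lambda>l. \<Sum>k\<in>F. g k * e k l)" by (rule l2_sum)
  show i: "ip f (\<lambda>l. \<Sum>k\<in>F. g k * e k l) = (\<Sum>k\<in>F. analysis e f k * cnj (g k))" if "l2 f" for f
    using l that by (simp add: ip_sum_right ip_cmult_right analysis_def mult.commute)
  have "analysis e (\<lambda>l. \<Sum>j\<in>F. g j * e j l) k = g k" if "k \<in> F" for k
  proof -
    have "analysis e (\<lambda>l. \<Sum>j\<in>F. g j * e j l) k = (\<Sum>j\<in>F. if j = k then g j else 0)"
      using l e by (auto simp: analysis_def orthonormal_def ip_sum_left ip_cmult_left intro!: sum.cong)
    then show ?thesis using F that by simp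
  qed
  then have "ip (\<lambda>l. \<Sum>k\<in>F. g k * e k l) (\<lambda>l. \<Sum>k\<in>F. g k * e k l) = (\<Sum>k\<in>F. of_real ((norm (g k))\<^sup>2))"
    unfolding i[OF s] by (intro sum.cong refl) (simp add: complex_norm_square del: of_real_power)
  then have "of_real ((nrm (\<lambda>l. \<Sum>k\<in>F. g k * e k l))\<^sup>2) = complex_of_real (\<Sum>k\<in>F. (norm (g k))\<^sup>2)"
    by (simp add: ip_self)
  then have "(nrm (\<lambda>l. \<Sum>k\<in>F. g k * e k l))\<^sup>2 = (\<Sum>k\<in>F. (norm (g k))\<^sup>2)"
    using of_real_eq_iff by blast
  then show "nrm (\<lambda>l. \<Sum>k\<in>F. g k * e k l) = L2_set (\<lambda>k. norm (g k)) F"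
    unfolding L2_set_def by (metis nrm_nonneg real_sqrt_abs abs_of_nonneg)
qed

lemma Bessel:
  assumes e: "orthonormal e" and f: "l2 f"
  shows "l2 (analysis e f)" "nrm (analysis e f) \<le> nrm f"
proof -
  have *: "L2_set (\<lambda>k. norm (analysis e f k)) F \<le> nrm f" if F: "finite F" for F
  proof -
    define s where "s = (\<lambda>l. \<Sum>k\<in>F. analysis e f k * e k l)"
    have s: "l2 s" "nrm s = L2_set (\<lambda>k. norm (analysis e f k)) F"
      unfolding s_def using orthonormal_finite_sum[OF e F] by auto
    have "ip f s = of_real (\<Sum>k\<in>F. (norm (analysis e f k))\<^sup>2)"
      unfolding s_def orthonormal_finite_sum(3)[OF e F f] by (simp add: complex_norm_square del: of_real_power)
    also have "(\<Sum>k\<in>F. (norm (analysis e f k))\<^sup>2) = (nrm s)\<^sup>2"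
      unfolding s L2_set_def by (simp add: sum_nonneg)
    finally have "(nrm (\<lambda>k. f k - s k))\<^sup>2 = (nrm f)\<^sup>2 - (nrm s)\<^sup>2"
      using nrm_sq_diff[OF f s(1)] by simp
    then have "(nrm s)\<^sup>2 \<le> (nrm f)\<^sup>2" by (smt (verit) zero_le_power2)
    then show ?thesis using s(2) by (simp add: power2_le_iff_abs_le)
  qed
  show "l2 (analysis e f)" "nrm (analysis e f) \<le> nrm f" by (rule l2I_L2_set[OF *]; assumption)+
qed

text \<open>For fixed \<open>l\<close> the numbers \<open>e k l\<close> are, up to conjugation, the
  coefficients of \<open>unit_seq l\<close>, hence square-summable by Bessel.\<close>

lemma synthesis_has_sum:
  assumes e: "orthonormal e" and g: "l2 g"
  shows "((\<lambda>k. g k * e k l) has_sum synthesis e g l) UNIV"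
proof -
  have "l2 (analysis e (unit_seq l))" by (intro Bessel e l2_unit)
  then have "(\<lambda>k. g k * e k l) summable_on UNIV"
    using ip_summable[OF g, of "analysis e (unit_seq l)"] by (simp add: analysis_def)
  then show ?thesis by (simp add: synthesis_def)
qed

lemma
  assumes e: "orthonormal e" and g: "l2 g"
  shows l2_synthesis: "l2 (synthesis e g)" and nrm_synthesis_le: "nrm (synthesis e g) \<le> nrm g"
proof -
  have t: "((\<lambda>F. \<Sum>k\<in>F. g k * e k l) \<longlongrightarrow> synthesis e g l) (finite_subsets_at_top UNIV)" for l
    using synthesis_has_sum[OF e g] by (simp add: has_sum_def)
  have "\<forall>\<^sub>F F in finite_subsets_at_top UNIV. l2 (\<lambda>l. \<Sum>k\<in>F. g k * e k l) \<and> nrm (\<lambda>l. \<Sum>k\<in>F. g k * e k l) \<le> nrm g"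
    using eventually_finite_subset
    by eventually_elim (use orthonormal_finite_sum[OF e] L2_set_le_nrm[OF g] in auto)
  from l2_limit[OF finite_subsets_at_top_neq_bot t this]
  show "l2 (synthesis e g)" "nrm (synthesis e g) \<le> nrm g" by auto
qed

lemma synthesis_diff:
  assumes "orthonormal e" "l2 g" "l2 h"
  shows "synthesis e (\<lambda>k. g k - h k) = (\<lambda>l. synthesis e g l - synthesis e h l)"
proof
  fix l
  have "((\<lambda>k. g k * e k l + - (h k * e k l)) has_sum synthesis e g l + - synthesis e h l) UNIV"
    using assms by (intro has_sum_add synthesis_has_sum has_sum_uminusI) auto
  then show "synthesis e (\<lambda>k. g k - h k) l = synthesis e g l - synthesis e h l"
    unfolding synthesis_def[of _ "\<lambda>k. g k - h k"] by (intro infsumI) (simp add: algebra_simps)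
qed

lemma synthesis_cmult: "synthesis e (\<lambda>k. c * g k) = (\<lambda>l. c * synthesis e g l)"
  by (auto simp: synthesis_def fun_eq_iff infsum_cmult_right' mult.assoc)

lemma synthesis_zero [simp]: "synthesis e (\<lambda>k. 0) = (\<lambda>l. 0)"
  by (simp add: synthesis_def fun_eq_iff)

lemma synthesis_finite:
  assumes "finite F" shows "synthesis e (\<lambda>k. if k \<in> F then g k else 0) = (\<lambda>l. \<Sum>k\<in>F. g k * e k l)"
proof
  fix l
  have "((\<lambda>k. (if k \<in> F then g k else 0) * e k l) has_sum (\<Sum>k\<in>F. g k * e k l)) UNIV"
    by (rule has_sum_finite_neutralI[OF assms]) auto
  then show "synthesis e (\<lambda>k. if k \<in> F then g k else 0) l = (\<Sum>k\<in>F. g k * e k l)"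
    unfolding synthesis_def by (rule infsumI)
qed

lemma truncation_tendsto:
  assumes g: "l2 g"
  shows "((\<lambda>F. nrm (\<lambda>k. g k - (if k \<in> F then g k else 0))) \<longlongrightarrow> 0) (finite_subsets_at_top UNIV)"
proof -
  have eq: "(nrm g)\<^sup>2 - (\<Sum>k\<in>F. (norm (g k))\<^sup>2) = (nrm (\<lambda>k. g k - (if k \<in> F then g k else 0)))\<^sup>2"
    if "finite F" for F
  proof -
    let ?h = "\<lambda>k. if k \<in> F then g k else 0"
    have h: "l2 ?h" by (rule l2_finite_support, rule finite_subset[OF _ that]) auto
    have s: "((\<lambda>k. of_real ((norm (?h k))\<^sup>2) :: complex) has_sum of_real (\<Sum>k\<in>F. (norm (g k))\<^sup>2)) UNIV"
      by (rule has_sum_finite_neutralI[OF that]) auto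
    then have "ip ?h ?h = of_real (\<Sum>k\<in>F. (norm (g k))\<^sup>2)"
      unfolding ip_def by (intro infsumI) (simp add: complex_norm_square del: of_real_power)
    then have nh: "(nrm ?h)\<^sup>2 = (\<Sum>k\<in>F. (norm (g k))\<^sup>2)"
      unfolding ip_self using of_real_eq_iff by blast
    have "(\<lambda>k. g k * cnj (?h k)) = (\<lambda>k. of_real ((norm (?h k))\<^sup>2))"
      by (auto simp: complex_norm_square fun_eq_iff simp del: of_real_power)
    then have "ip g ?h = of_real (\<Sum>k\<in>F. (norm (g k))\<^sup>2)"
      unfolding ip_def using infsumI[OF s] by simp
    then show ?thesis using nrm_sq_diff[OF g h] nh by simp
  qed
  have "((\<lambda>F. (nrm g)\<^sup>2 - (\<Sum>k\<in>F. (norm (g k))\<^sup>2)) \<longlongrightarrow> (nrm g)\<^sup>2 - (nrm g)\<^sup>2) (finite_subsets_at_top UNIV)"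
    using has_sum_infsum[of "\<lambda>k. (norm (g k))\<^sup>2" UNIV] g
    by (intro tendsto_intros) (simp add: has_sum_def nrm_sq l2_def)
  then have "((\<lambda>F. (nrm g)\<^sup>2 - (\<Sum>k\<in>F. (norm (g k))\<^sup>2)) \<longlongrightarrow> 0) (finite_subsets_at_top UNIV)"
    by (simp only: diff_self)
  then have "((\<lambda>F. (nrm (\<lambda>k. g k - (if k \<in> F then g k else 0)))\<^sup>2) \<longlongrightarrow> 0) (finite_subsets_at_top UNIV)"
    by (rule Lim_transform_eventually[OF _ eventually_mono[OF eventually_finite_subset eq]])
  then have "((\<lambda>F. sqrt ((nrm (\<lambda>k. g k - (if k \<in> F then g k else 0)))\<^sup>2)) \<longlongrightarrow> sqrt 0) (finite_subsets_at_top UNIV)"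
    by (rule tendsto_real_sqrt)
  then show ?thesis by simp
qed

text \<open>For finite truncations of \<open>g\<close> this is linearity. Cauchy-Schwarz bounds the
  error by the norm of the tail, which tends to 0 by \<open>truncation_tendsto\<close>.\<close>

lemma ip_synthesis_right:
  assumes e: "orthonormal e" and g: "l2 g" and f: "l2 f"
  shows "ip f (synthesis e g) = ip (analysis e f) g"
proof -
  let ?T = "finite_subsets_at_top (UNIV :: 'a set)"
  let ?h = "\<lambda>F k. if k \<in> F then g k else 0"
  have b: "norm ((\<Sum>k\<in>F. analysis e f k * cnj (g k)) - ip f (synthesis e g)) \<le> nrm f * nrm (\<lambda>k. g k - ?h F k)"
    if F: "finite F" for F
  proof -
    have h: "l2 (?h F)" by (rule l2_finite_support, rule finite_subset[OF _ F]) auto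
    have "(\<Sum>k\<in>F. analysis e f k * cnj (g k)) = ip f (synthesis e (?h F))"
      unfolding synthesis_finite[OF F] using orthonormal_finite_sum(3)[OF e F f] by simp
    also have "\<dots> - ip f (synthesis e g) = - ip f (synthesis e (\<lambda>k. g k - ?h F k))"
      unfolding synthesis_diff[OF e g h] by (subst ip_diff_right) (use l2_synthesis[OF e] f g h in auto)
    also have "norm \<dots> \<le> nrm f * nrm (synthesis e (\<lambda>k. g k - ?h F k))"
      unfolding norm_minus_cancel by (intro norm_ip_le f l2_synthesis[OF e] l2_diff g h)
    also have "\<dots> \<le> nrm f * nrm (\<lambda>k. g k - ?h F k)"
      by (intro mult_left_mono nrm_synthesis_le[OF e] l2_diff g h) simp
    finally show ?thesis .
  qed
  have lim: "((\<lambda>F. nrm f * nrm (\<lambda>k. g k - ?h F k)) \<longlongrightarrow> 0) ?T"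
    using tendsto_mult_left[OF truncation_tendsto[OF g], of "nrm f"] by simp
  have "((\<lambda>F. (\<Sum>k\<in>F. analysis e f k * cnj (g k)) - ip f (synthesis e g)) \<longlongrightarrow> 0) ?T"
    by (rule Lim_null_comparison[OF _ lim])
      (rule eventually_mono[OF eventually_finite_subset b])
  then have "((\<lambda>k. analysis e f k * cnj (g k)) has_sum ip f (synthesis e g)) UNIV"
    unfolding has_sum_def using Lim_null by blast
  moreover have "((\<lambda>k. analysis e f k * cnj (g k)) has_sum ip (analysis e f) g) UNIV"
    by (intro ip_has_sum Bessel[OF e f] g)
  ultimately show ?thesis using has_sum_unique by blast
qed

lemma ip_synthesis_left:
  assumes "orthonormal e" "l2 g" "l2 f"
  shows "ip (synthesis e g) f = ip g (analysis e f)"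
  using ip_synthesis_right[OF assms] by (simp flip: ip_cnj[of f] ip_cnj[of "analysis e f"])

lemma analysis_synth:
  assumes e: "orthonormal e" and g: "l2 g"
  shows "analysis e (synthesis e g) = g"
proof
  fix k
  have "analysis e (e k) = unit_seq k"
    using e by (auto simp: analysis_def orthonormal_def unit_seq_def fun_eq_iff)
  then show "analysis e (synthesis e g) k = g k"
    using ip_synthesis_left[OF e g, of "e k"] e by (simp add: analysis_def orthonormal_def)
qed

lemma nrm_synthesis:
  assumes "orthonormal e" "l2 g"
  shows "nrm (synthesis e g) = nrm g"
  using nrm_synthesis_le[OF assms] Bessel(2)[OF assms(1) l2_synthesis[OF assms]]
  by (simp add: analysis_synth[OF assms])

text \<open>For orthonormal \<open>e\<close>, \<open>synthesis e\<close> after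
  \<open>analysis e\<close> is the orthogonal projection onto the closed span of \<open>e\<close>;
  this is the complementary projection. For the shifts of \<open>t\<close> it becomes the projection
  onto the model space.\<close>

definition comp_proj :: "('k \<Rightarrow> 'l \<Rightarrow> complex) \<Rightarrow> ('l \<Rightarrow> complex) \<Rightarrow> 'l \<Rightarrow> complex" where
  "comp_proj e f = (\<lambda>l. f l - synthesis e (analysis e f) l)"

lemma
  assumes e: "orthonormal e" and f: "l2 f"
  shows l2_comp_proj: "l2 (comp_proj e f)"
    and analysis_comp_proj: "analysis e (comp_proj e f) = (\<lambda>k. 0)"
    and ip_comp_proj: "l2 g \<Longrightarrow> analysis e g = (\<lambda>k. 0) \<Longrightarrow> ip (comp_proj e f) g = ip f g"
    and nrm_comp_proj: "(nrm (comp_proj e f))\<^sup>2 = (nrm f)\<^sup>2 - (nrm (analysis e f))\<^sup>2"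
proof -
  note s = l2_synthesis[OF e Bessel(1)[OF e f]]
  show l: "l2 (comp_proj e f)" unfolding comp_proj_def by (intro l2_diff f s)
  show "analysis e (comp_proj e f) = (\<lambda>k. 0)"
    unfolding comp_proj_def by (simp add: analysis_diff f s e analysis_synth Bessel(1))
  show "ip (comp_proj e f) g = ip f g" if "l2 g" "analysis e g = (\<lambda>k. 0)"
    unfolding comp_proj_def using that
    by (simp add: ip_diff_left f s ip_synthesis_left e Bessel(1))
  have "ip f (synthesis e (analysis e f)) = of_real ((nrm (analysis e f))\<^sup>2)"
    by (simp only: ip_synthesis_right e f Bessel(1) ip_self)
  then show "(nrm (comp_proj e f))\<^sup>2 = (nrm f)\<^sup>2 - (nrm (analysis e f))\<^sup>2"
    unfolding comp_proj_def nrm_sq_diff[OF f s] by (simp add: nrm_synthesis e f Bessel(1))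
qed

section \<open>Shifts, characters and tensor products\<close>

text \<open>Membership in \<open>range ((+) d)\<close> expresses that the monomial of exponent
  \<open>k\<close> is divisible by that of exponent \<open>d\<close>, in one variable and in two
  alike.\<close>

definition shift :: "'k::cancel_comm_monoid_add \<Rightarrow> ('k \<Rightarrow> complex) \<Rightarrow> 'k \<Rightarrow> complex" where
  "shift d a k = (if k \<in> range ((+) d) then a (k - d) else 0)"

definition bshift :: "'k::cancel_comm_monoid_add \<Rightarrow> ('k \<Rightarrow> complex) \<Rightarrow> 'k \<Rightarrow> complex" where
  "bshift d a k = a (d + k)"

lemma shift_add [simp]: "shift d a (d + k) = a k"
  by (simp add: shift_def)

lemma shift_outside: "k \<notin> range ((+) d) \<Longrightarrow> shift d a k = 0"
  by (simp add: shift_def)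

lemma inj_plus: "inj ((+) (d :: 'k::cancel_comm_monoid_add))"
  by (auto intro: injI)

lemma has_sum_shift_iff:
  fixes F :: "'k::cancel_comm_monoid_add \<Rightarrow> 'b :: {comm_monoid_add, topological_space}"
  assumes "\<And>k. k \<notin> range ((+) d) \<Longrightarrow> F k = 0"
  shows "(F has_sum S) UNIV \<longleftrightarrow> ((\<lambda>j. F (d + j)) has_sum S) UNIV"
proof -
  have "(F has_sum S) UNIV \<longleftrightarrow> (F has_sum S) (range ((+) d))"
    by (rule has_sum_cong_neutral) (use assms in auto)
  then show ?thesis by (simp add: has_sum_reindex[OF inj_plus] o_def)
qed

lemma infsum_shift:
  fixes F :: "'k::cancel_comm_monoid_add \<Rightarrow> 'b :: {comm_monoid_add, t2_space}"
  assumes "\<And>k. k \<notin> range ((+) d) \<Longrightarrow> F k = 0"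
  shows "(\<Sum>\<^sub>\<infinity>k. F k) = (\<Sum>\<^sub>\<infinity>j. F (d + j))"
  using has_sum_shift_iff[of d F, OF assms] by (metis infsumI infsum_not_exists summable_on_def)

lemma l2_shift [intro]: "l2 a \<Longrightarrow> l2 (shift d a)"
  unfolding l2_def summable_on_def
  by (subst has_sum_shift_iff[of d]) (auto simp: shift_outside)

lemma l2_bshift [intro]: "l2 a \<Longrightarrow> l2 (bshift d a)"
  using l2_comp_inj[OF _ inj_plus] by (simp add: bshift_def [abs_def])

lemma ip_shift_left: "ip (shift d a) b = ip a (bshift d b)"
  unfolding ip_def by (subst infsum_shift[of d]) (auto simp: shift_outside bshift_def)

lemma ip_shift_right: "ip b (shift d a) = ip (bshift d b) a"
  using ip_shift_left[of d a b] by (metis ip_cnj)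

lemma bshift_shift [simp]: "bshift d (shift d a) = a"
  by (simp add: bshift_def fun_eq_iff)

lemma nrm_shift [simp]: "nrm (shift d a) = nrm a"
proof -
  have "complex_of_real ((nrm (shift d a))\<^sup>2) = of_real ((nrm a)\<^sup>2)"
    by (simp only: ip_self[symmetric] ip_shift_left bshift_shift)
  then have "(nrm (shift d a))\<^sup>2 = (nrm a)\<^sup>2"
    using of_real_eq_iff by blast
  then show ?thesis by simp
qed

lemma shift_0 [simp]: "shift 0 a = a"
  by (simp add: shift_def fun_eq_iff image_iff)

lemma bshift_0 [simp]: "bshift 0 a = a"
  by (simp add: bshift_def fun_eq_iff)

lemma shift_shift: "shift c (shift d a) = shift (c + d) a"
proof
  fix k
  consider j where "k = c + d + j" | j where "k = c + j" "k \<notin> range ((+) (c + d))" | "k \<notin> range ((+) c)"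
    by fast
  then show "shift c (shift d a) k = shift (c + d) a k"
  proof cases
    case 1
    then show ?thesis by (simp only: shift_add) (simp only: add.assoc shift_add)
  next
    case 2
    then have "j \<notin> range ((+) d)" by (auto simp: add.assoc)
    then show ?thesis using 2 by (simp add: shift_outside)
  next
    case 3
    then have "k \<notin> range ((+) (c + d))" by (auto simp: add.assoc)
    then show ?thesis using 3 by (simp add: shift_outside)
  qed
qed

lemma bshift_diff: "bshift d (\<lambda>k. a k - b k) = (\<lambda>k. bshift d a k - bshift d b k)"
  by (simp add: bshift_def fun_eq_iff)

lemma nrm_bshift_le: "l2 a \<Longrightarrow> nrm (bshift d a) \<le> nrm a"
proof -
  assume a: "l2 a"
  have "L2_set (\<lambda>k. norm (bshift d a k)) F \<le> nrm a" if "finite F" for F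
    using L2_set_le_nrm[OF a, of "(+) d ` F"] that inj_plus[of d]
    by (simp add: L2_set_def sum.reindex bshift_def inj_on_def)
  then show ?thesis by (rule l2I_L2_set)
qed

text \<open>Orthonormality of the monomial multiples of \<open>t\<close> is what makes
  multiplication by \<open>t\<close> an isometry; it replaces unimodular boundary values from here
  on.\<close>

definition inner_seq :: "('k::cancel_comm_monoid_add \<Rightarrow> complex) \<Rightarrow> bool" where
  "inner_seq t \<longleftrightarrow> orthonormal (\<lambda>k. shift k t)"

definition mul :: "('k::cancel_comm_monoid_add \<Rightarrow> complex) \<Rightarrow> ('k \<Rightarrow> complex) \<Rightarrow> 'k \<Rightarrow> complex" where
  "mul t = synthesis (\<lambda>k. shift k t)"

definition adj :: "('k::cancel_comm_monoid_add \<Rightarrow> complex) \<Rightarrow> ('k \<Rightarrow> complex) \<Rightarrow> 'k \<Rightarrow> complex" where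
  "adj t = analysis (\<lambda>k. shift k t)"

definition proj :: "('k::cancel_comm_monoid_add \<Rightarrow> complex) \<Rightarrow> ('k \<Rightarrow> complex) \<Rightarrow> 'k \<Rightarrow> complex" where
  "proj t = comp_proj (\<lambda>k. shift k t)"

lemma inner_seq_l2: "inner_seq t \<Longrightarrow> l2 t"
  unfolding inner_seq_def orthonormal_def by (metis shift_0)

lemma adj_apply: "adj t f k = ip f (shift k t)"
  by (simp add: adj_def analysis_def)

lemma proj_apply: "proj t f l = f l - mul t (adj t f) l"
  by (simp add: proj_def comp_proj_def mul_def adj_def)

lemmas l2_mul = l2_synthesis[of "\<lambda>k. shift k t" for t, folded inner_seq_def mul_def]
lemmas l2_adj = Bessel(1)[of "\<lambda>k. shift k t" for t, folded inner_seq_def adj_def]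
lemmas nrm_adj_le = Bessel(2)[of "\<lambda>k. shift k t" for t, folded inner_seq_def adj_def]
lemmas ip_mul_left = ip_synthesis_left[of "\<lambda>k. shift k t" for t, folded inner_seq_def mul_def adj_def]
lemmas ip_mul_right = ip_synthesis_right[of "\<lambda>k. shift k t" for t, folded inner_seq_def mul_def adj_def]
lemmas adj_mul = analysis_synth[of "\<lambda>k. shift k t" for t, folded inner_seq_def mul_def adj_def]
lemmas adj_diff = analysis_diff[of _ _ "\<lambda>k. shift k t" for t, folded inner_seq_def adj_def]
lemmas adj_cmult = analysis_cmult[of "\<lambda>k. shift k t" for t, folded adj_def]
lemmas mul_cmult = synthesis_cmult[of "\<lambda>k. shift k t" for t, folded mul_def]
lemmas mul_zero [simp] = synthesis_zero[of "\<lambda>k. shift k t" for t, folded mul_def]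
lemmas adj_zero [simp] = analysis_zero[of "\<lambda>k. shift k t" for t, folded adj_def]
lemmas l2_proj = l2_comp_proj[of "\<lambda>k. shift k t" for t, folded inner_seq_def proj_def]
lemmas adj_proj = analysis_comp_proj[of "\<lambda>k. shift k t" for t, folded inner_seq_def proj_def adj_def]
lemmas ip_proj = ip_comp_proj[of "\<lambda>k. shift k t" for t, folded inner_seq_def proj_def adj_def]
lemmas nrm_proj = nrm_comp_proj[of "\<lambda>k. shift k t" for t, folded inner_seq_def proj_def adj_def]

lemma proj_diff:
  assumes "inner_seq t" "l2 f" "l2 g"
  shows "proj t (\<lambda>k. f k - g k) = (\<lambda>k. proj t f k - proj t g k)"
proof
  fix k
  have "mul t (adj t (\<lambda>k. f k - g k)) = (\<lambda>k. mul t (adj t f) k - mul t (adj t g) k)"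
    using assms synthesis_diff[of "\<lambda>k. shift k t" "adj t f" "adj t g"]
    by (simp add: adj_diff l2_adj flip: mul_def inner_seq_def)
  then show "proj t (\<lambda>k. f k - g k) k = proj t f k - proj t g k"
    by (simp add: proj_apply)
qed

lemma proj_fixed: "adj t f = (\<lambda>k. 0) \<Longrightarrow> proj t f = f"
  using proj_apply[of t f] by (intro ext) simp

lemma nrm_proj_le:
  assumes "inner_seq t" "l2 f" shows "nrm (proj t f) \<le> nrm f"
proof -
  have "(nrm (proj t f))\<^sup>2 \<le> (nrm f)\<^sup>2" using nrm_proj[OF assms] by simp
  then show ?thesis by (simp add: power2_le_iff_abs_le)
qed

lemma adj_shift: "adj t (shift d f) (d + k) = adj t f k"
  by (simp add: adj_apply ip_shift_left flip: shift_shift)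

text \<open>Multiplication by \<open>t\<close> commutes with shifts, hence so do the adjoints. This
  makes the model space invariant under \<open>bshift d\<close>.\<close>

lemma adj_bshift: "adj t (bshift d f) = bshift d (adj t f)"
  by (simp add: adj_apply bshift_def[of _ "adj t f"] fun_eq_iff flip: shift_shift ip_shift_right)

lemma mul_unit_0 [simp]: "mul t (unit_seq 0) = t"
proof
  fix l
  have "((\<lambda>k. unit_seq 0 k * shift k t l) has_sum t l) UNIV"
    by (rule has_sum_finite_neutralI[of "{0}"]) (auto simp: unit_seq_def)
  then show "mul t (unit_seq 0) l = t l"
    unfolding mul_def synthesis_def by (rule infsumI)
qed

section \<open>Point evaluations and their kernels\<close>

definition character :: "('k::cancel_comm_monoid_add \<Rightarrow> complex) \<Rightarrow> bool" where
  "character \<eta> \<longleftrightarrow> l2 \<eta> \<and> \<eta> 0 = 1 \<and> (\<forall>j k. \<eta> (j + k) = \<eta> j * \<eta> k)"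

definition ev :: "('k \<Rightarrow> complex) \<Rightarrow> ('k \<Rightarrow> complex) \<Rightarrow> complex" where
  "ev \<eta> a = (\<Sum>\<^sub>\<infinity>k. a k * \<eta> k)"

text \<open>The conjugate turns the bilinear pairing with \<open>\<eta>\<close> into an inner
  product: this is the Szego kernel of the point.\<close>

definition ker_seq :: "('k \<Rightarrow> complex) \<Rightarrow> 'k \<Rightarrow> complex" where
  "ker_seq \<eta> k = cnj (\<eta> k)"

lemma ev_ip: "ev \<eta> a = ip a (ker_seq \<eta>)"
  by (simp add: ev_def ip_def ker_seq_def)

lemma l2_ker_seq: "character \<eta> \<Longrightarrow> l2 (ker_seq \<eta>)"
  by (simp add: l2_def ker_seq_def character_def)

lemma ev_has_sum: "character \<eta> \<Longrightarrow> l2 a \<Longrightarrow> ((\<lambda>k. a k * \<eta> k) has_sum ev \<eta> a) UNIV"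
  using ip_has_sum[of a "ker_seq \<eta>"] l2_ker_seq[of \<eta>] by (simp add: ev_ip) (simp add: ker_seq_def)

lemma bshift_ker_seq: "character \<eta> \<Longrightarrow> bshift d (ker_seq \<eta>) = (\<lambda>k. cnj (\<eta> d) * ker_seq \<eta> k)"
  by (simp add: bshift_def ker_seq_def character_def fun_eq_iff)

lemma ev_shift: "character \<eta> \<Longrightarrow> ev \<eta> (shift d a) = \<eta> d * ev \<eta> a"
  by (simp add: ev_ip ip_shift_left bshift_ker_seq ip_cmult_right)

text \<open>A character only picks up a scalar factor under translation, so a kernel is an
  eigenvector of every \<open>adj t\<close>.\<close>

lemma adj_ker_seq: "character \<eta> \<Longrightarrow> adj t (ker_seq \<eta>) = (\<lambda>k. cnj (ev \<eta> t) * ker_seq \<eta> k)"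
  by (simp add: adj_apply ip_shift_right bshift_ker_seq ip_cmult_left fun_eq_iff ev_ip ip_cnj)
    (simp add: ker_seq_def)

text \<open>Moving \<open>mul t\<close> over to the kernel, an eigenvector of the adjoint, takes the
  place of rearranging a Cauchy product.\<close>

lemma ev_mul: "character \<eta> \<Longrightarrow> inner_seq t \<Longrightarrow> l2 g \<Longrightarrow> ev \<eta> (mul t g) = ev \<eta> t * ev \<eta> g"
  by (simp add: ev_ip ip_mul_left l2_ker_seq adj_ker_seq ip_cmult_right)

section \<open>Tensor products of sequences\<close>

definition ten :: "('i \<Rightarrow> complex) \<Rightarrow> ('j \<Rightarrow> complex) \<Rightarrow> 'i \<times> 'j \<Rightarrow> complex" where
  "ten a b = (\<lambda>(i, j). a i * b j)"

text \<open>The first variable is paired off against \<open>a\<close>; by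
  \<open>ip_ten_right\<close> this is the adjoint of \<open>\<lambda>b. ten a b\<close>.\<close>

definition pin :: "('i \<Rightarrow> complex) \<Rightarrow> ('i \<times> 'j \<Rightarrow> complex) \<Rightarrow> 'j \<Rightarrow> complex" where
  "pin a f j = ip (\<lambda>i. f (i, j)) a"

lemma ten_apply [simp]: "ten a b (i, j) = a i * b j"
  by (simp add: ten_def)

lemma l2_ten [intro]:
  assumes "l2 a" "l2 b" shows "l2 (ten a b)"
proof -
  have "(\<lambda>k. (norm (ten a b k))\<^sup>2) summable_on Sigma UNIV (\<lambda>_. UNIV)"
  proof (rule summable_on_SigmaI)
    show "((\<lambda>j. (norm (ten a b (i, j)))\<^sup>2) has_sum (norm (a i))\<^sup>2 * (nrm b)\<^sup>2) UNIV" for i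
      unfolding ten_apply norm_mult power_mult_distrib nrm_sq
      by (intro has_sum_cmult_right has_sum_infsum) (use assms in \<open>simp add: l2_def\<close>)
    show "(\<lambda>i. (norm (a i))\<^sup>2 * (nrm b)\<^sup>2) summable_on UNIV"
      by (rule summable_on_cmult_left) (use assms in \<open>simp add: l2_def\<close>)
  qed auto
  then show ?thesis by (simp add: l2_def)
qed

lemma l2_slice: "l2 f \<Longrightarrow> l2 (\<lambda>i. f (i, j))"
  by (rule l2_comp_inj[of f "\<lambda>i. (i, j)"]) (auto intro: injI)

text \<open>Cauchy-Schwarz in each slice; the squared norms of the slices add up to that of
  \<open>f\<close>.\<close>

lemma
  assumes a: "l2 a" and f: "l2 f"
  shows l2_pin: "l2 (pin a f)" and nrm_pin_le: "nrm (pin a f) \<le> nrm a * nrm f"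
proof -
  have "((\<lambda>(j, i). (norm (f (i, j)))\<^sup>2) has_sum (nrm f)\<^sup>2) (UNIV \<times> UNIV)"
    by (subst has_sum_swap[symmetric]) (use f in \<open>simp add: nrm_sq l2_def\<close>)
  then have s: "((\<lambda>j. (nrm (\<lambda>i. f (i, j)))\<^sup>2) has_sum (nrm f)\<^sup>2) UNIV"
    by (rule has_sum_SigmaD) (use l2_slice[OF f] in \<open>simp add: nrm_sq l2_def\<close>)
  have *: "L2_set (\<lambda>j. norm (pin a f j)) F \<le> nrm a * nrm f" if F: "finite F" for F
  proof -
    have "L2_set (\<lambda>j. norm (pin a f j)) F \<le> L2_set (\<lambda>j. nrm a * nrm (\<lambda>i. f (i, j))) F"
      using norm_ip_le[OF l2_slice[OF f] a]
      by (intro L2_set_mono) (auto simp: pin_def mult.commute)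
    also have "\<dots> = nrm a * L2_set (\<lambda>j. nrm (\<lambda>i. f (i, j))) F"
      by (simp add: L2_set_right_distrib)
    also have "L2_set (\<lambda>j. nrm (\<lambda>i. f (i, j))) F \<le> sqrt ((nrm f)\<^sup>2)"
      unfolding L2_set_def by (intro real_sqrt_le_mono finite_sum_le_has_sum[OF s]) (use F in auto)
    finally show ?thesis by (simp add: mult_left_mono)
  qed
  show "l2 (pin a f)" "nrm (pin a f) \<le> nrm a * nrm f" by (rule l2I_L2_set[OF *]; assumption)+
qed

lemma ip_ten_right:
  assumes a: "l2 a" and b: "l2 b" and f: "l2 f"
  shows "ip f (ten a b) = ip (pin a f) b"
proof -
  have "((\<lambda>k. f k * cnj (ten a b k)) has_sum ip f (ten a b)) (UNIV \<times> UNIV)"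
    using ip_has_sum[OF f l2_ten[OF a b]] by simp
  then have "((\<lambda>(j, i). f (i, j) * cnj (ten a b (i, j))) has_sum ip f (ten a b)) (UNIV \<times> UNIV)"
    by (subst (asm) has_sum_swap)
  then have "((\<lambda>j. pin a f j * cnj (b j)) has_sum ip f (ten a b)) UNIV"
  proof (rule has_sum_SigmaD)
    fix j
    have "((\<lambda>i. f (i, j) * cnj (a i) * cnj (b j)) has_sum pin a f j * cnj (b j)) UNIV"
      unfolding pin_def by (intro has_sum_cmult_left ip_has_sum a l2_slice f)
    then show "((\<lambda>i. case (j, i) of (j, i) \<Rightarrow> f (i, j) * cnj (ten a b (i, j))) has_sum pin a f j * cnj (b j)) UNIV"
      by (simp add: mult.assoc)
  qed
  then show ?thesis unfolding ip_def[of "pin a f"] by (simp add: infsumI)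
qed

lemma pin_ten: "pin c (ten a b) = (\<lambda>j. ip a c * b j)"
  unfolding pin_def ten_apply
  by (simp add: fun_eq_iff mult.commute[of _ "b _"] ip_cmult_left)

lemma ip_ten: "l2 a \<Longrightarrow> l2 b \<Longrightarrow> l2 c \<Longrightarrow> l2 d \<Longrightarrow> ip (ten a b) (ten c d) = ip a c * ip b d"
  by (simp add: ip_ten_right l2_ten pin_ten ip_cmult_left)

lemma nrm_ten:
  assumes "l2 a" "l2 b" shows "nrm (ten a b) = nrm a * nrm b"
proof -
  have "complex_of_real ((nrm (ten a b))\<^sup>2) = of_real ((nrm a * nrm b)\<^sup>2)"
    using ip_ten[of a b a b] assms by (simp only: ip_self) (simp add: power_mult_distrib)
  then have "(nrm (ten a b))\<^sup>2 = (nrm a * nrm b)\<^sup>2"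
    using of_real_eq_iff by blast
  then show ?thesis by simp
qed

lemma range_plus_prod: "(k, l) \<in> range ((+) (i, j)) \<longleftrightarrow> k \<in> range ((+) i) \<and> l \<in> range ((+) j)"
  by (auto simp: image_iff)

lemma shift_ten: "shift (i, j) (ten a b) = ten (shift i a) (shift j b)"
  by (auto simp: fun_eq_iff shift_def range_plus_prod)

lemma bshift_ten: "bshift (i, j) (ten a b) = ten (bshift i a) (bshift j b)"
  by (auto simp: fun_eq_iff bshift_def)

lemma inner_seq_ten: "inner_seq a \<Longrightarrow> inner_seq b \<Longrightarrow> inner_seq (ten a b)"
  by (auto simp: inner_seq_def orthonormal_def shift_ten ip_ten l2_ten)

lemma adj_ten:
  "l2 a \<Longrightarrow> l2 b \<Longrightarrow> l2 f \<Longrightarrow> adj (ten a b) f (i, j) = adj b (pin (shift i a) f) j"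
  by (simp add: adj_apply shift_ten ip_ten_right l2_shift)

text \<open>Only indices with first entry 0 contribute, so the double sum collapses to one row. Both
  correction terms of the commutator have this shape.\<close>

lemma mul_ten_unit: "mul (ten a b) (ten (unit_seq 0) v) = ten a (mul b v)"
proof
  fix k :: "'a \<times> 'b"
  obtain l m where k: "k = (l, m)" by (cases k)
  let ?F = "\<lambda>p. ten (unit_seq 0) v p * shift p (ten a b) k"
  have "(\<Sum>\<^sub>\<infinity>p. ?F p) = (\<Sum>\<^sub>\<infinity>p\<in>range (Pair 0). ?F p)"
    by (rule infsum_cong_neutral) (auto simp: unit_seq_def)
  also have "\<dots> = (\<Sum>\<^sub>\<infinity>j. ?F (0, j))"
    by (subst infsum_reindex) (auto simp: o_def intro: injI)
  also have "\<dots> = (\<Sum>\<^sub>\<infinity>j. a l * (v j * shift j b m))"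
    by (simp add: k shift_ten unit_seq_def mult_ac)
  finally show "mul (ten a b) (ten (unit_seq 0) v) k = ten a (mul b v) k"
    by (simp add: mul_def synthesis_def k infsum_cmult_right')
qed

section \<open>The self-commutator on a model space of sequences\<close>

text \<open>The complement of the multiples of \<open>t\<close> is encoded as the kernel of
  \<open>adj t\<close>, so that membership is a family of scalar equations;
  \<open>model_space_eq\<close> links it to \<open>model_space\<close>.\<close>

definition modsp :: "('k::cancel_comm_monoid_add \<Rightarrow> complex) \<Rightarrow> ('k \<Rightarrow> complex) set" where
  "modsp t = {f. l2 f \<and> adj t f = (\<lambda>k. 0)}"

text \<open>The compression of \<^term>\<open>shift d\<close> to \<^term>\<open>modsp t\<close> is \<open>proj t \<circ> shift d\<close>, and its adjoint is
  \<^term>\<open>bshift d\<close>, which leaves \<^term>\<open>modsp t\<close> invariant.\<close>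

definition commutator :: "'k::cancel_comm_monoid_add \<Rightarrow> ('k \<Rightarrow> complex) \<Rightarrow> ('k \<Rightarrow> complex) \<Rightarrow> 'k \<Rightarrow> complex" where
  "commutator d t f = (\<lambda>k. bshift d (proj t (shift d f)) k - proj t (shift d (bshift d f)) k)"

text \<open>Coefficient form of \<open>compact_operator_on\<close>. With the identity for
  \<open>C\<close> and a model space for \<open>M\<close> it says that bounded sequences in
  \<open>M\<close> have convergent subsequences, that is, that \<open>M\<close> is
  finite-dimensional.\<close>

definition compact_seq :: "('k \<Rightarrow> complex) set \<Rightarrow> (('k \<Rightarrow> complex) \<Rightarrow> 'k \<Rightarrow> complex) \<Rightarrow> bool" where
  "compact_seq M C \<longleftrightarrow> (\<forall>X :: nat \<Rightarrow> 'k \<Rightarrow> complex. range X \<subseteq> M \<and> (\<exists>B. \<forall>n. nrm (X n) \<le> B) \<longrightarrow>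
     (\<exists>r g. strict_mono r \<and> g \<in> M \<and> (\<lambda>n. nrm (\<lambda>k. C (X (r n)) k - g k)) \<longlonglongrightarrow> 0))"

lemma modspD: "f \<in> modsp t \<Longrightarrow> l2 f" "f \<in> modsp t \<Longrightarrow> adj t f = (\<lambda>k. 0)"
  by (auto simp: modsp_def)

lemma bshift_in_modsp: "f \<in> modsp t \<Longrightarrow> bshift d f \<in> modsp t"
  by (auto simp: modsp_def adj_bshift bshift_def)

lemma proj_in_modsp: "inner_seq t \<Longrightarrow> l2 f \<Longrightarrow> proj t f \<in> modsp t"
  by (simp add: modsp_def l2_proj adj_proj)

text \<open>\<open>adj t\<close> is a contraction and sends \<open>X n - g\<close> to
  \<open>- adj t g\<close>, whose norm is therefore arbitrarily small.\<close>

lemma modsp_closed: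
  assumes t: "inner_seq t" and X: "\<And>n. X n \<in> modsp t" and g: "l2 g"
    and lim: "(\<lambda>n. nrm (\<lambda>k. X n k - g k)) \<longlonglongrightarrow> 0"
  shows "g \<in> modsp t"
proof -
  have "nrm (adj t g) \<le> nrm (\<lambda>k. X n k - g k)" for n
  proof -
    have "adj t (\<lambda>k. X n k - g k) = (\<lambda>k. - adj t g k)"
      using t g modspD[OF X] by (simp add: adj_diff)
    then show ?thesis using nrm_adj_le[OF t l2_diff[OF modspD(1)[OF X[of n]] g]] by simp
  qed
  then have "nrm (adj t g) \<le> 0" by (intro LIMSEQ_le_const[OF lim]) auto
  then have "adj t g = (\<lambda>k. 0)" by (intro nrm_eq_0 l2_adj t g) (simp add: order_antisym)
  then show ?thesis using g by (simp add: modsp_def)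
qed

text \<open>\<open>Q\<close> is the projection onto psi H^2 in the second variable. With v = 1 - cnj
  (\<alpha> 0) \<alpha>, the first two terms are 1 tensor (I - Q) f0 plus v tensor Q f0. Since
  \<open>Q\<close> kills \<open>pin \<alpha> f\<close>, Q f0 equals Q (pin v f), so the rest is
  \<open>Q\<close> tensored with the difference of the rank one operators of v and of
  \<open>bshift (Suc 0) \<alpha>\<close>.\<close>

lemma commutator_ten:
  fixes \<alpha> \<beta> :: "nat \<Rightarrow> complex"
  assumes a: "inner_seq \<alpha>" and b: "inner_seq \<beta>" and f: "f \<in> modsp (ten \<alpha> \<beta>)"
  defines "Q \<equiv> \<lambda>g. mul \<beta> (adj \<beta> g)" and "f0 \<equiv> pin (unit_seq 0) f"
  shows "commutator (Suc 0, 0) (ten \<alpha> \<beta>) f =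
    (\<lambda>k. ten (unit_seq 0) f0 k - ten \<alpha> (\<lambda>j. cnj (\<alpha> 0) * Q f0 j) k
         - ten (bshift (Suc 0) \<alpha>) (Q (pin (bshift (Suc 0) \<alpha>) f)) k)"
proof -
  let ?t = "ten \<alpha> \<beta>" and ?d = "(Suc 0, 0) :: nat \<times> nat"
  note la = inner_seq_l2[OF a] and lb = inner_seq_l2[OF b]
  have lf: "l2 f" and adjf: "adj ?t f = (\<lambda>k. 0)" using modspD[OF f] .
  have t: "inner_seq ?t" by (rule inner_seq_ten[OF a b])
  have lf0: "l2 f0" unfolding f0_def by (intro l2_pin l2_unit lf)
  \<comment> \<open>Because \<open>adj ?t f\<close> vanishes, shifting \<open>f\<close> can create
    nonzero coefficients in row 0 only.\<close>
  have "adj ?t (shift ?d f) (i, j) = ten (unit_seq 0) (adj \<beta> (pin (bshift (Suc 0) \<alpha>) f)) (i, j)" for i j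
  proof (cases i)
    case 0
    have "adj ?t (shift ?d f) (0, j) = ip f (ten (bshift (Suc 0) \<alpha>) (shift j \<beta>))"
      using bshift_ten[of "Suc 0" 0 \<alpha> "shift j \<beta>"] shift_ten[of 0 j \<alpha> \<beta>]
      by (simp add: adj_apply ip_shift_left bshift_0[of "shift j \<beta>"] shift_0[of \<alpha>] flip: ip_shift_right)
    also have "\<dots> = adj \<beta> (pin (bshift (Suc 0) \<alpha>) f) j"
      by (simp add: adj_apply ip_ten_right l2_bshift l2_shift la lb lf)
    finally show ?thesis using 0 by (simp add: unit_seq_def)
  next
    case (Suc i')
    then show ?thesis
      using adj_shift[of ?t ?d f "(i', j)"] by (simp add: adjf unit_seq_def)
  qed
  then have "adj ?t (shift ?d f) = ten (unit_seq 0) (adj \<beta> (pin (bshift (Suc 0) \<alpha>) f))" by auto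
  then have "proj ?t (shift ?d f) = (\<lambda>k. shift ?d f k - ten \<alpha> (Q (pin (bshift (Suc 0) \<alpha>) f)) k)"
    by (intro ext) (simp add: proj_apply mul_ten_unit Q_def)
  then have 1: "bshift ?d (proj ?t (shift ?d f)) = (\<lambda>k. f k - ten (bshift (Suc 0) \<alpha>) (Q (pin (bshift (Suc 0) \<alpha>) f)) k)"
    by (simp add: bshift_diff bshift_ten)
  have f0_apply: "f0 j = f (0, j)" for j by (simp add: f0_def pin_def)
  \<comment> \<open>Going back and then forward in the first variable only erases row 0, which is
    \<open>f0\<close>.\<close>
  have "shift ?d (bshift ?d f) (i, j) = f (i, j) - ten (unit_seq 0) f0 (i, j)" for i j
  proof (cases i)
    case 0
    then show ?thesis by (simp add: shift_def range_plus_prod image_iff unit_seq_def f0_apply)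
  next
    case (Suc i')
    then show ?thesis using shift_add[of ?d "bshift ?d f" "(i', j)"]
      by (simp add: bshift_def unit_seq_def)
  qed
  then have sb: "shift ?d (bshift ?d f) = (\<lambda>k. f k - ten (unit_seq 0) f0 k)" by auto
  \<comment> \<open>Row \<open>i\<close> pairs \<open>unit_seq 0\<close> with
    \<open>shift i \<alpha>\<close>, whose entry at 0 can be nonzero only for
    \<open>i = 0\<close>.\<close>
  have "adj ?t (ten (unit_seq 0) f0) (i, j) = ten (unit_seq 0) (\<lambda>j. cnj (\<alpha> 0) * adj \<beta> f0 j) (i, j)" for i j
    by (cases i) (simp_all add: adj_ten la lb lf0 l2_ten pin_ten adj_cmult unit_seq_def shift_0[of \<alpha>] shift_def image_iff)
  then have "adj ?t (ten (unit_seq 0) f0) = ten (unit_seq 0) (\<lambda>j. cnj (\<alpha> 0) * adj \<beta> f0 j)" by auto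
  then have "proj ?t (ten (unit_seq 0) f0) = (\<lambda>k. ten (unit_seq 0) f0 k - ten \<alpha> (\<lambda>j. cnj (\<alpha> 0) * Q f0 j) k)"
    by (intro ext) (simp add: proj_apply mul_ten_unit Q_def mul_cmult)
  then have 2: "proj ?t (shift ?d (bshift ?d f)) =
      (\<lambda>k. f k - (ten (unit_seq 0) f0 k - ten \<alpha> (\<lambda>j. cnj (\<alpha> 0) * Q f0 j) k))"
    unfolding sb by (simp add: proj_diff[OF t lf] l2_ten lf0 proj_fixed adjf)
  show ?thesis unfolding commutator_def 1 2 by (auto simp: algebra_simps)
qed

lemma ten_unit_in_modsp:
  fixes \<alpha> \<beta> :: "nat \<Rightarrow> complex"
  assumes "inner_seq \<alpha>" "inner_seq \<beta>" "g \<in> modsp \<beta>"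
  shows "ten (unit_seq 0) g \<in> modsp (ten \<alpha> \<beta>)"
  using modspD[OF assms(3)] inner_seq_l2[OF assms(1)] inner_seq_l2[OF assms(2)]
  by (auto simp: modsp_def fun_eq_iff adj_ten l2_ten pin_ten adj_cmult)

text \<open>Once one defect vector is a unimodular multiple of the other, the two rank one terms
  cancel and only the contribution of the model space of psi is left.\<close>

lemma commutator_ten_blaschke:
  fixes \<alpha> \<beta> :: "nat \<Rightarrow> complex"
  assumes a: "inner_seq \<alpha>" and b: "inner_seq \<beta>" and f: "f \<in> modsp (ten \<alpha> \<beta>)"
    and c: "norm c = 1" "bshift (Suc 0) \<alpha> = (\<lambda>n. c * (unit_seq 0 n - cnj (\<alpha> 0) * \<alpha> n))"
  shows "commutator (Suc 0, 0) (ten \<alpha> \<beta>) f = ten (unit_seq 0) (proj \<beta> (pin (unit_seq 0) f))"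
proof -
  let ?f0 = "pin (unit_seq 0) f"
  note la = inner_seq_l2[OF a] and lb = inner_seq_l2[OF b]
  have lf: "l2 f" and adjf: "adj (ten \<alpha> \<beta>) f = (\<lambda>k. 0)" using modspD[OF f] .
  have lf0: "l2 ?f0" by (intro l2_pin l2_unit lf)
  \<comment> \<open>This is row 0 of \<open>adj (ten \<alpha> \<beta>) f\<close>. Under
    \<open>adj \<beta>\<close> it lets \<open>pin (bshift (Suc 0) \<alpha>) f\<close> be replaced by
    a multiple of \<open>?f0\<close>.\<close>
  have pa: "adj \<beta> (pin \<alpha> f) = (\<lambda>k. 0)"
    using adj_ten[OF la lb lf, of 0] by (simp add: adjf fun_eq_iff)
  have "pin (bshift (Suc 0) \<alpha>) f = (\<lambda>j. cnj c * (?f0 j - \<alpha> 0 * pin \<alpha> f j))"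
    unfolding c(2) pin_def
    by (simp only: ip_cmult_right)
      (simp add: ip_diff_right l2_slice[OF lf] la l2_cmult ip_cmult_right del: ip_unit_right)
  then have "adj \<beta> (pin (bshift (Suc 0) \<alpha>) f) = (\<lambda>j. cnj c * adj \<beta> ?f0 j)"
    by (simp add: adj_cmult adj_diff b lf0 l2_cmult l2_pin la lf pa)
  then have q: "mul \<beta> (adj \<beta> (pin (bshift (Suc 0) \<alpha>) f)) = (\<lambda>j. cnj c * mul \<beta> (adj \<beta> ?f0) j)"
    by (simp add: mul_cmult)
  have cc: "c * cnj c = 1" using c(1) by (simp add: complex_norm_square[symmetric])
  show ?thesis
    unfolding commutator_ten[OF a b f] q
  proof (intro ext)
    fix k :: "nat \<times> nat"
    obtain i j where k: "k = (i, j)" by (cases k)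
    define x where "x = mul \<beta> (adj \<beta> ?f0) j"
    have "bshift (Suc 0) \<alpha> i * (cnj c * x) = (c * cnj c) * ((unit_seq 0 i - cnj (\<alpha> 0) * \<alpha> i) * x)"
      unfolding c(2) by (simp add: algebra_simps)
    then show "ten (unit_seq 0) ?f0 k - ten \<alpha> (\<lambda>j. cnj (\<alpha> 0) * mul \<beta> (adj \<beta> ?f0) j) k
        - ten (bshift (Suc 0) \<alpha>) (\<lambda>j. cnj c * mul \<beta> (adj \<beta> ?f0) j) k = ten (unit_seq 0) (proj \<beta> ?f0) k"
      by (simp add: k proj_apply cc algebra_simps flip: x_def)
  qed
qed

lemma nrm_unit [simp]: "nrm (unit_seq k) = 1"
proof -
  have "complex_of_real ((nrm (unit_seq k))\<^sup>2) = 1"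
    by (simp only: ip_self[symmetric] ip_unit_left) (simp add: unit_seq_def)
  then have "(nrm (unit_seq k))\<^sup>2 = 1" using of_real_eq_1_iff by blast
  then show ?thesis using nrm_nonneg[of "unit_seq k"] by (auto simp: power2_eq_1_iff)
qed

lemma inner_seq_nrm: assumes "inner_seq t" shows "nrm t = 1"
proof -
  have "ip (shift 0 t) (shift 0 t) = 1" using assms unfolding inner_seq_def orthonormal_def by presburger
  then have "ip t t = 1" by simp
  then have "(nrm t)\<^sup>2 = 1" unfolding ip_self using of_real_eq_1_iff by blast
  then show ?thesis using nrm_nonneg[of t] by (auto simp: power2_eq_1_iff)
qed

text \<open>\<open>v\<close> is the projection of the constant 1 onto the model space, its
  reproducing kernel at 0, so its squared norm is its value at 0. The backward shift merely drops
  the zeroth coefficient of a sequence of norm 1.\<close>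

lemma ip_defect:
  fixes \<alpha> :: "nat \<Rightarrow> complex"
  assumes a: "inner_seq \<alpha>"
  defines "v \<equiv> \<lambda>n. unit_seq 0 n - cnj (\<alpha> 0) * \<alpha> n"
  shows "v \<in> modsp \<alpha>" "ip v (unit_seq 0) = 1 - (norm (\<alpha> 0))\<^sup>2"
    "(nrm v)\<^sup>2 = 1 - (norm (\<alpha> 0))\<^sup>2" "(nrm (bshift (Suc 0) \<alpha>))\<^sup>2 = 1 - (norm (\<alpha> 0))\<^sup>2"
proof -
  note la = inner_seq_l2[OF a]
  have "adj \<alpha> (unit_seq 0) = (\<lambda>j. cnj (\<alpha> 0) * unit_seq 0 j)"
    by (auto simp: fun_eq_iff adj_apply unit_seq_def shift_0[of \<alpha>] shift_def image_iff)
  then have veq: "v = proj \<alpha> (unit_seq 0)"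
    by (intro ext) (simp add: v_def proj_apply mul_cmult)
  show "v \<in> modsp \<alpha>" unfolding veq by (rule proj_in_modsp[OF a l2_unit])
  show "ip v (unit_seq 0) = 1 - (norm (\<alpha> 0))\<^sup>2"
    by (simp add: v_def unit_seq_def complex_norm_square mult.commute del: of_real_power)
  have "nrm (adj \<alpha> (unit_seq 0)) = norm (\<alpha> 0)"
    using \<open>adj \<alpha> (unit_seq 0) = _\<close> by (simp add: nrm_cmult)
  then show "(nrm v)\<^sup>2 = 1 - (norm (\<alpha> 0))\<^sup>2"
    unfolding veq nrm_proj[OF a l2_unit] by simp
  have "shift (Suc 0) (bshift (Suc 0) \<alpha>) n = \<alpha> n - \<alpha> 0 * unit_seq 0 n" for n
    by (cases n) (auto simp: shift_def bshift_def unit_seq_def image_iff)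
  then have "nrm (bshift (Suc 0) \<alpha>) = nrm (\<lambda>n. \<alpha> n - \<alpha> 0 * unit_seq 0 n)"
    using nrm_shift[of "Suc 0" "bshift (Suc 0) \<alpha>"] by presburger
  then show "(nrm (bshift (Suc 0) \<alpha>))\<^sup>2 = 1 - (norm (\<alpha> 0))\<^sup>2"
    using nrm_sq_diff[OF la l2_cmult[OF l2_unit], of "\<alpha> 0" 0] inner_seq_nrm[OF a]
    by (simp add: nrm_cmult ip_cmult_right cmod_power2) (simp add: power2_eq_square)
qed

text \<open>Each condition comes from one kind of test sequence: constants tensored with elements of
  the model space of psi, which the commutator fixes, and \<open>v\<close> tensored with the
  monomial multiples of psi, on which it acts as an operator tensor the identity. The single vector
  \<open>v\<close> suffices, because annihilating it already makes the two defect vectors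
  parallel.\<close>

lemma compact_commutator_iff:
  fixes \<alpha> \<beta> :: "nat \<Rightarrow> complex"
  assumes a: "inner_seq \<alpha>" and b: "inner_seq \<beta>" and a0: "norm (\<alpha> 0) < 1"
  shows "compact_seq (modsp (ten \<alpha> \<beta>)) (commutator (Suc 0, 0) (ten \<alpha> \<beta>)) \<longleftrightarrow>
    compact_seq (modsp \<beta>) (\<lambda>f. f) \<and>
    (\<exists>c. norm c = 1 \<and> bshift (Suc 0) \<alpha> = (\<lambda>n. c * (unit_seq 0 n - cnj (\<alpha> 0) * \<alpha> n)))"
    (is "?L \<longleftrightarrow> ?R1 \<and> ?R2")
proof (intro iffI conjI)
  let ?t = "ten \<alpha> \<beta>" and ?d = "(Suc 0, 0) :: nat \<times> nat"
  note la = inner_seq_l2[OF a] and lb = inner_seq_l2[OF b]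
  {
    assume L: ?L
    show ?R1
      unfolding compact_seq_def
    proof (intro allI impI, elim conjE exE)
      fix X :: "nat \<Rightarrow> nat \<Rightarrow> complex" and B
      assume X: "range X \<subseteq> modsp \<beta>" and B: "\<forall>n. nrm (X n) \<le> B"
      have Xn: "X n \<in> modsp \<beta>" for n using X by auto
      note lX = modspD(1)[OF Xn]
      have M: "ten (unit_seq 0) (X n) \<in> modsp ?t" for n by (rule ten_unit_in_modsp[OF a b Xn])
      \<comment> \<open>Both correction terms vanish since \<open>adj \<beta>\<close> annihilates
        \<open>X n\<close>.\<close>
      have C: "commutator ?d ?t (ten (unit_seq 0) (X n)) = ten (unit_seq 0) (X n)" for n
      proof -
        have "pin (unit_seq 0) (ten (unit_seq 0) (X n)) = X n"
          by (simp add: pin_ten) (simp add: unit_seq_def)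
        then show ?thesis
          unfolding commutator_ten[OF a b M]
          by (auto simp: pin_ten adj_cmult modspD(2)[OF Xn] mul_cmult fun_eq_iff simp del: ip_unit_left)
      qed
      have XM: "range (\<lambda>n. ten (unit_seq 0) (X n)) \<subseteq> modsp ?t \<and> (\<exists>B. \<forall>n. nrm (ten (unit_seq 0) (X n)) \<le> B)"
        using M B by (auto simp: nrm_ten lX)
      then obtain r g where r: "strict_mono r" and g: "g \<in> modsp ?t"
        and lim: "(\<lambda>n. nrm (\<lambda>k. ten (unit_seq 0) (X (r n)) k - g k)) \<longlonglongrightarrow> 0"
        using L[unfolded compact_seq_def, rule_format, OF XM] unfolding C by blast
      note lg = modspD(1)[OF g]
      \<comment> \<open>Row 0 of the limit; taking row 0 is a contraction, so convergence passes to
        it.\<close>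
      let ?h = "pin (unit_seq 0) g"
      have lh: "l2 ?h" by (intro l2_pin l2_unit lg)
      have le: "nrm (\<lambda>k. X (r n) k - ?h k) \<le> nrm (\<lambda>k. ten (unit_seq 0) (X (r n)) k - g k)" for n
      proof -
        have "(\<lambda>k. X (r n) k - ?h k) = pin (unit_seq 0) (\<lambda>k. ten (unit_seq 0) (X (r n)) k - g k)"
          by (auto simp: fun_eq_iff pin_def unit_seq_def)
        then show ?thesis
          using nrm_pin_le[OF l2_unit l2_diff[OF l2_ten[OF l2_unit lX] lg]] by simp
      qed
      have lim': "(\<lambda>n. nrm (\<lambda>k. X (r n) k - ?h k)) \<longlonglongrightarrow> 0"
        by (rule tendsto_sandwich[OF _ _ tendsto_const lim]) (simp_all add: le)
      have "?h \<in> modsp \<beta>" by (rule modsp_closed[OF b Xn lh lim'])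
      then show "\<exists>r g. strict_mono r \<and> g \<in> modsp \<beta> \<and> (\<lambda>n. nrm (\<lambda>k. X (r n) k - g k)) \<longlonglongrightarrow> 0"
        using r lim' by blast
    qed
    show ?R2
    proof -
      define v where "v = (\<lambda>n. unit_seq 0 n - cnj (\<alpha> 0) * \<alpha> n)"
      define \<rho> where "\<rho> = complex_of_real (1 - (norm (\<alpha> 0))\<^sup>2)"
      define \<gamma> where "\<gamma> = ip v (bshift (Suc 0) \<alpha>)"
      \<comment> \<open>The image of \<open>v\<close> under the self-commutator of the one-variable
        compression; \<open>\<rho>\<close> is \<open>ip v v\<close>, rewritten by
        \<open>ip_defect\<close>.\<close>
      define w where "w = (\<lambda>n. \<rho> * v n - \<gamma> * bshift (Suc 0) \<alpha> n)"
      note D = ip_defect[OF a, folded v_def]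
      have rho: "\<rho> \<noteq> 0"
        unfolding \<rho>_def using a0 by (smt (verit) norm_ge_zero of_real_eq_0_iff power2_le_imp_le power_one)
      have lv: "l2 v" using D(1) modspD by blast
      have lw: "l2 w" unfolding w_def by (intro l2_diff l2_cmult lv l2_bshift la)
      \<comment> \<open>Mutually orthogonal vectors of equal norm, on whose second factor the
        commutator does not act.\<close>
      define X where "X n = ten v (shift n \<beta>)" for n
      have M: "X n \<in> modsp ?t" for n
        using modspD(2)[OF D(1)]
        by (auto simp: X_def modsp_def fun_eq_iff adj_ten la lb l2_ten lv l2_shift pin_ten adj_cmult
            adj_apply[of \<alpha>])
      have C: "commutator ?d ?t (X n) = ten w (shift n \<beta>)" for n
      proof -
        have "mul \<beta> (unit_seq n) = shift n \<beta>"
        proof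
          fix l
          have "((\<lambda>k. unit_seq n k * shift k \<beta> l) has_sum shift n \<beta> l) UNIV"
            by (rule has_sum_finite_neutralI[of "{n}"]) (auto simp: unit_seq_def)
          then show "mul \<beta> (unit_seq n) l = shift n \<beta> l"
            unfolding mul_def synthesis_def by (rule infsumI)
        qed
        then have Q: "mul \<beta> (adj \<beta> (shift n \<beta>)) = shift n \<beta>"
          using adj_mul[OF b l2_unit, of n] by simp
        have p: "pin (unit_seq 0) (X n) = (\<lambda>j. \<rho> * shift n \<beta> j)"
          "pin (bshift (Suc 0) \<alpha>) (X n) = (\<lambda>j. \<gamma> * shift n \<beta> j)"
          using D(2) by (simp_all add: X_def pin_ten \<rho>_def \<gamma>_def del: ip_unit_right)
        show ?thesis
          unfolding commutator_ten[OF a b M] p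
          by (auto simp: adj_cmult mul_cmult Q w_def v_def fun_eq_iff algebra_simps)
      qed
      have "nrm (X n) \<le> nrm v" for n
        by (simp add: X_def nrm_ten lv l2_shift lb inner_seq_nrm[OF b])
      then have XM: "range X \<subseteq> modsp ?t \<and> (\<exists>B. \<forall>n. nrm (X n) \<le> B)" using M by blast
      then obtain r g where r: "strict_mono r" and g: "g \<in> modsp ?t"
        and lim: "(\<lambda>n. nrm (\<lambda>k. ten w (shift (r n) \<beta>) k - g k)) \<longlonglongrightarrow> 0"
        using L[unfolded compact_seq_def, rule_format, OF XM] unfolding C by blast
      let ?Y = "\<lambda>n. ten w (shift (r n) \<beta>)"
      have lY: "l2 (?Y n)" for n by (intro l2_ten lw l2_shift lb)
      \<comment> \<open>Distinct images are orthogonal of equal norm, so consecutive terms keep a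
        fixed distance; convergence then forces \<open>w\<close> to be 0.\<close>
      have sq: "(nrm (\<lambda>k. ?Y n k - ?Y (Suc n) k))\<^sup>2 = 2 * (nrm w)\<^sup>2" for n
      proof -
        have "r n \<noteq> r (Suc n)" using strict_monoD[OF r, of n "Suc n"] by simp
        then have "ip (?Y n) (?Y (Suc n)) = 0"
          using b by (simp add: ip_ten lw l2_shift lb) (simp add: inner_seq_def orthonormal_def)
        then show ?thesis
          using nrm_sq_diff[OF lY[of n] lY[of "Suc n"]]
          by (simp add: nrm_ten lw l2_shift lb inner_seq_nrm[OF b])
      qed
      have le: "sqrt (2 * (nrm w)\<^sup>2) \<le> nrm (\<lambda>k. ?Y n k - g k) + nrm (\<lambda>k. ?Y (Suc n) k - g k)" for n
        using nrm_dist_triangle[OF lY[of n] modspD(1)[OF g] lY[of "Suc n"]]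
          nrm_commute[of g "?Y (Suc n)"]
        by (simp flip: sq[of n])
      have "(\<lambda>n. nrm (\<lambda>k. ?Y n k - g k) + nrm (\<lambda>k. ?Y (Suc n) k - g k)) \<longlonglongrightarrow> 0 + 0"
        by (intro tendsto_add lim LIMSEQ_Suc[OF lim])
      then have "sqrt (2 * (nrm w)\<^sup>2) \<le> 0 + 0"
        by (rule LIMSEQ_le_const) (use le in auto)
      then have "nrm w = 0" by simp
      then have w0: "w n = 0" for n using nrm_eq_0[OF lw] by simp
      \<comment> \<open>Otherwise \<open>w\<close> is \<open>\<rho>\<close> times \<open>v\<close>,
        so \<open>v\<close> vanishes at 0, whereas its value there is \<open>\<rho>\<close>.\<close>
      have "\<gamma> \<noteq> 0"
      proof
        assume "\<gamma> = 0"
        then have "v 0 = 0" using w0[of 0] rho by (simp add: w_def)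
        then show False using D(2) rho by (simp add: \<rho>_def)
      qed
      define c where "c = \<rho> / \<gamma>"
      have eq: "bshift (Suc 0) \<alpha> = (\<lambda>n. c * v n)"
        using w0 \<open>\<gamma> \<noteq> 0\<close> by (auto simp: w_def c_def field_simps fun_eq_iff)
      have "nrm v \<noteq> 0" using D(3) rho by (auto simp: \<rho>_def simp del: of_real_diff of_real_power)
      moreover have "(norm c * nrm v)\<^sup>2 = (nrm v)\<^sup>2"
        using D(3,4) unfolding eq nrm_cmult by simp
      ultimately have "norm c = 1" by (simp add: power_mult_distrib power2_eq_1_iff)
        (smt (verit) norm_ge_zero)
      then show ?thesis using eq unfolding v_def by blast
    qed
  }
  {
    assume R: "?R1 \<and> ?R2"
    then obtain c where c: "norm c = 1" "bshift (Suc 0) \<alpha> = (\<lambda>n. c * (unit_seq 0 n - cnj (\<alpha> 0) * \<alpha> n))"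
      by blast
    show ?L
      unfolding compact_seq_def
    proof (intro allI impI, elim conjE exE)
      fix X :: "nat \<Rightarrow> nat \<times> nat \<Rightarrow> complex" and B
      assume X: "range X \<subseteq> modsp ?t" and B: "\<forall>n. nrm (X n) \<le> B"
      have Xn: "X n \<in> modsp ?t" for n using X by auto
      note lX = modspD(1)[OF Xn]
      \<comment> \<open>The commutator maps \<open>X n\<close> to
        \<open>ten (unit_seq 0) (Y n)\<close>, so a convergent subsequence of \<open>Y\<close> is
        all that is needed.\<close>
      define Y where "Y n = proj \<beta> (pin (unit_seq 0) (X n))" for n
      have Y: "Y n \<in> modsp \<beta>" for n
        unfolding Y_def by (intro proj_in_modsp b l2_pin l2_unit lX)
      have "nrm (Y n) \<le> B" for n
        unfolding Y_def using nrm_proj_le[OF b l2_pin[OF l2_unit lX], of 0 n]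
          nrm_pin_le[OF l2_unit lX, of 0 n] B[rule_format, of n] by simp
      then have XM: "range Y \<subseteq> modsp \<beta> \<and> (\<exists>B. \<forall>n. nrm (Y n) \<le> B)" using Y by blast
      then obtain r g where r: "strict_mono r" and g: "g \<in> modsp \<beta>"
        and lim: "(\<lambda>n. nrm (\<lambda>k. Y (r n) k - g k)) \<longlonglongrightarrow> 0"
        using conjunct1[OF R, unfolded compact_seq_def, rule_format, OF XM] by blast
      have C: "(\<lambda>k. commutator ?d ?t (X n) k - ten (unit_seq 0) g k) = ten (unit_seq 0) (\<lambda>k. Y n k - g k)" for n
        unfolding commutator_ten_blaschke[OF a b Xn c] Y_def by (auto simp: fun_eq_iff algebra_simps)
      have "nrm (\<lambda>k. commutator ?d ?t (X n) k - ten (unit_seq 0) g k) = nrm (\<lambda>k. Y n k - g k)" for n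
        unfolding C by (simp add: nrm_ten l2_diff modspD(1)[OF Y] modspD(1)[OF g])
      then show "\<exists>r g. strict_mono r \<and> g \<in> modsp ?t \<and>
          (\<lambda>n. nrm (\<lambda>k. commutator ?d ?t (X (r n)) k - g k)) \<longlonglongrightarrow> 0"
        using r lim ten_unit_in_modsp[OF a b g] by (intro exI[of _ r] exI[of _ "ten (unit_seq 0) g"]) simp
    qed
  }
qed

section \<open>Hardy space functions and their coefficients\<close>

definition chr1 :: "complex \<Rightarrow> nat \<Rightarrow> complex" where
  "chr1 z n = z ^ n"

definition chr2 :: "complex \<times> complex \<Rightarrow> nat \<times> nat \<Rightarrow> complex" where
  "chr2 z = ten (chr1 (fst z)) (chr1 (snd z))"

lemma character_chr1: assumes "norm z < 1" shows "character (chr1 z)"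
proof -
  have "summable (\<lambda>n. ((norm z)\<^sup>2) ^ n)"
    using assms by (intro summable_geometric) (simp add: abs_square_less_1)
  then have "l2 (chr1 z)"
    unfolding l2_def chr1_def by (subst summable_on_UNIV_nonneg_real_iff) (auto simp: norm_power power_mult[symmetric] mult.commute)
  then show ?thesis by (simp add: character_def chr1_def power_add)
qed

lemma character_chr2: assumes "z \<in> bidisk" shows "character (chr2 z)"
proof -
  have "character (chr1 (fst z))" "character (chr1 (snd z))"
    using assms by (auto simp: bidisk_def intro!: character_chr1)
  then show ?thesis by (auto simp: character_def chr2_def l2_ten zero_prod_def mult_ac)
qed

lemma ker_seq_chr2: "ker_seq (chr2 z) = ten (ker_seq (chr1 (fst z))) (ker_seq (chr1 (snd z)))"
  by (auto simp: ker_seq_def chr2_def fun_eq_iff)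

lemma ev_chr1_eq_0:
  assumes a: "l2 a" and 0: "\<And>z. norm z < 1 \<Longrightarrow> ev (chr1 z) a = 0"
  shows "a = (\<lambda>n. 0)"
proof (rule ccontr)
  assume "a \<noteq> (\<lambda>n. 0)"
  then obtain m where m: "a m \<noteq> 0" by auto
  have s: "(\<lambda>n. a n * (z - 0) ^ n) sums (\<lambda>z. 0) z" if "norm (z - 0) < 1" for z
    using ev_has_sum[OF character_chr1 a, of z] that 0[of z]
    by (intro has_sum_imp_sums) (simp add: chr1_def)
  \<comment> \<open>The series represents the zero function, so the punctured disk free of zeros
    that \<open>powser_0_nonzero\<close> supplies is absurd. That rule needs a nonzero coefficient
    of positive index, hence the case distinction.\<close>
  obtain r where "0 < r" "\<And>z :: complex. z \<in> cball 0 r - {0} \<Longrightarrow> (0 :: complex) \<noteq> 0"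
  proof (cases "a 0 = 0")
    case True
    then have "m > 0" using m by (cases m) auto
    from powser_0_nonzero[OF zero_less_one s refl m this] that show ?thesis by metis
  next
    case False
    have "(\<lambda>n. a n * 0 ^ n) sums 0" using s[of 0] by simp
    then have "a 0 = 0" using powser_sums_zero_iff by blast
    then show ?thesis using False by simp
  qed
  from this(2)[of "of_real r"] \<open>0 < r\<close> show False by simp
qed

lemma ev_chr1_inj:
  assumes "l2 a" "l2 b" "\<And>z. norm z < 1 \<Longrightarrow> ev (chr1 z) a = ev (chr1 z) b"
  shows "a = b"
proof -
  have "(\<lambda>n. a n - b n) = (\<lambda>n. 0)"
    using assms l2_ker_seq[OF character_chr1]
    by (intro ev_chr1_eq_0 l2_diff) (auto simp: ev_ip ip_diff_left)
  then show ?thesis by (auto simp: fun_eq_iff)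
qed

text \<open>One-variable uniqueness twice: for a fixed first point the partial evaluation is a
  series in the second variable, so its coefficients vanish, and each of them is in turn a series in
  the first variable.\<close>

lemma ev_chr2_eq_0:
  assumes a: "l2 a" and 0: "\<And>z. z \<in> bidisk \<Longrightarrow> ev (chr2 z) a = 0"
  shows "a = (\<lambda>k. 0)"
proof -
  have "(\<lambda>i. a (i, j)) = (\<lambda>i. 0)" for j
  proof (rule ev_chr1_eq_0[OF l2_slice[OF a]])
    fix z :: complex assume z: "norm z < 1"
    note lz = l2_ker_seq[OF character_chr1[OF z]]
    have "pin (ker_seq (chr1 z)) a = (\<lambda>j. 0)"
    proof (rule ev_chr1_eq_0[OF l2_pin[OF lz a]])
      fix w :: complex assume w: "norm w < 1"
      show "ev (chr1 w) (pin (ker_seq (chr1 z)) a) = 0"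
        using 0[of "(z, w)"] z w
        by (simp add: ev_ip ker_seq_chr2 ip_ten_right[OF lz l2_ker_seq[OF character_chr1[OF w]] a] bidisk_def)
    qed
    then show "ev (chr1 z) (\<lambda>i. a (i, j)) = 0"
      by (simp add: ev_ip pin_def fun_eq_iff)
  qed
  then show ?thesis by (auto simp: fun_eq_iff)
qed

text \<open>Vanishing off the bidisk copies the normalisation of \<open>hardy2\<close>, so that
  square-summable sequences correspond one to one to its elements.\<close>

definition h2_fun :: "(nat \<times> nat \<Rightarrow> complex) \<Rightarrow> complex \<times> complex \<Rightarrow> complex" where
  "h2_fun a z = (if z \<in> bidisk then ev (chr2 z) a else 0)"

lemma h2_expansion_iff: "h2_expansion a f \<longleftrightarrow> l2 a \<and> (\<forall>z\<in>bidisk. f z = ev (chr2 z) a)"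
proof -
  have "(\<lambda>(m, n). a (m, n) * fst z ^ m * snd z ^ n) = (\<lambda>k. a k * chr2 z k)" for z
    by (auto simp: fun_eq_iff chr2_def chr1_def)
  moreover have "((\<lambda>k. a k * chr2 z k) has_sum f z) UNIV \<longleftrightarrow> f z = ev (chr2 z) a" if "l2 a" "z \<in> bidisk" for z
    using ev_has_sum[OF character_chr2 that(1), OF that(2)] has_sum_unique by metis
  ultimately show ?thesis
    unfolding h2_expansion_def l2_def[symmetric] by auto
qed

lemma h2_fun_diff: "l2 a \<Longrightarrow> l2 b \<Longrightarrow> h2_fun (\<lambda>k. a k - b k) = (\<lambda>z. h2_fun a z - h2_fun b z)"
  using l2_ker_seq[OF character_chr2] by (auto simp: h2_fun_def fun_eq_iff ev_ip ip_diff_left)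

lemma h2_coeff_eq: assumes "h2_expansion a f" shows "h2_coeff f = a"
  unfolding h2_coeff_def
proof (rule the_equality)
  show "b = a" if "h2_expansion b f" for b
  proof -
    have "(\<lambda>k. b k - a k) = (\<lambda>k. 0)"
      using assms that l2_ker_seq[OF character_chr2]
      by (intro ev_chr2_eq_0 l2_diff) (auto simp: h2_expansion_iff ev_ip ip_diff_left)
    then show ?thesis by (auto simp: fun_eq_iff)
  qed
qed (fact assms)

lemma h2_coeff_h2_fun: "l2 a \<Longrightarrow> h2_coeff (h2_fun a) = a"
  by (rule h2_coeff_eq) (auto simp: h2_expansion_iff h2_fun_def)

lemma hardy2_eq: "hardy2 = h2_fun ` {a. l2 a}"
proof (intro equalityI subsetI)
  fix f assume "f \<in> hardy2"
  then obtain a where a: "h2_expansion a f" and 0: "\<forall>z. z \<notin> bidisk \<longrightarrow> f z = 0"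
    by (auto simp: hardy2_def)
  have "f = h2_fun a" using a 0 by (auto simp: h2_expansion_iff h2_fun_def fun_eq_iff)
  then show "f \<in> h2_fun ` {a. l2 a}" using a by (auto simp: h2_expansion_iff)
qed (auto simp: hardy2_def h2_expansion_iff h2_fun_def)

lemma h2_inner_h2_fun: "l2 a \<Longrightarrow> l2 b \<Longrightarrow> h2_inner (h2_fun a) (h2_fun b) = ip a b"
  by (simp add: h2_inner_def h2_coeff_h2_fun ip_def)

lemma h2_norm_h2_fun: "l2 a \<Longrightarrow> h2_norm (h2_fun a) = nrm a"
  by (simp add: h2_norm_def h2_inner_h2_fun ip_self del: of_real_power)

lemma h2_fun_shift: "(\<lambda>z. chr2 z d * h2_fun a z) = h2_fun (shift d a)"
  by (auto simp: h2_fun_def fun_eq_iff ev_shift character_chr2)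

text \<open>Test against \<open>a - b\<close> itself. This serves the uniqueness halves of the
  definite descriptions in \<open>orth_proj\<close> and \<open>adjoint_on\<close>.\<close>

lemma seq_modsp_unique:
  assumes a: "a \<in> modsp t" and b: "b \<in> modsp t" and eq: "\<And>h. h \<in> modsp t \<Longrightarrow> ip a h = ip b h"
    and t: "inner_seq t"
  shows "a = b"
proof -
  have l: "l2 a" "l2 b" using a b modspD by blast+
  have "(\<lambda>k. a k - b k) \<in> modsp t" using a b t by (simp add: modsp_def l2_diff adj_diff)
  then have "ip (\<lambda>k. a k - b k) (\<lambda>k. a k - b k) = 0"
    using eq l by (simp add: ip_diff_left l2_diff)
  then have "nrm (\<lambda>k. a k - b k) = 0" by (simp add: ip_self)
  then have "(\<lambda>k. a k - b k) = (\<lambda>k. 0)" by (intro nrm_eq_0 l2_diff l)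
  then show ?thesis by (auto simp: fun_eq_iff)
qed

section \<open>Transfer of projection, adjoint and compactness from functions to
  coefficients\<close>

context
  fixes t :: "nat \<times> nat \<Rightarrow> complex" and \<theta> :: "complex \<times> complex \<Rightarrow> complex"
  assumes t: "inner_seq t" and \<theta>: "\<And>z. z \<in> bidisk \<Longrightarrow> \<theta> z = ev (chr2 z) t"
begin

lemma h2_fun_mul: "l2 g \<Longrightarrow> (\<lambda>z. \<theta> z * h2_fun g z) = h2_fun (mul t g)"
  by (auto simp: h2_fun_def fun_eq_iff ev_mul[OF character_chr2 t] \<theta>)

lemma model_space_eq: "model_space \<theta> = h2_fun ` modsp t"
proof -
  have "(\<forall>g. l2 g \<longrightarrow> ip a (mul t g) = 0) \<longleftrightarrow> adj t a = (\<lambda>k. 0)" if a: "l2 a" for a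
  proof
    assume "\<forall>g. l2 g \<longrightarrow> ip a (mul t g) = 0"
    then have "ip (adj t a) (adj t a) = 0" using l2_adj[OF t a] by (simp add: ip_mul_right t a)
    then have "nrm (adj t a) = 0" by (simp add: ip_self)
    then show "adj t a = (\<lambda>k. 0)" by (intro nrm_eq_0 l2_adj t a)
  qed (simp add: ip_mul_right t a)
  then have "modsp t = {a. l2 a \<and> (\<forall>g. l2 g \<longrightarrow> ip a (mul t g) = 0)}"
    by (auto simp: modsp_def)
  then show ?thesis
    by (auto simp: model_space_def hardy2_eq h2_fun_mul h2_inner_h2_fun l2_mul[OF t])
qed

lemma orth_proj_eq:
  assumes f: "l2 f" shows "orth_proj (model_space \<theta>) (h2_fun f) = h2_fun (proj t f)"
  unfolding orth_proj_def
proof (rule the_equality)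
  note p = proj_in_modsp[OF t f]
  have *: "h2_inner (\<lambda>z. h2_fun f z - h2_fun a z) (h2_fun h) = ip f h - ip a h" if "l2 a" "l2 h" for a h
    using f that by (simp add: h2_inner_h2_fun l2_diff ip_diff_left flip: h2_fun_diff)
  show "h2_fun (proj t f) \<in> model_space \<theta> \<and>
      (\<forall>h\<in>model_space \<theta>. h2_inner (\<lambda>z. h2_fun f z - h2_fun (proj t f) z) h = 0)"
    using p by (auto simp: model_space_eq * modspD ip_proj[OF t f])
  fix g assume g: "g \<in> model_space \<theta> \<and> (\<forall>h\<in>model_space \<theta>. h2_inner (\<lambda>z. h2_fun f z - g z) h = 0)"
  then obtain b where b: "b \<in> modsp t" "g = h2_fun b" by (auto simp: model_space_eq)
  have "b = proj t f"
  proof (rule seq_modsp_unique[OF b(1) p _ t])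
    fix h assume h: "h \<in> modsp t"
    then have "h2_inner (\<lambda>z. h2_fun f z - h2_fun b z) (h2_fun h) = 0"
      using g by (auto simp: b model_space_eq)
    then show "ip b h = ip (proj t f) h"
      using h b by (simp add: * modspD ip_proj[OF t f])
  qed
  then show "g = h2_fun (proj t f)" using b by simp
qed

lemma adjoint_on_eq:
  assumes S: "\<And>f. f \<in> modsp t \<Longrightarrow> S (h2_fun f) = h2_fun (proj t (shift d f))" and g: "g \<in> modsp t"
  shows "adjoint_on (model_space \<theta>) S (h2_fun g) = h2_fun (bshift d g)"
  unfolding adjoint_on_def
proof (rule the_equality)
  note lg = modspD(1)[OF g]
  note p = bshift_in_modsp[OF g, of d]
  have *: "h2_inner (S (h2_fun f)) (h2_fun g) = ip f (bshift d g)" if "f \<in> modsp t" for f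
    using that modspD[OF g] modspD(1)[OF that]
    by (simp add: S h2_inner_h2_fun l2_proj t l2_shift ip_proj ip_shift_left)
  show "h2_fun (bshift d g) \<in> model_space \<theta> \<and>
      (\<forall>f\<in>model_space \<theta>. h2_inner (S f) (h2_fun g) = h2_inner f (h2_fun (bshift d g)))"
    using p by (auto simp: model_space_eq * h2_inner_h2_fun modspD)
  fix h assume h: "h \<in> model_space \<theta> \<and> (\<forall>f\<in>model_space \<theta>. h2_inner (S f) (h2_fun g) = h2_inner f h)"
  then obtain b where b: "b \<in> modsp t" "h = h2_fun b" by (auto simp: model_space_eq)
  have "b = bshift d g"
  proof (rule seq_modsp_unique[OF b(1) p _ t])
    fix f assume f: "f \<in> modsp t"
    then have "ip f (bshift d g) = ip f b"
      using h * h2_inner_h2_fun[OF modspD(1)[OF f] modspD(1)[OF b(1)]] by (auto simp: b model_space_eq)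
    then show "ip b f = ip (bshift d g) f" by (metis ip_cnj)
  qed
  then show "h = h2_fun (bshift d g)" using b by simp
qed

text \<open>\<open>h2_fun\<close> is an isometry of \<open>modsp t\<close> onto the model space and
  carries \<open>proj t\<close> after \<open>shift d\<close> to the compressed multiplication, so
  bounded sequences and limits can be moved both ways. A general \<open>d\<close> covers both
  coordinates.\<close>

lemma essentially_normal_iff:
  "essentially_normal_on (model_space \<theta>) (\<lambda>f. orth_proj (model_space \<theta>) (\<lambda>z. chr2 z d * f z))
     \<longleftrightarrow> compact_seq (modsp t) (commutator d t)"
proof -
  define S where "S f = orth_proj (model_space \<theta>) (\<lambda>z. chr2 z d * f z)" for f
  have S: "S (h2_fun f) = h2_fun (proj t (shift d f))" if "f \<in> modsp t" for f
    using that by (simp add: S_def h2_fun_shift orth_proj_eq l2_shift modspD)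
  have C: "adjoint_on (model_space \<theta>) S (S (h2_fun f)) z - S (adjoint_on (model_space \<theta>) S (h2_fun f)) z
      = h2_fun (commutator d t f) z" (is ?C) and lC: "l2 (commutator d t f)" if f: "f \<in> modsp t" for f z
  proof -
    have p: "proj t (shift d f) \<in> modsp t" by (intro proj_in_modsp t l2_shift modspD[OF f])
    note b = bshift_in_modsp[OF f, of d]
    have l: "l2 (bshift d (proj t (shift d f)))" "l2 (proj t (shift d (bshift d f)))"
      using modspD(1)[OF f] by (auto intro!: l2_bshift l2_proj[OF t] l2_shift)
    then show "l2 (commutator d t f)" unfolding commutator_def by (rule l2_diff)
    show ?C unfolding commutator_def using f p b l
      by (simp add: S adjoint_on_eq[where S=S, OF S] h2_fun_diff)
  qed
  have N: "h2_norm (\<lambda>z. h2_fun (commutator d t f) z - h2_fun g z) = nrm (\<lambda>k. commutator d t f k - g k)"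
    if "f \<in> modsp t" "g \<in> modsp t" for f g
    using lC[OF that(1)] modspD(1)[OF that(2)] by (simp add: h2_norm_h2_fun l2_diff flip: h2_fun_diff)
  show ?thesis
    unfolding essentially_normal_on_def S_def[symmetric] compact_operator_on_def
  proof
    assume L: "\<forall>X :: nat \<Rightarrow> complex \<times> complex \<Rightarrow> complex. range X \<subseteq> model_space \<theta> \<and> (\<exists>C. \<forall>n. h2_norm (X n) \<le> C) \<longrightarrow>
      (\<exists>r g. strict_mono r \<and> g \<in> model_space \<theta> \<and>
        (\<lambda>n. h2_norm (\<lambda>z. (adjoint_on (model_space \<theta>) S (S (X (r n))) z - S (adjoint_on (model_space \<theta>) S (X (r n))) z) - g z)) \<longlonglongrightarrow> 0)"
    show "compact_seq (modsp t) (commutator d t)"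
      unfolding compact_seq_def
    proof (intro allI impI, elim conjE exE)
      fix X :: "nat \<Rightarrow> nat \<times> nat \<Rightarrow> complex" and B
      assume X: "range X \<subseteq> modsp t" and B: "\<forall>n. nrm (X n) \<le> B"
      have Xn: "X n \<in> modsp t" for n using X by auto
      have "range (\<lambda>n. h2_fun (X n)) \<subseteq> model_space \<theta> \<and> (\<exists>C. \<forall>n. h2_norm (h2_fun (X n)) \<le> C)"
        using X B by (auto simp: model_space_eq h2_norm_h2_fun modspD(1)[OF Xn])
      from L[rule_format, OF this] obtain r g' where r': "strict_mono r" "g' \<in> model_space \<theta>"
        and lim': "(\<lambda>n. h2_norm (\<lambda>z. h2_fun (commutator d t (X (r n))) z - g' z)) \<longlonglongrightarrow> 0"
        unfolding C[OF Xn] by blast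
      then obtain g where g: "g' = h2_fun g" and r: "strict_mono r" "g \<in> modsp t"
        by (auto simp: model_space_eq)
      note lim = lim'[unfolded g]
      show "\<exists>r g. strict_mono r \<and> g \<in> modsp t \<and> (\<lambda>n. nrm (\<lambda>k. commutator d t (X (r n)) k - g k)) \<longlonglongrightarrow> 0"
        using r lim unfolding N[OF Xn r(2)] by blast
    qed
  next
    assume R: "compact_seq (modsp t) (commutator d t)"
    show "\<forall>X :: nat \<Rightarrow> complex \<times> complex \<Rightarrow> complex. range X \<subseteq> model_space \<theta> \<and> (\<exists>C. \<forall>n. h2_norm (X n) \<le> C) \<longrightarrow>
      (\<exists>r g. strict_mono r \<and> g \<in> model_space \<theta> \<and>
        (\<lambda>n. h2_norm (\<lambda>z. (adjoint_on (model_space \<theta>) S (S (X (r n))) z - S (adjoint_on (model_space \<theta>) S (X (r n))) z) - g z)) \<longlonglongrightarrow> 0)"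
    proof (intro allI impI, elim conjE exE)
      fix X :: "nat \<Rightarrow> complex \<times> complex \<Rightarrow> complex" and B
      assume X: "range X \<subseteq> model_space \<theta>" and B: "\<forall>n. h2_norm (X n) \<le> B"
      have "\<forall>n. \<exists>Y. Y \<in> modsp t \<and> X n = h2_fun Y" using X by (auto simp: model_space_eq)
      then obtain Y where Yn: "\<And>n. Y n \<in> modsp t" and XY: "\<And>n. X n = h2_fun (Y n)" by metis
      have "range Y \<subseteq> modsp t \<and> (\<exists>C. \<forall>n. nrm (Y n) \<le> C)"
        using Yn B by (auto simp: XY h2_norm_h2_fun modspD(1)[OF Yn])
      from R[unfolded compact_seq_def, rule_format, OF this] obtain r g where r: "strict_mono r" "g \<in> modsp t"
        and lim: "(\<lambda>n. nrm (\<lambda>k. commutator d t (Y (r n)) k - g k)) \<longlonglongrightarrow> 0" by blast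
      then show "\<exists>r g. strict_mono r \<and> g \<in> model_space \<theta> \<and>
        (\<lambda>n. h2_norm (\<lambda>z. (adjoint_on (model_space \<theta>) S (S (X (r n))) z - S (adjoint_on (model_space \<theta>) S (X (r n))) z) - g z)) \<longlonglongrightarrow> 0"
        by (intro exI[of _ r] exI[of _ "h2_fun g"]) (use r(2) in \<open>simp add: XY C[OF Yn] N[OF Yn r(2)], simp add: model_space_eq\<close>)
    qed
  qed
qed

end

section \<open>Exchange of the two variables\<close>

definition swap_seq :: "('i \<times> 'j \<Rightarrow> complex) \<Rightarrow> 'j \<times> 'i \<Rightarrow> complex" where
  "swap_seq f k = f (prod.swap k)"

lemma swap_seq_swap_seq [simp]: "swap_seq (swap_seq f) = f"
  by (simp add: swap_seq_def fun_eq_iff)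

lemma swap_seq_ten: "swap_seq (ten a b) = ten b a"
  by (auto simp: swap_seq_def fun_eq_iff)

lemma bij_swap: "bij prod.swap"
  by (rule o_bij[of prod.swap]) auto

lemma ip_swap: "ip (swap_seq f) (swap_seq g) = ip f g"
  unfolding swap_seq_def [abs_def] by (rule ip_comp_bij[OF bij_swap])

lemma nrm_swap: "nrm (swap_seq f) = nrm f"
  unfolding swap_seq_def [abs_def] by (rule nrm_comp_bij[OF bij_swap])

lemma l2_swap: "l2 f \<Longrightarrow> l2 (swap_seq f)"
  unfolding swap_seq_def [abs_def] by (rule l2_comp_inj) auto

lemma shift_swap: "swap_seq (shift d f) = shift (prod.swap d) (swap_seq f)"
  by (cases d) (auto simp: swap_seq_def shift_def fun_eq_iff range_plus_prod)

lemma bshift_swap: "swap_seq (bshift d f) = bshift (prod.swap d) (swap_seq f)"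
  by (cases d) (auto simp: swap_seq_def bshift_def fun_eq_iff)

lemma adj_swap: "swap_seq (adj t f) = adj (swap_seq t) (swap_seq f)"
  by (rule ext) (simp add: swap_seq_def[of "adj t f"] adj_apply ip_swap flip: shift_swap[of "prod.swap k" for k, simplified])

lemma mul_swap:
  fixes t :: "'a::cancel_comm_monoid_add \<times> 'b::cancel_comm_monoid_add \<Rightarrow> complex"
  shows "swap_seq (mul t g) = mul (swap_seq t) (swap_seq g)"
proof
  fix k :: "'b \<times> 'a"
  have "mul t g (prod.swap k) = (\<Sum>\<^sub>\<infinity>p. g (prod.swap p) * shift (prod.swap p) t (prod.swap k))"
    unfolding mul_def synthesis_def
    using infsum_reindex_bij_betw[OF bij_swap, of "\<lambda>p. g p * shift p t (prod.swap k)"] by simp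
  also have "\<dots> = mul (swap_seq t) (swap_seq g) k"
    unfolding mul_def synthesis_def
    by (simp add: swap_seq_def[of g] flip: swap_seq_def[of _ k] add: shift_swap)
  finally show "swap_seq (mul t g) k = mul (swap_seq t) (swap_seq g) k"
    by (simp add: swap_seq_def)
qed

lemma proj_swap: "swap_seq (proj t f) = proj (swap_seq t) (swap_seq f)"
  by (rule ext) (simp add: proj_apply swap_seq_def[of "proj t f"] flip: adj_swap mul_swap, simp add: swap_seq_def)

lemma commutator_swap:
  "swap_seq (commutator d t f) = commutator (prod.swap d) (swap_seq t) (swap_seq f)"
  by (rule ext) (simp add: commutator_def swap_seq_def[of "\<lambda>k. _ k - _ k"]
      flip: shift_swap bshift_swap proj_swap, simp add: swap_seq_def)

lemma modsp_swap: "f \<in> modsp t \<Longrightarrow> swap_seq f \<in> modsp (swap_seq t)"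
  by (auto simp: modsp_def l2_swap simp flip: adj_swap) (simp add: swap_seq_def fun_eq_iff)

text \<open>The exchange is unitary and respects every ingredient of the commutator. As it is an
  involution, this implication also yields its converse.\<close>

lemma compact_seq_swap:
  fixes t :: "'a::cancel_comm_monoid_add \<times> 'b::cancel_comm_monoid_add \<Rightarrow> complex"
  assumes "compact_seq (modsp t) (commutator d t)"
  shows "compact_seq (modsp (swap_seq t)) (commutator (prod.swap d) (swap_seq t))"
  unfolding compact_seq_def
proof (intro allI impI, elim conjE exE)
  fix X :: "nat \<Rightarrow> 'b \<times> 'a \<Rightarrow> complex" and B
  assume X: "range X \<subseteq> modsp (swap_seq t)" and B: "\<forall>n. nrm (X n) \<le> B"
  have "swap_seq (X n) \<in> modsp t" for n
    using X modsp_swap[of "X n" "swap_seq t"] by auto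
  then have "range (\<lambda>n. swap_seq (X n)) \<subseteq> modsp t \<and> (\<exists>B. \<forall>n. nrm (swap_seq (X n)) \<le> B)"
    using B by (auto simp: nrm_swap)
  from assms[unfolded compact_seq_def, rule_format, OF this] obtain r g where r: "strict_mono r" "g \<in> modsp t"
    and lim: "(\<lambda>n. nrm (\<lambda>k. commutator d t (swap_seq (X (r n))) k - g k)) \<longlonglongrightarrow> 0" by blast
  have "nrm (\<lambda>k. commutator d t (swap_seq (X n)) k - g k) =
      nrm (\<lambda>k. commutator (prod.swap d) (swap_seq t) (X n) k - swap_seq g k)" for n
  proof -
    have "(\<lambda>k. commutator (prod.swap d) (swap_seq t) (X n) k - swap_seq g k)
        = swap_seq (\<lambda>k. commutator d t (swap_seq (X n)) k - g k)"
      using commutator_swap[of d t "swap_seq (X n)"] by (simp add: fun_eq_iff swap_seq_def)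
    then show ?thesis by (simp add: nrm_swap)
  qed
  then show "\<exists>r g. strict_mono r \<and> g \<in> modsp (swap_seq t) \<and>
      (\<lambda>n. nrm (\<lambda>k. commutator (prod.swap d) (swap_seq t) (X (r n)) k - g k)) \<longlonglongrightarrow> 0"
    using lim r modsp_swap[OF r(2)] by (intro exI[of _ r] exI[of _ "swap_seq g"]) simp
qed

section \<open>Coefficients of inner functions\<close>

abbreviation circle_measure :: "real measure" where
  "circle_measure \<equiv> lebesgue_on {0..2 * pi}"

lemma integral_cis:
  "integral\<^sup>L circle_measure (\<lambda>t. cis (of_int n * t)) = (if n = 0 then of_real (2 * pi) else 0)"
proof -
  have "integral\<^sup>L circle_measure (\<lambda>t. cis (of_int n * t)) = integral {0..2*pi} (\<lambda>t. cis (of_int n * t))"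
    by (intro lebesgue_integral_eq_integral continuous_imp_integrable_real continuous_intros) auto
  also have "((\<lambda>t. cis (of_int n * t)) has_integral (if n = 0 then of_real (2 * pi) else 0)) {0..2*pi}"
  proof (cases "n = 0")
    case True
    then show ?thesis using has_integral_const_real[of "1::complex" 0 "2*pi"] by (simp add: scaleR_conv_of_real)
  next
    case False
    have "((\<lambda>t. cis (of_int n * t)) has_integral
        cis (of_int n * (2 * pi)) / (\<i> * of_int n) - cis (of_int n * 0) / (\<i> * of_int n)) {0..2*pi}"
    proof (rule fundamental_theorem_of_calculus)
      fix t :: real
      show "((\<lambda>t. cis (of_int n * t) / (\<i> * of_int n)) has_vector_derivative cis (of_int n * t)) (at t within {0..2*pi})"
      proof -
        have "((\<lambda>z. exp (\<i> * of_int n * z) / (\<i> * of_int n)) has_field_derivative exp (\<i> * of_int n * of_real t)) (at (of_real t))"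
          using False by (auto intro!: derivative_eq_intros)
        from has_vector_derivative_real_field[OF this, of "{0..2*pi}"] show ?thesis
          by (simp add: cis_conv_exp mult.assoc)
      qed
    qed auto
    moreover have "cis (of_int n * (2 * pi)) = 1"
      unfolding mult.commute[of "of_int n" "2 * pi"] by (simp only: complex_eq_iff cis.sel cos_int_2pin sin_int_2pin) simp
    ultimately show ?thesis using False by simp
  qed
  then have "integral {0..2*pi} (\<lambda>t. cis (of_int n * t)) = (if n = 0 then of_real (2 * pi) else 0)"
    by (rule integral_unique)
  finally show ?thesis .
qed

text \<open>With \<open>B\<close> a bound for \<open>G\<close>, the majorant
  \<open>B * norm (c n)\<close> is summable and independent of \<open>t\<close>, which permits
  termwise integration. The factor \<open>G\<close> lets one of two series be expanded while the
  other stays intact.\<close>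

lemma integral_uniform_series:
  fixes G :: "real \<Rightarrow> complex"
  assumes G: "continuous_on {0..2*pi} G" and c: "summable (\<lambda>n. norm (c n))"
    and u: "\<And>n. continuous_on {0..2*pi} (u n)" "\<And>n t. norm (u n t) \<le> 1"
  shows "(\<lambda>n. integral\<^sup>L circle_measure (\<lambda>t. G t * (c n * u n t))) sums
     integral\<^sup>L circle_measure (\<lambda>t. G t * (\<Sum>n. c n * u n t))"
proof -
  obtain B where "\<forall>w\<in>G ` {0..2*pi}. norm w \<le> B"
    using compact_imp_bounded[OF compact_continuous_image[OF G compact_Icc]] unfolding bounded_iff by blast
  then have B: "norm (G t) \<le> B" if "t \<in> {0..2*pi}" for t using that by blast
  have le: "norm (G t * (c n * u n t)) \<le> B * norm (c n)" if "t \<in> {0..2*pi}" for t n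
  proof -
    have "norm (G t) * (norm (c n) * norm (u n t)) \<le> B * (norm (c n) * 1)"
      using B[OF that] u(2)[of n t] by (intro mult_mono) (auto intro: order_trans[OF norm_ge_zero])
    then show ?thesis by (simp add: norm_mult)
  qed
  have su: "summable (\<lambda>n. norm (c n * u n t))" for t
    by (rule summable_comparison_test'[OF c, of 0]) (use u(2)[of _ t] in \<open>simp add: norm_mult mult_left_le\<close>)
  have "(\<lambda>n. integral\<^sup>L circle_measure (\<lambda>t. G t * (c n * u n t))) sums
     integral\<^sup>L circle_measure (\<lambda>t. \<Sum>n. G t * (c n * u n t))"
  proof (rule sums_integral)
    have cont: "continuous_on {0..2*pi} (\<lambda>t. G t * (c n * u n t))" for n
      by (intro continuous_intros G u)
    show i: "integrable circle_measure (\<lambda>t. G t * (c n * u n t))" for n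
      by (rule continuous_imp_integrable_real[OF cont])
    show "AE t in circle_measure. summable (\<lambda>n. norm (G t * (c n * u n t)))"
      using su by (intro AE_I2) (simp add: norm_mult[of "G _"] summable_mult)
    show "summable (\<lambda>n. \<integral>t. norm (G t * (c n * u n t)) \<partial>circle_measure)"
    proof (rule summable_comparison_test'[of "\<lambda>n. 2 * pi * (B * norm (c n))" 0])
      show "summable (\<lambda>n. 2 * pi * (B * norm (c n)))" by (intro summable_mult c)
      fix n
      have "(\<integral>t. norm (G t * (c n * u n t)) \<partial>circle_measure) \<le> (\<integral>t. B * norm (c n) \<partial>circle_measure)"
        by (rule integral_mono[OF integrable_norm[OF i]]) (use le in \<open>auto intro!: continuous_imp_integrable_real continuous_intros\<close>)
      also have "\<dots> = 2 * pi * (B * norm (c n))"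
        by (simp add: measure_restrict_space)
      finally show "norm (\<integral>t. norm (G t * (c n * u n t)) \<partial>circle_measure) \<le> 2 * pi * (B * norm (c n))"
        by simp
    qed
  qed
  also have "(\<lambda>t. \<Sum>n. G t * (c n * u n t)) = (\<lambda>t. G t * (\<Sum>n. c n * u n t))"
    by (intro ext suminf_mult) (rule summable_norm_cancel[OF su])
  finally show ?thesis .
qed

text \<open>This is the \<open>k\<close>-th Fourier coefficient of the squared modulus on the circle
  of radius \<open>r\<close>. All \<open>k\<close> are needed: \<open>k = 0\<close> gives the norm,
  and the others give orthogonality to the monomial multiples.\<close>

lemma Parseval_shifted:
  fixes a :: "nat \<Rightarrow> complex"
  assumes r: "0 \<le> r" and s: "summable (\<lambda>n. norm (a n * of_real r ^ n))"
    and F_def: "\<And>t. F t = (\<Sum>n. a n * (of_real r * cis t) ^ n)"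
    and F: "continuous_on {0..2*pi} F"
  shows "(\<lambda>n. of_real (2 * pi) * (cnj (a n) * a (n + k) * of_real r ^ (2 * n + k))) sums
     integral\<^sup>L circle_measure (\<lambda>t. F t * cnj (F t) * cis (- (real k * t)))"
proof -
  have Feq: "F t = (\<Sum>n. (a n * of_real r ^ n) * cis (real n * t))" for t
    unfolding F_def by (simp add: power_mult_distrib Complex.DeMoivre mult.assoc)
  have sF: "summable (\<lambda>n. (a n * of_real r ^ n) * cis (real n * t))" for t
    by (rule summable_norm_cancel) (use s in \<open>simp add: norm_mult\<close>)
  have coef: "integral\<^sup>L circle_measure (\<lambda>t. cis (- (real m * t)) * F t) = of_real (2 * pi) * (a m * of_real r ^ m)" for m
  proof -
    have "(\<lambda>n. integral\<^sup>L circle_measure (\<lambda>t. cis (- (real m * t)) * ((a n * of_real r ^ n) * cis (real n * t)))) sums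
        integral\<^sup>L circle_measure (\<lambda>t. cis (- (real m * t)) * F t)"
      unfolding Feq by (rule integral_uniform_series[OF _ s]) (auto intro!: continuous_intros)
    moreover have "integral\<^sup>L circle_measure (\<lambda>t. cis (- (real m * t)) * ((a n * of_real r ^ n) * cis (real n * t)))
        = (if n = m then of_real (2 * pi) * (a m * of_real r ^ m) else 0)" for n
    proof -
      have e: "cis (- (real m * t)) * ((a n * of_real r ^ n) * cis (real n * t))
          = (a n * of_real r ^ n) * cis (of_int (int n - int m) * t)" for t
        using cis_mult[of "- (real m * t)" "real n * t"] by (simp add: algebra_simps)
      show ?thesis unfolding e using integral_cis[of "int n - int m"] by simp
    qed
    ultimately have "(\<lambda>n. if n = m then of_real (2 * pi) * (a m * of_real r ^ m) else 0) sums
        integral\<^sup>L circle_measure (\<lambda>t. cis (- (real m * t)) * F t)" by simp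
    then show ?thesis using sums_unique2[OF _ sums_single[of m "\<lambda>_. of_real (2 * pi) * (a m * of_real r ^ m)"]] by auto
  qed
  have cF: "cnj (F t) = (\<Sum>n. (cnj (a n) * of_real r ^ n) * cis (- (real n * t)))" for t
    unfolding Feq using bounded_linear.suminf[OF bounded_linear_cnj sF[of t]]
    by (simp add: cis_cnj)
  \<comment> \<open>Only the conjugate is expanded now; the remaining factor \<open>F t\<close> is
    integrated by \<open>coef\<close>, so no double series arises.\<close>
  have A: "(\<lambda>n. integral\<^sup>L circle_measure (\<lambda>t. (F t * cis (- (real k * t))) * ((cnj (a n) * of_real r ^ n) * cis (- (real n * t))))) sums
     integral\<^sup>L circle_measure (\<lambda>t. (F t * cis (- (real k * t))) * cnj (F t))"
    unfolding cF
    by (rule integral_uniform_series) (use s in \<open>auto intro!: continuous_intros F simp: norm_mult\<close>)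
  have "integral\<^sup>L circle_measure (\<lambda>t. (F t * cis (- (real k * t))) * ((cnj (a n) * of_real r ^ n) * cis (- (real n * t))))
      = of_real (2 * pi) * (cnj (a n) * a (n + k) * of_real r ^ (2 * n + k))" for n
  proof -
    have e: "(F t * cis (- (real k * t))) * ((cnj (a n) * of_real r ^ n) * cis (- (real n * t)))
        = (cnj (a n) * of_real r ^ n) * (cis (- (real (n + k) * t)) * F t)" for t
      using cis_mult[of "- (real k * t)" "- (real n * t)"] by (simp add: algebra_simps)
    show ?thesis
    proof -
      have "integral\<^sup>L circle_measure (\<lambda>t. (F t * cis (- (real k * t))) * ((cnj (a n) * of_real r ^ n) * cis (- (real n * t))))
          = integral\<^sup>L circle_measure (\<lambda>t. (cnj (a n) * of_real r ^ n) * (cis (- (real (n + k) * t)) * F t))"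
        by (rule arg_cong[where f = "integral\<^sup>L circle_measure"]) (rule ext, rule e)
      also have "\<dots> = (cnj (a n) * of_real r ^ n) * integral\<^sup>L circle_measure (\<lambda>t. cis (- (real (n + k) * t)) * F t)"
        by (rule integral_mult_right_zero)
      also have "\<dots> = (cnj (a n) * of_real r ^ n) * (of_real (2 * pi) * (a (n + k) * of_real r ^ (n + k)))"
        unfolding coef ..
      also have "\<dots> = of_real (2 * pi) * (cnj (a n) * a (n + k) * of_real r ^ (2 * n + k))"
      proof -
        have "2 * n + k = n + (n + k)" by simp
        then have "(of_real r :: complex) ^ (2 * n + k) = of_real r ^ n * of_real r ^ (n + k)"
          by (simp only: power_add)
        then show ?thesis by (simp only: mult_ac)
      qed
      finally show ?thesis .
    qed
  qed
  note B = this
  from A have "(\<lambda>n. of_real (2 * pi) * (cnj (a n) * a (n + k) * of_real r ^ (2 * n + k))) sums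
     integral\<^sup>L circle_measure (\<lambda>t. (F t * cis (- (real k * t))) * cnj (F t))"
    by (simp only: B)
  moreover have "(F t * cis (- (real k * t))) * cnj (F t) = F t * cnj (F t) * cis (- (real k * t))" for t
    by (rule mult.assoc[THEN trans]) (simp only: mult.commute[of "cis _"] mult.assoc)
  ultimately show ?thesis by (simp only:)
qed

text \<open>On circles approaching the boundary the squared modulus tends boundedly to 1 almost
  everywhere, so its Fourier coefficients tend to those of the constant 1. By
  \<open>Parseval_shifted\<close> they also tend to the inner products of the coefficient sequence
  with its backward shifts.\<close>

lemma inner_function_coeffs:
  assumes "inner_function \<phi>"
  shows "\<exists>\<alpha>. inner_seq \<alpha> \<and> (\<forall>z. norm z < 1 \<longrightarrow> \<phi> z = ev (chr1 z) \<alpha>)"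
proof -
  have hol: "\<phi> holomorphic_on ball 0 1" and bdd: "bounded (\<phi> ` ball 0 1)"
    and ae: "AE t in circle_measure. \<exists>l. norm l = 1 \<and> ((\<lambda>r. \<phi> (of_real r * cis t)) \<longlongrightarrow> l) (at_left 1)"
    using assms by (auto simp: inner_function_def)
  obtain B where "\<forall>w\<in>\<phi> ` ball 0 1. norm w \<le> B"
    using bdd unfolding bounded_iff by blast
  then have B: "norm (\<phi> z) \<le> B" if "norm z < 1" for z using that by simp
  define a where "a n = (deriv ^^ n) \<phi> 0 / fact n" for n
  have sums: "(\<lambda>n. a n * z ^ n) sums \<phi> z" if "norm z < 1" for z
    using holomorphic_power_series[OF hol, of z] that by (simp add: a_def)
  \<comment> \<open>The offset by 2 makes every radius positive, already for
    \<open>j = 0\<close>.\<close>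
  define \<rho> where "\<rho> j = 1 - inverse (real (Suc (Suc j)))" for j
  have rho: "0 < \<rho> j" "\<rho> j < 1" for j by (auto simp: \<rho>_def inverse_less_1_iff)
  have rho_lim: "\<rho> \<longlonglongrightarrow> 1"
    unfolding \<rho>_def using tendsto_diff[OF tendsto_const[of "1::real"] LIMSEQ_Suc[OF LIMSEQ_inverse_real_of_nat]] by simp
  have rho_left: "filterlim \<rho> (at_left 1) sequentially"
    using rho rho_lim by (auto simp: filterlim_at less_imp_neq)
  have summ: "summable (\<lambda>n. norm (a n * of_real (\<rho> j) ^ n))" for j
  proof -
    obtain q where q: "\<rho> j < q" "q < 1" using dense[OF rho(2)] by blast
    then have "0 < q" using rho(1)[of j] by linarith
    have "summable (\<lambda>n. a n * of_real q ^ n)"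
      using sums[of "of_real q"] q \<open>0 < q\<close> by (intro sums_summable) auto
    then show ?thesis
      by (rule powser_insidea) (use q \<open>0 < q\<close> rho(1)[of j] in auto)
  qed
  define F where "F j t = \<phi> (of_real (\<rho> j) * cis t)" for j t
  have nr: "norm (of_real (\<rho> j) * cis t) < 1" for j t
    using rho[of j] by (simp add: norm_mult)
  have Feq: "F j t = (\<Sum>n. a n * (of_real (\<rho> j) * cis t) ^ n)" for j t
    unfolding F_def using sums_unique[OF sums[OF nr]] by auto
  have Fcont: "continuous_on {0..2*pi} (F j)" for j
    unfolding F_def
    by (rule continuous_on_compose2[OF holomorphic_on_imp_continuous_on[OF hol]])
      (use nr in \<open>auto intro!: continuous_intros\<close>)
  have FB: "norm (F j t) \<le> B" for j t unfolding F_def by (rule B[OF nr])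
  have B0: "0 \<le> B" using FB[of 0 0] norm_ge_zero order_trans by blast
  define I where "I j k = (\<Sum>n. cnj (a n) * a (n + k) * of_real (\<rho> j) ^ (2 * n + k))" for j k
  have Isums: "(\<lambda>n. cnj (a n) * a (n + k) * of_real (\<rho> j) ^ (2 * n + k)) sums I j k"
    and Ieq: "of_real (2 * pi) * I j k = integral\<^sup>L circle_measure (\<lambda>t. F j t * cnj (F j t) * cis (- (real k * t)))"
    for j k
  proof -
    note P = Parseval_shifted[OF less_imp_le[OF rho(1)[of j]] summ Feq Fcont, of k]
    have "(\<lambda>n. cnj (a n) * a (n + k) * of_real (\<rho> j) ^ (2 * n + k)) sums
        (integral\<^sup>L circle_measure (\<lambda>t. F j t * cnj (F j t) * cis (- (real k * t))) / of_real (2 * pi))"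
      using sums_divide[OF P, of "of_real (2 * pi)"] by simp
    moreover from this have "I j k = integral\<^sup>L circle_measure (\<lambda>t. F j t * cnj (F j t) * cis (- (real k * t))) / of_real (2 * pi)"
      unfolding I_def by (rule sums_unique[symmetric])
    ultimately show "(\<lambda>n. cnj (a n) * a (n + k) * of_real (\<rho> j) ^ (2 * n + k)) sums I j k"
      "of_real (2 * pi) * I j k = integral\<^sup>L circle_measure (\<lambda>t. F j t * cnj (F j t) * cis (- (real k * t)))"
      by simp_all
  qed
  \<comment> \<open>Dominated convergence with majorant \<open>B * B\<close>; the unimodular radial
    limits leave the bare exponential.\<close>
  have Ilim: "(\<lambda>j. I j k) \<longlonglongrightarrow> (if k = 0 then 1 else 0)" for k
  proof -
    have "(\<lambda>j. integral\<^sup>L circle_measure (\<lambda>t. F j t * cnj (F j t) * cis (- (real k * t))))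
        \<longlonglongrightarrow> integral\<^sup>L circle_measure (\<lambda>t. cis (of_int (- int k) * t))"
    proof (rule integral_dominated_convergence)
      show "(\<lambda>t. cis (of_int (- int k) * t)) \<in> borel_measurable circle_measure"
        "(\<lambda>t. F j t * cnj (F j t) * cis (- (real k * t))) \<in> borel_measurable circle_measure" for j
        by (intro continuous_imp_measurable_on_sets_lebesgue continuous_intros Fcont; simp)+
      show "integrable circle_measure (\<lambda>t. B * B)"
        by (intro continuous_imp_integrable_real continuous_intros)
      show "AE t in circle_measure. norm (F j t * cnj (F j t) * cis (- (real k * t))) \<le> B * B" for j
        using FB B0 by (intro AE_I2) (simp add: norm_mult mult_mono)
      show "AE t in circle_measure. (\<lambda>j. F j t * cnj (F j t) * cis (- (real k * t))) \<longlonglongrightarrow> cis (of_int (- int k) * t)"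
        using ae
      proof eventually_elim
        case (elim t)
        then obtain l where l: "norm l = 1" "((\<lambda>r. \<phi> (of_real r * cis t)) \<longlongrightarrow> l) (at_left 1)" by blast
        have "(\<lambda>j. F j t) \<longlonglongrightarrow> l"
          unfolding F_def by (rule filterlim_compose[OF l(2) rho_left])
        then have "(\<lambda>j. F j t * cnj (F j t) * cis (- (real k * t))) \<longlonglongrightarrow> l * cnj l * cis (- (real k * t))"
          by (intro tendsto_intros)
        moreover have "l * cnj l = 1" using l(1) by (simp add: complex_norm_square[symmetric])
        ultimately show ?case by simp
      qed
    qed
    then have "(\<lambda>j. of_real (2 * pi) * I j k / of_real (2 * pi)) \<longlonglongrightarrow> (if k = 0 then of_real (2 * pi) else 0) / of_real (2 * pi)"
      unfolding Ieq integral_cis by (intro tendsto_divide) auto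
    then show ?thesis by (cases "k = 0") simp_all
  qed
  \<comment> \<open>Square-summability has to come before \<open>main\<close>, which draws its
    majorant from it: partial sums at radius \<open>\<rho> j\<close> stay below
    \<open>I j 0\<close>, which tends to 1.\<close>
  have part: "(\<Sum>n<N. (norm (a n))\<^sup>2) \<le> 1" for N
  proof (rule LIMSEQ_le)
    show "(\<lambda>j. \<Sum>n<N. (norm (a n))\<^sup>2 * (\<rho> j) ^ (2 * n)) \<longlonglongrightarrow> (\<Sum>n<N. (norm (a n))\<^sup>2)"
    proof -
      have "(\<lambda>j. \<Sum>n<N. (norm (a n))\<^sup>2 * (\<rho> j) ^ (2 * n)) \<longlonglongrightarrow> (\<Sum>n<N. (norm (a n))\<^sup>2 * 1 ^ (2 * n))"
        by (intro tendsto_intros rho_lim)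
      then show ?thesis by simp
    qed
    show "(\<lambda>j. Re (I j 0)) \<longlonglongrightarrow> 1"
      using tendsto_Re[OF Ilim[of 0]] by simp
    show "\<exists>M. \<forall>j\<ge>M. (\<Sum>n<N. (norm (a n))\<^sup>2 * (\<rho> j) ^ (2 * n)) \<le> Re (I j 0)"
    proof (intro exI allI impI)
      fix j
      have "(\<lambda>n. of_real ((norm (a n))\<^sup>2 * (\<rho> j) ^ (2 * n)) :: complex) sums I j 0"
        using Isums[of 0 j] by (simp add: complex_norm_square mult_ac del: of_real_power) (simp add: of_real_power)
      then have s: "(\<lambda>n. (norm (a n))\<^sup>2 * (\<rho> j) ^ (2 * n)) sums Re (I j 0)"
        using sums_Re by fastforce
      show "(\<Sum>n<N. (norm (a n))\<^sup>2 * (\<rho> j) ^ (2 * n)) \<le> Re (I j 0)"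
        using sum_le_suminf[OF sums_summable[OF s], of "{..<N}"] rho(1)[of j] sums_unique[OF s] by simp
    qed
  qed
  have la: "l2 a"
    unfolding l2_def
  proof (subst summable_on_UNIV_nonneg_real_iff)
    show "summable (\<lambda>n. (norm (a n))\<^sup>2)"
      by (rule bounded_imp_summable[of _ 1]) (use part[of "Suc _"] in \<open>auto simp: lessThan_Suc_atMost\<close>)
  qed simp
  have main: "ip (bshift k a) a = (if k = 0 then 1 else 0)" for k
  proof -
    have hs: "((\<lambda>n. bshift k a n * cnj (a n)) has_sum ip (bshift k a) a) UNIV"
      by (intro ip_has_sum l2_bshift la)
    define M where "M n = norm (bshift k a n * cnj (a n))" for n
    have sM: "summable M" unfolding M_def
      by (rule summable_on_imp_summable, rule Cauchy_Schwarz_abs(1)) (intro l2_bshift la)+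
    \<comment> \<open>Tannery's theorem lets the radius tend to 1 under the sum; the majorant
      \<open>M\<close> is summable by Cauchy-Schwarz.\<close>
    have "(\<lambda>j. \<Sum>n. cnj (a n) * a (n + k) * of_real (\<rho> j) ^ (2 * n + k)) \<longlonglongrightarrow> (\<Sum>n. cnj (a n) * a (n + k) * 1 ^ (2 * n + k))"
    proof (rule tannerys_theorem[THEN conjunct2, THEN conjunct2])
      show "(\<lambda>j. cnj (a n) * a (n + k) * of_real (\<rho> j) ^ (2 * n + k)) \<longlonglongrightarrow> cnj (a n) * a (n + k) * 1 ^ (2 * n + k)" for n
        by (intro tendsto_intros) (use tendsto_of_real[OF rho_lim] in simp)
      have "norm (cnj (a n) * a (n + k) * of_real (\<rho> j) ^ (2 * n + k)) \<le> M n" for n j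
      proof -
        have "\<rho> j ^ (2 * n + k) \<le> 1" using rho[of j] by (intro power_le_one) auto
        then have "norm (cnj (a n)) * norm (a (n + k)) * \<rho> j ^ (2 * n + k) \<le> norm (cnj (a n)) * norm (a (n + k)) * 1"
          by (intro mult_left_mono) auto
        then show ?thesis
          using rho(1)[of j] by (simp add: M_def bshift_def norm_mult norm_power mult_ac add.commute)
      qed
      then show "\<forall>\<^sub>F (n, j) in at_top \<times>\<^sub>F sequentially. norm (cnj (a n) * a (n + k) * of_real (\<rho> j) ^ (2 * n + k)) \<le> M n"
        by (intro always_eventually) auto
    qed (use sM in auto)
    also have "(\<Sum>n. cnj (a n) * a (n + k) * 1 ^ (2 * n + k)) = (\<Sum>n. bshift k a n * cnj (a n))"
      by (simp add: bshift_def mult.commute add.commute)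
    also have "\<dots> = ip (bshift k a) a"
      using sums_unique[OF has_sum_imp_sums[OF hs]] by simp
    finally have L: "(\<lambda>j. I j k) \<longlonglongrightarrow> ip (bshift k a) a" unfolding I_def .
    show ?thesis by (rule LIMSEQ_unique[OF L Ilim])
  qed
  \<comment> \<open>The common part of the two shifts cancels, and conjugation handles the opposite
    order, so \<open>main\<close> decides all cases.\<close>
  have "ip (shift j a) (shift k a) = (if j = k then 1 else 0)" for j k
  proof -
    have 1: "ip (shift j a) (shift (j + d) a) = ip (bshift d a) a" for j d
      by (simp add: ip_shift_left ip_shift_right flip: shift_shift)
    show ?thesis
    proof (cases "j \<le> k")
      case True
      then show ?thesis using 1[of j "k - j"] by (simp add: main)
    next
      case False
      then have "ip (shift k a) (shift j a) = 0" using 1[of k "j - k"] by (simp add: main)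
      then show ?thesis using False ip_cnj[of "shift k a" "shift j a"] by simp
    qed
  qed
  then have "inner_seq a" using la by (auto simp: inner_seq_def orthonormal_def l2_shift)
  moreover have "\<phi> z = ev (chr1 z) a" if "norm z < 1" for z
    using has_sum_imp_sums[OF ev_has_sum[OF character_chr1[OF that] la]] sums[OF that] sums_unique2
    by (auto simp: chr1_def)
  ultimately show ?thesis by blast
qed

section \<open>Finite Blaschke products\<close>

lemma blaschke_norm_identity:
  "(norm (1 - cnj a * z))\<^sup>2 - (norm (z - a))\<^sup>2 = (1 - (norm a)\<^sup>2) * (1 - (norm z)\<^sup>2)"
  by (simp add: cmod_power2) (simp add: power2_eq_square algebra_simps)

lemma blaschke_denom_nz: "norm a < 1 \<Longrightarrow> norm z < 1 \<Longrightarrow> 1 - cnj a * z \<noteq> 0"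
proof
  assume a: "norm a < 1" "norm z < 1" "1 - cnj a * z = 0"
  then have "norm (cnj a * z) = 1" by (metis eq_iff_diff_eq_0 norm_one)
  moreover have "norm (cnj a * z) < 1 * 1"
    using a unfolding norm_mult by (intro mult_strict_mono') auto
  ultimately show False by simp
qed

lemma blaschke_norm_less:
  assumes "norm a < 1" "norm z < 1"
  shows "norm ((z - a) / (1 - cnj a * z)) < 1"
proof -
  have "0 < (1 - (norm a)\<^sup>2) * (1 - (norm z)\<^sup>2)"
    using assms by (simp add: abs_square_less_1)
  then have "(norm (z - a))\<^sup>2 < (norm (1 - cnj a * z))\<^sup>2"
    using blaschke_norm_identity[of a z] by linarith
  then have "norm (z - a) < norm (1 - cnj a * z)" by (rule power_less_imp_less_base) simp
  then show ?thesis using blaschke_denom_nz[OF assms] by (simp add: norm_divide)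
qed

text \<open>The denominator is at least \<open>1 - norm a\<close>. The bound makes the convergence
  of the modulus to 1 at the circle explicit, so that \<open>divide_out_zero\<close> can name a
  radius.\<close>

lemma blaschke_norm_lower:
  assumes "norm a < 1" "norm z < 1"
  shows "1 - (1 - (norm z)\<^sup>2) / (1 - norm a)\<^sup>2 \<le> (norm ((z - a) / (1 - cnj a * z)))\<^sup>2"
proof -
  have "norm (cnj a * z) \<le> norm a" using assms by (simp add: norm_mult mult_left_le)
  then have d: "1 - norm a \<le> norm (1 - cnj a * z)"
    using norm_triangle_ineq2[of 1 "cnj a * z"] by simp
  have d': "(1 - norm a)\<^sup>2 \<le> (norm (1 - cnj a * z))\<^sup>2" by (rule power_mono[OF d]) (use assms in simp)
  have dpos: "0 < (1 - norm a)\<^sup>2" using assms by simp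
  then have D: "0 < (norm (1 - cnj a * z))\<^sup>2" using d' by linarith
  have le: "(1 - (norm a)\<^sup>2) * (1 - (norm z)\<^sup>2) \<le> 1 - (norm z)\<^sup>2"
    using assms by (intro mult_left_le_one_le) (auto simp: power_le_one)
  have "(norm ((z - a) / (1 - cnj a * z)))\<^sup>2 = 1 - ((1 - (norm a)\<^sup>2) * (1 - (norm z)\<^sup>2)) / (norm (1 - cnj a * z))\<^sup>2"
    using D blaschke_norm_identity[of a z] by (simp add: norm_divide power_divide field_simps)
  moreover have "((1 - (norm a)\<^sup>2) * (1 - (norm z)\<^sup>2)) / (norm (1 - cnj a * z))\<^sup>2 \<le> (1 - (norm z)\<^sup>2) / (1 - norm a)\<^sup>2"
    by (rule frac_le) (use le d' dpos assms in \<open>auto simp: power_le_one\<close>)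
  ultimately show ?thesis by linarith
qed

text \<open>A bound on a thin annulus stands in for boundary values: the maximum modulus principle
  is applied on a closed disk that contains \<open>w\<close> and whose boundary circle lies in that
  annulus.\<close>

lemma disk_max_principle:
  assumes hol: "h holomorphic_on ball 0 1"
    and bd: "\<And>e. e > 0 \<Longrightarrow> \<exists>R<1. \<forall>z. R \<le> norm z \<and> norm z < 1 \<longrightarrow> norm (h z) \<le> 1 + e"
    and w: "norm w < 1"
  shows "norm (h w) \<le> 1"
proof (rule field_le_epsilon)
  fix e :: real assume "e > 0"
  then obtain R where R: "R < 1" "\<forall>z. R \<le> norm z \<and> norm z < 1 \<longrightarrow> norm (h z) \<le> 1 + e" using bd by blast
  define s where "s = max R ((1 + norm w) / 2)"
  have "norm w \<le> (1 + norm w) / 2" "0 < (1 + norm w) / 2"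
    using w by (simp_all add: add_pos_nonneg)
  then have s: "R \<le> s" "s < 1" "norm w \<le> s" "0 < s"
    using R(1) w unfolding s_def max_def by (auto split: if_splits)
  show "norm (h w) \<le> 1 + e"
  proof (rule maximum_modulus_frontier[where f = h and S = "cball 0 s"])
    show "h holomorphic_on interior (cball 0 s)"
      by (rule holomorphic_on_subset[OF hol]) (use s in auto)
    show "continuous_on (closure (cball 0 s)) h"
      by (rule continuous_on_subset[OF holomorphic_on_imp_continuous_on[OF hol]]) (use s in auto)
    show "norm (h z) \<le> 1 + e" if "z \<in> frontier (cball 0 s)" for z
      using that R(2) s by (auto simp: frontier_cball)
    show "w \<in> cball 0 s" using s by simp
  qed simp
qed

text \<open>In the absence of zeros the maximum principle applies to the reciprocal as well, so the
  modulus is 1 throughout and is attained as a maximum inside.\<close>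

lemma disk_unimodular_constant:
  assumes hol: "f holomorphic_on ball 0 1"
    and bd: "\<And>e. e > 0 \<Longrightarrow> \<exists>R<1. \<forall>z. R \<le> norm z \<and> norm z < 1 \<longrightarrow> 1 - e \<le> norm (f z)"
    and le: "\<And>z. norm z < 1 \<Longrightarrow> norm (f z) \<le> 1"
    and nz: "\<And>z. norm z < 1 \<Longrightarrow> f z \<noteq> 0"
  shows "\<exists>c. norm c = 1 \<and> (\<forall>z\<in>ball 0 1. f z = c)"
proof -
  have inv: "norm (inverse (f w)) \<le> 1" if "norm w < 1" for w
  proof (rule disk_max_principle[OF _ _ that])
    show "(\<lambda>z. inverse (f z)) holomorphic_on ball 0 1"
      by (intro holomorphic_on_inverse hol) (use nz in auto)
    fix e :: real assume e: "e > 0"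
    \<comment> \<open>Chosen so that inverting the lower bound \<open>1 - d\<close> gives exactly
      \<open>1 + e\<close>.\<close>
    define d where "d = e / (1 + e)"
    have d: "d > 0" "1 - d = inverse (1 + e)" using e by (auto simp: d_def field_simps)
    then obtain R where R: "R < 1" "\<forall>z. R \<le> norm z \<and> norm z < 1 \<longrightarrow> 1 - d \<le> norm (f z)" using bd by blast
    have "norm (inverse (f z)) \<le> 1 + e" if "R \<le> norm z" "norm z < 1" for z
    proof -
      have "inverse (1 + e) \<le> norm (f z)" using R(2) that d by auto
      then have "inverse (norm (f z)) \<le> inverse (inverse (1 + e))"
        by (rule le_imp_inverse_le) (use e in auto)
      then show ?thesis by (simp add: norm_inverse)
    qed
    then show "\<exists>R<1. \<forall>z. R \<le> norm z \<and> norm z < 1 \<longrightarrow> norm (inverse (f z)) \<le> 1 + e"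
      using R(1) by blast
  qed
  have one: "norm (f z) = 1" if "norm z < 1" for z
  proof -
    have "0 < norm (f z)" using nz[OF that] by simp
    moreover have "inverse (norm (f z)) \<le> 1" using inv[OF that] by (simp add: norm_inverse)
    ultimately have "1 \<le> norm (f z)" using inverse_le_1_iff[of "norm (f z)"] by linarith
    then show ?thesis using le[OF that] by simp
  qed
  have "f constant_on ball 0 1"
    by (rule maximum_modulus_principle[OF hol _ _ _ order_refl, of 0]) (auto simp: one)
  then obtain c where "\<forall>z\<in>ball 0 1. f z = c" by (auto simp: constant_on_def)
  moreover have "norm c = 1" using one[of 0] calculation by simp
  ultimately show ?thesis by blast
qed

text \<open>Near the circle the Blaschke factor has modulus close to 1, so dividing by it costs at
  most a factor \<open>1 + e\<close> there; the maximum principle then carries the bound 1 to the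
  whole disk.\<close>

lemma divide_out_zero:
  assumes hol: "f holomorphic_on ball 0 1"
    and bd: "\<And>e. e > 0 \<Longrightarrow> \<exists>R<1. \<forall>z. R \<le> norm z \<and> norm z < 1 \<longrightarrow> 1 - e \<le> norm (f z)"
    and le: "\<And>z. norm z < 1 \<Longrightarrow> norm (f z) \<le> 1"
    and a: "norm a < 1" "f a = 0"
  obtains g where "g holomorphic_on ball 0 1" "\<And>z. norm z < 1 \<Longrightarrow> norm (g z) \<le> 1"
    "\<And>z. norm z < 1 \<Longrightarrow> f z = (z - a) / (1 - cnj a * z) * g z"
proof -
  define h where "h z = (if z = a then deriv f a else (f z - f a) / (z - a))" for z
  define g where "g z = h z * (1 - cnj a * z)" for z
  have h: "h holomorphic_on ball 0 1" unfolding h_def by (rule pole_lemma_open[OF hol open_ball])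
  have g: "g holomorphic_on ball 0 1" unfolding g_def by (intro holomorphic_intros h)
  have eq: "f z = (z - a) / (1 - cnj a * z) * g z" if "norm z < 1" for z
    using blaschke_denom_nz[OF a(1) that] a(2) by (auto simp: g_def h_def)
  have "norm (g w) \<le> 1" if w: "norm w < 1" for w
  proof (rule disk_max_principle[OF g _ w])
    fix e :: real assume e: "e > 0"
    \<comment> \<open>If the squared modulus of the Blaschke factor is at least
      \<open>1 - d\<close>, its modulus is at least \<open>inverse (1 + e)\<close>. The radius
      \<open>R\<close> below achieves this, as 1 - |z|^2 is at most 2 (1 - |z|).\<close>
    define d where "d = 1 - (inverse (1 + e))\<^sup>2"
    have "inverse (1 + e) < 1" "0 < inverse (1 + e)" using e by (auto simp: inverse_less_1_iff)
    then have d: "0 < d" unfolding d_def by (simp add: abs_square_less_1)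
    define R where "R = max (1/2) (1 - d * (1 - norm a)\<^sup>2 / 2)"
    have R: "R < 1" using d a(1) by (auto simp: R_def)
    have "norm (g z) \<le> 1 + e" if z: "R \<le> norm z" "norm z < 1" for z
    proof -
      let ?b = "(z - a) / (1 - cnj a * z)"
      have "1 - (norm z)\<^sup>2 = (1 - norm z) * (1 + norm z)" by (simp add: power2_eq_square algebra_simps)
      also have "\<dots> \<le> (1 - norm z) * 2" using z by (intro mult_left_mono) auto
      also have "\<dots> \<le> d * (1 - norm a)\<^sup>2" using z(1) by (auto simp: R_def)
      finally have "(1 - (norm z)\<^sup>2) / (1 - norm a)\<^sup>2 \<le> d" using a(1) by (simp add: divide_le_eq)
      then have "(inverse (1 + e))\<^sup>2 \<le> (norm ?b)\<^sup>2"
        using blaschke_norm_lower[OF a(1) z(2)] unfolding d_def by linarith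
      then have b: "inverse (1 + e) \<le> norm ?b" by (rule power2_le_imp_le) simp
      have "inverse (1 + e) * norm (g z) \<le> norm ?b * norm (g z)" by (rule mult_right_mono[OF b]) simp
      also have "\<dots> = norm (f z)" by (simp only: eq[OF z(2)] norm_mult)
      also have "\<dots> \<le> 1" by (rule le[OF z(2)])
      finally show ?thesis using e by (simp add: field_simps)
    qed
    then show "\<exists>R<1. \<forall>z. R \<le> norm z \<and> norm z < 1 \<longrightarrow> norm (g z) \<le> 1 + e" using R by blast
  qed
  then show ?thesis using that g eq by blast
qed

text \<open>Zeros are divided out one at a time. At a fixed point \<open>z\<^sub>0\<close> each division enlarges the modulus
  by a factor at least \<open>1 / \<rho> > 1\<close>, whereas the maximum principle keeps it below \<open>1\<close>, so this stops.\<close>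

lemma finite_blaschke_productI:
  assumes "f holomorphic_on ball 0 1"
    and "\<And>e. e > 0 \<Longrightarrow> \<exists>R<1. \<forall>z. R \<le> norm z \<and> norm z < 1 \<longrightarrow> 1 - e \<le> norm (f z)"
    and "\<And>z. norm z < 1 \<Longrightarrow> norm (f z) \<le> 1"
  shows "finite_blaschke_product f"
proof -
  obtain R where R: "R < 1" "\<forall>z. R \<le> norm z \<and> norm z < 1 \<longrightarrow> 1 - 1/2 \<le> norm (f z)"
    using assms(2)[of "1/2"] by auto
  \<comment> \<open>Beyond radius \<open>R\<close> the modulus of \<open>f\<close> is at least 1/2,
    so all zeros lie in the disk of radius \<open>x\<close>, while \<open>z0\<close> on its boundary
    is not one.\<close>
  define x where "x = max 0 R"
  define z0 where "z0 = complex_of_real x"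
  have x: "0 \<le> x" "x < 1" "R \<le> x" using R by (auto simp: x_def)
  have z0: "norm z0 < 1" using x by (simp add: z0_def)
  have "1 - 1/2 \<le> norm (f z0)" by (rule R(2)[rule_format]) (use x in \<open>simp add: z0_def\<close>)
  then have fz0: "0 < norm (f z0)" by linarith
  \<comment> \<open>A maximum over the compact disk of possible zeros yields one constant
    \<open>\<rho>\<close> below 1 that bounds all their Blaschke factors at
    \<open>z0\<close>.\<close>
  have "continuous_on (cball 0 x) (\<lambda>a. norm ((z0 - a) / (1 - cnj a * z0)))"
    by (intro continuous_intros) (use blaschke_denom_nz z0 x in auto)
  then obtain a0 where a0: "a0 \<in> cball 0 x"
      "\<forall>a\<in>cball 0 x. norm ((z0 - a) / (1 - cnj a * z0)) \<le> norm ((z0 - a0) / (1 - cnj a0 * z0))"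
    using continuous_attains_sup[of "cball 0 x" "\<lambda>a. norm ((z0 - a) / (1 - cnj a * z0))"] x by auto
  define \<rho> where "\<rho> = norm ((z0 - a0) / (1 - cnj a0 * z0))"
  have rho: "\<rho> < 1" "0 \<le> \<rho>"
    unfolding \<rho>_def using blaschke_norm_less[of a0 z0] a0(1) z0 x by auto
  \<comment> \<open>\<open>N\<close> limits how many divisions are still possible; at
    \<open>N = 0\<close> the last hypothesis contradicts the bound by 1.\<close>
  have main: "finite_blaschke_product h"
    if "h holomorphic_on ball 0 1"
      "\<And>e. e > 0 \<Longrightarrow> \<exists>R<1. \<forall>z. R \<le> norm z \<and> norm z < 1 \<longrightarrow> 1 - e \<le> norm (h z)"
      "\<And>z. norm z < 1 \<Longrightarrow> norm (h z) \<le> 1"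
      "\<And>z. norm z < 1 \<Longrightarrow> h z = 0 \<Longrightarrow> norm z \<le> x"
      "\<rho> ^ N < norm (h z0)" for h N
    using that
  proof (induction N arbitrary: h)
    case 0
    then show ?case using "0.prems"(3)[OF z0] by simp
  next
    case (Suc N)
    show ?case
    proof (cases "\<exists>a. norm a < 1 \<and> h a = 0")
      case False
      then have "\<exists>c. norm c = 1 \<and> (\<forall>z\<in>ball 0 1. h z = c)"
        by (intro disk_unimodular_constant Suc.prems) auto
      then obtain c where c: "norm c = 1" "\<forall>z\<in>ball 0 1. h z = c" by blast
      then show ?thesis unfolding finite_blaschke_product_def by (intro exI[of _ c] exI[of _ "[]"]) simp
    next
      case True
      then obtain a where a: "norm a < 1" "h a = 0" by blast
      obtain g where g: "g holomorphic_on ball 0 1" "\<And>z. norm z < 1 \<Longrightarrow> norm (g z) \<le> 1"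
        "\<And>z. norm z < 1 \<Longrightarrow> h z = (z - a) / (1 - cnj a * z) * g z"
        using divide_out_zero[OF Suc.prems(1,2,3) a] by blast
      have hg: "norm (h z) \<le> norm (g z)" if "norm z < 1" for z
      proof -
        have "norm (h z) = norm ((z - a) / (1 - cnj a * z)) * norm (g z)"
          unfolding g(3)[OF that] norm_mult ..
        also have "\<dots> \<le> 1 * norm (g z)"
          by (rule mult_right_mono[OF less_imp_le[OF blaschke_norm_less[OF a(1) that]]]) simp
        finally show ?thesis by simp
      qed
      have "finite_blaschke_product g"
      proof (rule Suc.IH[OF g(1)])
        show "\<exists>R<1. \<forall>z. R \<le> norm z \<and> norm z < 1 \<longrightarrow> 1 - e \<le> norm (g z)" if "e > 0" for e
          using Suc.prems(2)[OF that] hg by (meson order_trans)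
        show "norm (g z) \<le> 1" if "norm z < 1" for z using g(2) that .
        show "norm z \<le> x" if "norm z < 1" "g z = 0" for z
          using Suc.prems(4)[OF that(1)] g(3)[OF that(1)] that(2) by simp
        have "a \<in> cball 0 x" using Suc.prems(4)[OF a] by simp
        then have "norm ((z0 - a) / (1 - cnj a * z0)) \<le> \<rho>" using a0(2) by (simp only: \<rho>_def)
        then have "norm (h z0) \<le> \<rho> * norm (g z0)"
          unfolding g(3)[OF z0] norm_mult by (rule mult_right_mono) simp
        then have "\<rho> * \<rho> ^ N < \<rho> * norm (g z0)" using Suc.prems(5) by simp
        then show "\<rho> ^ N < norm (g z0)" using rho(2) by (simp add: mult_less_cancel_left)
      qed
      then obtain c Bs where B: "norm c = 1" "\<forall>B\<in>set Bs. single_blaschke_factor B"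
        "\<forall>z\<in>ball 0 1. g z = c * (\<Prod>B\<leftarrow>Bs. B z)" unfolding finite_blaschke_product_def by blast
      define b where "b z = 1 * ((z - a) / (1 - cnj a * z))" for z
      have "single_blaschke_factor b"
        unfolding single_blaschke_factor_def b_def using a by (intro exI[of _ 1] exI[of _ a]) simp
      then show ?thesis unfolding finite_blaschke_product_def
        using B g(3) by (intro exI[of _ c] exI[of _ "b # Bs"]) (simp add: b_def)
    qed
  qed
  have zeros: "norm z \<le> x" if "norm z < 1" "f z = 0" for z
    using R(2)[rule_format, of z] that x(3) by (cases "R \<le> norm z") auto
  obtain N where "\<rho> ^ N < norm (f z0)" using real_arch_pow_inv[OF fz0 rho(1)] by blast
  then show ?thesis using main[OF assms(1-3) zeros] by blast
qed

section \<open>Compactness of one-variable model spaces\<close>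

lemma nrm_ker_seq_chr1:
  assumes z: "norm z < 1" shows "(nrm (ker_seq (chr1 z)))\<^sup>2 = 1 / (1 - (norm z)\<^sup>2)"
proof -
  have g: "norm ((norm z)\<^sup>2) < 1" using z by (simp add: abs_square_less_1)
  have "((\<lambda>n. (norm (ker_seq (chr1 z) n))\<^sup>2) has_sum (nrm (ker_seq (chr1 z)))\<^sup>2) UNIV"
    unfolding nrm_sq using l2_ker_seq[OF character_chr1[OF z]] by (simp add: l2_def)
  then have "(\<lambda>n. ((norm z)\<^sup>2) ^ n) sums (nrm (ker_seq (chr1 z)))\<^sup>2"
    by (auto dest!: has_sum_imp_sums simp: ker_seq_def chr1_def norm_power power_mult[symmetric] mult.commute)
  with geometric_sums[OF g] show ?thesis by (rule sums_unique2[symmetric])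
qed

text \<open>The projected Szego kernel is the reproducing kernel of the model space. By the
  eigenvector property, the part removed has norm |psi(z)| times that of the Szego kernel.\<close>

lemma nrm_model_kernel:
  assumes b: "inner_seq \<beta>" and z: "norm z < 1"
  shows "(nrm (proj \<beta> (ker_seq (chr1 z))))\<^sup>2 = (1 - (norm (ev (chr1 z) \<beta>))\<^sup>2) / (1 - (norm z)\<^sup>2)"
  using nrm_proj[OF b l2_ker_seq[OF character_chr1[OF z]]]
  by (simp add: adj_ker_seq[OF character_chr1[OF z]] nrm_cmult power_mult_distrib nrm_ker_seq_chr1[OF z] diff_divide_distrib)

text \<open>The squared norm of the model kernel cannot be negative, which bounds psi without any
  appeal to boundary values.\<close>

lemma norm_ev_inner_le:
  assumes b: "inner_seq \<beta>" and z: "norm z < 1"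
  shows "norm (ev (chr1 z) \<beta>) \<le> 1"
proof -
  have p: "0 < 1 - (norm z)\<^sup>2" using z by (simp add: abs_square_less_1)
  have "0 \<le> (1 - (norm (ev (chr1 z) \<beta>))\<^sup>2) / (1 - (norm z)\<^sup>2)"
    using nrm_model_kernel[OF assms] by (metis zero_le_power2)
  then have "(norm (ev (chr1 z) \<beta>))\<^sup>2 \<le> 1" using p by (simp add: zero_le_divide_iff)
  then show ?thesis by (simp add: abs_square_le_1)
qed

lemma mul_nat: "mul t g l = (\<Sum>k\<le>l. g k * t (l - k))" for l :: nat
proof -
  have "((\<lambda>k. g k * shift k t l) has_sum (\<Sum>k\<le>l. g k * t (l - k))) UNIV"
  proof (rule has_sum_finite_neutralI[of "{..l}"])
    show "(\<Sum>k\<le>l. g k * t (l - k)) = (\<Sum>k\<le>l. g k * shift k t l)"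
    proof (rule sum.cong[OF refl])
      fix k assume "k \<in> {..l}"
      then show "g k * t (l - k) = g k * shift k t l"
        using shift_add[of k t "l - k"] by simp
    qed
    show "g k * shift k t l = 0" if "k \<in> UNIV - {..l}" for k
      using that by (auto simp: shift_def image_iff)
  qed auto
  then show ?thesis unfolding mul_def synthesis_def by (rule infsumI)
qed

text \<open>The bound must not depend on \<open>z\<close>: the Szego kernel contributes at most 1,
  and the Cauchy product at most \<open>m + 1\<close> terms of modulus at most 1.\<close>

lemma norm_model_kernel_coeff:
  assumes b: "inner_seq \<beta>" and z: "norm z < 1"
  shows "norm (proj \<beta> (ker_seq (chr1 z)) m) \<le> real m + 2"
proof -
  let ?k = "ker_seq (chr1 z)"
  have k: "norm (?k n) \<le> 1" for n using z by (simp add: ker_seq_def chr1_def norm_power power_le_one)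
  have bn: "norm (\<beta> n) \<le> 1" for n
    using norm_le_nrm[OF inner_seq_l2[OF b], of n] inner_seq_nrm[OF b] by simp
  have "norm (mul \<beta> ?k m) \<le> (\<Sum>i\<le>m. 1 * 1)"
    unfolding mul_nat by (rule sum_norm_le) (auto simp: norm_mult intro!: mult_le_one k bn)
  then have "norm (ev (chr1 z) \<beta>) * norm (mul \<beta> ?k m) \<le> 1 * (real m + 1)"
    using norm_ev_inner_le[OF assms] by (intro mult_mono) auto
  moreover have "proj \<beta> ?k m = ?k m - cnj (ev (chr1 z) \<beta>) * mul \<beta> ?k m"
    by (simp add: proj_apply adj_ker_seq[OF character_chr1[OF z]] mul_cmult)
  ultimately show ?thesis
    using norm_triangle_ineq4[of "?k m" "cnj (ev (chr1 z) \<beta>) * mul \<beta> ?k m"] k[of m]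
    by (simp add: norm_mult)
qed

text \<open>If \<open>\<psi>\<close> stayed away from the circle along points \<open>w\<^sub>n\<close> tending to the boundary, the normalised
  reproducing kernels of the model space at \<open>w\<^sub>n\<close> would be unit vectors tending to zero weakly.\<close>

lemma compact_imp_boundary_modulus:
  assumes b: "inner_seq \<beta>" and comp: "compact_seq (modsp \<beta>) (\<lambda>f. f)" and e: "e > 0"
  shows "\<exists>R<1. \<forall>z. R \<le> norm z \<and> norm z < 1 \<longrightarrow> 1 - e \<le> norm (ev (chr1 z) \<beta>)"
proof (rule ccontr)
  assume neg: "\<not> ?thesis"
  define \<rho> where "\<rho> n = 1 - inverse (real (Suc n))" for n
  have "\<exists>z. \<rho> n \<le> norm z \<and> norm z < 1 \<and> norm (ev (chr1 z) \<beta>) < 1 - e" for n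
  proof -
    have "\<rho> n < 1" by (simp add: \<rho>_def)
    then show ?thesis using neg by (meson not_le)
  qed
  then obtain w where w: "\<And>n. \<rho> n \<le> norm (w n)" "\<And>n. norm (w n) < 1" "\<And>n. norm (ev (chr1 (w n)) \<beta>) < 1 - e"
    by metis
  define K where "K n = proj \<beta> (ker_seq (chr1 (w n)))" for n
  define f where "f n k = of_real (inverse (nrm (K n))) * K n k" for n k
  have K: "K n \<in> modsp \<beta>" for n
    unfolding K_def by (intro proj_in_modsp b l2_ker_seq character_chr1 w)
  have pos: "0 < 1 - (norm (w n))\<^sup>2" for n using w(2)[of n] by (simp add: abs_square_less_1)
  \<comment> \<open>As |psi| stays below \<open>1 - e\<close> at these points, the norms of the
    kernels blow up at the circle.\<close>
  have Kn: "e / (1 - (norm (w n))\<^sup>2) \<le> (nrm (K n))\<^sup>2" for n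
  proof -
    have "(norm (ev (chr1 (w n)) \<beta>))\<^sup>2 \<le> norm (ev (chr1 (w n)) \<beta>)"
      using norm_ev_inner_le[OF b w(2)[of n]] by (simp add: power2_eq_square mult_left_le)
    then show ?thesis
      unfolding K_def nrm_model_kernel[OF b w(2)] using w(3)[of n] pos[of n]
      by (intro divide_right_mono) auto
  qed
  have Kpos: "0 < nrm (K n)" for n
  proof -
    have "0 < e / (1 - (norm (w n))\<^sup>2)" using e pos by simp
    then have "0 < (nrm (K n))\<^sup>2" using Kn[of n] by linarith
    then show ?thesis using nrm_nonneg[of "K n"] by (simp add: less_le)
  qed
  have f: "f n \<in> modsp \<beta>" "nrm (f n) = 1" for n
  proof -
    have "f n = (\<lambda>k. of_real (inverse (nrm (K n))) * K n k)" by (simp add: f_def fun_eq_iff)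
    then show "f n \<in> modsp \<beta>" "nrm (f n) = 1"
      using modspD[OF K[of n]] Kpos[of n] by (auto simp: modsp_def adj_cmult l2_cmult nrm_cmult norm_inverse)
  qed
  have "range f \<subseteq> modsp \<beta> \<and> (\<exists>B. \<forall>n. nrm (f n) \<le> B)" using f by (auto intro!: exI[of _ 1])
  from comp[unfolded compact_seq_def, rule_format, OF this]
  obtain r g where r: "strict_mono r" and g: "g \<in> modsp \<beta>"
    and lim: "(\<lambda>n. nrm (\<lambda>k. f (r n) k - g k)) \<longlonglongrightarrow> 0" by blast
  \<comment> \<open>For fixed \<open>m\<close> the coefficients of the kernels are bounded, so
    normalising by norms that blow up sends them to 0.\<close>
  have coeff: "(\<lambda>n. f n m) \<longlonglongrightarrow> 0" for m
  proof (rule Lim_null_comparison)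
    have inv: "inverse (nrm (K n)) \<le> sqrt (2 * inverse (real (Suc n)) / e)" for n
    proof -
      have "1 - (norm (w n))\<^sup>2 = (1 - norm (w n)) * (1 + norm (w n))" by (simp add: power2_eq_square algebra_simps)
      also have "\<dots> \<le> inverse (real (Suc n)) * 2"
        using w(1,2)[of n] by (intro mult_mono) (auto simp: \<rho>_def)
      finally have "(1 - (norm (w n))\<^sup>2) / e \<le> 2 * inverse (real (Suc n)) / e"
        using e by (simp add: divide_right_mono mult.commute)
      moreover have "inverse ((nrm (K n))\<^sup>2) \<le> inverse (e / (1 - (norm (w n))\<^sup>2))"
        by (rule le_imp_inverse_le[OF Kn]) (use e pos in simp)
      ultimately have "(inverse (nrm (K n)))\<^sup>2 \<le> 2 * inverse (real (Suc n)) / e"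
        by (simp add: power_inverse)
      then show ?thesis by (rule real_le_rsqrt)
    qed
    show "\<forall>\<^sub>F n in sequentially. norm (f n m) \<le> sqrt (2 * inverse (real (Suc n)) / e) * (real m + 2)"
    proof (intro always_eventually allI)
      fix n
      have "norm (f n m) = inverse (nrm (K n)) * norm (K n m)"
        by (simp add: f_def norm_mult norm_inverse)
      also have "\<dots> \<le> sqrt (2 * inverse (real (Suc n)) / e) * (real m + 2)"
        using inv[of n] norm_model_kernel_coeff[OF b w(2), of n m] e by (intro mult_mono) (auto simp: K_def)
      finally show "norm (f n m) \<le> sqrt (2 * inverse (real (Suc n)) / e) * (real m + 2)" .
    qed
    have "(\<lambda>n. sqrt (2 * inverse (real (Suc n)) / e) * (real m + 2)) \<longlonglongrightarrow> sqrt (2 * 0 / e) * (real m + 2)"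
      by (intro tendsto_intros LIMSEQ_inverse_real_of_nat) (use e in auto)
    then show "(\<lambda>n. sqrt (2 * inverse (real (Suc n)) / e) * (real m + 2)) \<longlonglongrightarrow> 0" by simp
  qed
  \<comment> \<open>Norm convergence implies coefficientwise convergence, so the limit is 0 although
    every \<open>f (r n)\<close> has norm 1.\<close>
  have "g m = 0" for m
  proof -
    have "(\<lambda>n. f (r n) m - g m) \<longlonglongrightarrow> 0"
      by (rule Lim_null_comparison[OF _ lim])
        (use norm_le_nrm[OF l2_diff[OF modspD(1)[OF f(1)] modspD(1)[OF g]]] in \<open>auto intro!: always_eventually\<close>)
    moreover have "(\<lambda>n. f (r n) m - g m) \<longlonglongrightarrow> 0 - g m"
      using LIMSEQ_subseq_LIMSEQ[OF coeff[of m] r] by (intro tendsto_diff tendsto_const) (simp add: o_def)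
    ultimately show ?thesis using LIMSEQ_unique by fastforce
  qed
  then have "(\<lambda>n. nrm (f (r n))) \<longlonglongrightarrow> 0" using lim by simp
  then show False by (simp add: f(2) LIMSEQ_const_iff)
qed

text \<open>Moving \<open>bshift k\<close> across the inner product, this says that \<open>f\<close>
  is orthogonal to \<open>q\<close> times every monomial.\<close>

definition coeff_annihilates :: "complex poly \<Rightarrow> (nat \<Rightarrow> complex) \<Rightarrow> bool" where
  "coeff_annihilates q f \<longleftrightarrow> (\<forall>k. ip (bshift k f) (coeff q) = 0)"

text \<open>The adjoint of multiplication by the linear polynomial with root
  \<open>a\<close>.\<close>

definition bshift_minus :: "complex \<Rightarrow> (nat \<Rightarrow> complex) \<Rightarrow> nat \<Rightarrow> complex" where
  "bshift_minus a f = (\<lambda>k. bshift (Suc 0) f k - cnj a * f k)"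

lemma l2_coeff: "l2 (coeff p)"
  by (rule l2_finite_support) (metis MOST_coeff_eq_0 cofinite_eq_sequentially eventually_cofinite)

lemma ev_coeff: "ev (chr1 z) (coeff p) = poly p z"
proof -
  have "((\<lambda>k. coeff p k * chr1 z k) has_sum (\<Sum>k\<le>degree p. coeff p k * z ^ k)) UNIV"
    by (rule has_sum_finite_neutralI[of "{..degree p}"]) (auto simp: chr1_def coeff_eq_0)
  then show ?thesis unfolding ev_def poly_altdef by (rule infsumI)
qed

lemma l2_bshift_minus: "l2 f \<Longrightarrow> l2 (bshift_minus a f)"
  unfolding bshift_minus_def by (intro l2_diff l2_bshift l2_cmult)

lemma bshift_minus_diff:
  "bshift_minus a (\<lambda>k. f k - g k) = (\<lambda>k. bshift_minus a f k - bshift_minus a g k)"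
  by (simp add: bshift_minus_def bshift_def fun_eq_iff algebra_simps)

text \<open>The linear factor passes from the polynomial to the sequence by taking its adjoint,
  which lowers the degree by one.\<close>

lemma coeff_annihilates_linear:
  assumes f: "l2 f" and q: "coeff_annihilates ([:-a, 1:] * q) f"
  shows "coeff_annihilates q (bshift_minus a f)"
  unfolding coeff_annihilates_def
proof
  fix k
  have "coeff ([:-a, 1:] * q) = (\<lambda>n. shift (Suc 0) (coeff q) n - a * coeff q n)"
  proof
    fix n show "coeff ([:-a, 1:] * q) n = shift (Suc 0) (coeff q) n - a * coeff q n"
      using shift_add[of "Suc 0" "coeff q"]
      by (cases n) (auto simp: shift_def image_iff)
  qed
  then have "0 = ip (bshift k f) (\<lambda>n. shift (Suc 0) (coeff q) n - a * coeff q n)"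
    using q[unfolded coeff_annihilates_def, rule_format, of k] by (simp only:)
  also have "\<dots> = ip (bshift (Suc 0) (bshift k f)) (coeff q) - cnj a * ip (bshift k f) (coeff q)"
    by (simp add: ip_diff_right l2_bshift f l2_shift l2_coeff l2_cmult ip_shift_right ip_cmult_right)
  also have "\<dots> = ip (bshift k (bshift_minus a f)) (coeff q)"
  proof -
    have "bshift k (bshift_minus a f) = (\<lambda>n. bshift (Suc 0) (bshift k f) n - cnj a * bshift k f n)"
      by (simp add: bshift_minus_def bshift_def fun_eq_iff)
    then show ?thesis by (simp add: ip_diff_left l2_bshift f l2_cmult l2_coeff ip_cmult_left)
  qed
  finally show "ip (bshift k (bshift_minus a f)) (coeff q) = 0" ..
qed

text \<open>The norm of \<open>f\<close> is at most that of its zeroth coefficient plus that of its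
  backward shift, and the latter differs from \<open>bshift_minus a f\<close> by a multiple of
  \<open>f\<close> of size \<open>norm a\<close>, which is absorbed on the left. The estimate is
  useful when \<open>norm a < 1\<close>.\<close>

lemma nrm_le_bshift_minus:
  assumes f: "l2 f"
  shows "(1 - norm a) * nrm f \<le> norm (f 0) + nrm (bshift_minus a f)"
proof -
  have "shift (Suc 0) (bshift (Suc 0) f) n = f n - f 0 * unit_seq 0 n" for n
    by (cases n) (auto simp: shift_def bshift_def unit_seq_def image_iff)
  then have e: "f = (\<lambda>n. shift (Suc 0) (bshift (Suc 0) f) n + f 0 * unit_seq 0 n)" by auto
  have "nrm (\<lambda>n. shift (Suc 0) (bshift (Suc 0) f) n + f 0 * unit_seq 0 n)
      \<le> nrm (shift (Suc 0) (bshift (Suc 0) f)) + nrm (\<lambda>n::nat. f 0 * unit_seq 0 n)"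
    by (rule nrm_triangle[of "shift (Suc 0) (bshift (Suc 0) f)" "\<lambda>n::nat. f 0 * unit_seq 0 n"])
      (intro l2_shift l2_bshift f l2_cmult l2_unit)+
  then have "nrm f \<le> nrm (shift (Suc 0) (bshift (Suc 0) f)) + nrm (\<lambda>n::nat. f 0 * unit_seq 0 n)"
    using arg_cong[OF e, of nrm] by linarith
  then have 1: "nrm f \<le> nrm (bshift (Suc 0) f) + norm (f 0)" by (simp add: nrm_cmult)
  have "bshift (Suc 0) f = (\<lambda>n. bshift_minus a f n + cnj a * f n)" by (simp add: bshift_minus_def)
  then have "nrm (bshift (Suc 0) f) \<le> nrm (bshift_minus a f) + norm a * nrm f"
    using nrm_triangle[OF l2_bshift_minus[OF f] l2_cmult[OF f], of a "cnj a"] by (simp add: nrm_cmult)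
  with 1 show ?thesis by (simp add: algebra_simps)
qed

text \<open>By the estimate above, a sequence converges as soon as its zeroth coefficients and its images
  under \<^const>\<open>bshift_minus\<close> do, which removes one root at a time.\<close>

lemma annihilated_compact:
  fixes X :: "nat \<Rightarrow> nat \<Rightarrow> complex"
  assumes "\<And>n. l2 (X n)" "\<And>n. nrm (X n) \<le> B" "\<forall>a\<in>set as. norm a < 1"
    and "\<And>n. coeff_annihilates (\<Prod>a\<leftarrow>as. [:-a, 1:]) (X n)"
  shows "\<exists>r g. strict_mono r \<and> l2 g \<and> (\<lambda>n. nrm (\<lambda>k. X (r n) k - g k)) \<longlonglongrightarrow> 0"
  using assms
proof (induction as arbitrary: X B)
  case Nil
  \<comment> \<open>The empty product is 1, and orthogonality of all backward shifts to 1 means that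
    every coefficient vanishes.\<close>
  have "X n k = 0" for n k
  proof -
    have "coeff (1 :: complex poly) = unit_seq 0" by (auto simp: fun_eq_iff unit_seq_def coeff_1)
    moreover have "ip (bshift k (X n)) (coeff 1) = 0"
      using Nil(4)[of n] unfolding coeff_annihilates_def by simp
    ultimately show ?thesis by (simp add: bshift_def)
  qed
  then show ?case by (intro exI[of _ id] exI[of _ "\<lambda>k. 0"]) (simp add: strict_mono_def)
next
  case (Cons a as)
  let ?Y = "\<lambda>n. bshift_minus a (X n)"
  have lY: "l2 (?Y n)" for n by (intro l2_bshift_minus Cons.prems)
  have bY: "nrm (?Y n) \<le> B + norm a * B" for n
  proof -
    have "nrm (?Y n) \<le> nrm (bshift (Suc 0) (X n)) + nrm (\<lambda>k. cnj a * X n k)"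
      unfolding bshift_minus_def by (intro nrm_triangle_diff l2_bshift l2_cmult Cons.prems)
    also have "\<dots> \<le> B + norm a * B"
      using nrm_bshift_le[OF Cons.prems(1)[of n], of "Suc 0"] Cons.prems(2)[of n]
      by (intro add_mono) (auto simp: nrm_cmult intro: mult_left_mono)
    finally show ?thesis .
  qed
  have an: "coeff_annihilates (\<Prod>a\<leftarrow>as. [:-a, 1:]) (?Y n)" for n
    by (rule coeff_annihilates_linear[OF Cons.prems(1)]) (use Cons.prems(4)[of n] in simp)
  from Cons.IH[of ?Y "B + norm a * B", OF lY bY _ an] Cons.prems(3) obtain r1 h where r1: "strict_mono r1" and h: "l2 h"
    and lim: "(\<lambda>n. nrm (\<lambda>k. ?Y (r1 n) k - h k)) \<longlonglongrightarrow> 0" by auto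
  have "norm (X n 0) \<le> B" for n
    using norm_le_nrm[OF Cons.prems(1), of n 0] Cons.prems(2)[of n] by linarith
  then have "bounded (range (\<lambda>n. X (r1 n) 0))" by (auto simp: bounded_iff)
  \<comment> \<open>A second extraction makes the zeroth coefficients converge, the one datum in the
    estimate that \<open>bshift_minus\<close> does not supply.\<close>
  then obtain l r2 where r2: "strict_mono r2" and l: "((\<lambda>n. X (r1 n) 0) \<circ> r2) \<longlonglongrightarrow> l"
    using bounded_imp_convergent_subsequence by blast
  define r where "r = r1 \<circ> r2"
  have r: "strict_mono r" unfolding r_def using r1 r2 by (rule strict_mono_o)
  have lim': "(\<lambda>n. nrm (\<lambda>k. ?Y (r n) k - h k)) \<longlonglongrightarrow> 0"
    using LIMSEQ_subseq_LIMSEQ[OF lim r2] by (simp add: o_def r_def)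
  have l': "(\<lambda>n. norm (X (r n) 0 - l)) \<longlonglongrightarrow> 0"
    using tendsto_norm[OF LIM_zero[OF l]] by (simp add: o_def r_def)
  have a: "0 < 1 - norm a" using Cons.prems(3) by simp
  define d where "d n = (norm (X (r n) 0 - l) + nrm (\<lambda>k. ?Y (r n) k - h k)) / (1 - norm a)" for n
  have d: "d \<longlonglongrightarrow> 0"
    unfolding d_def using tendsto_divide[OF tendsto_add[OF l' lim'] tendsto_const[of "1 - norm a"]] a by simp
  have le: "nrm (\<lambda>k. X (r m) k - X (r n) k) \<le> d m + d n" for m n
  proof -
    have "(1 - norm a) * nrm (\<lambda>k. X (r m) k - X (r n) k)
        \<le> norm (X (r m) 0 - X (r n) 0) + nrm (\<lambda>k. ?Y (r m) k - ?Y (r n) k)"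
      using nrm_le_bshift_minus[OF l2_diff[OF Cons.prems(1) Cons.prems(1)], of a "r m" "r n"]
      by (simp add: bshift_minus_diff)
    also have "norm (X (r m) 0 - X (r n) 0) \<le> norm (X (r m) 0 - l) + norm (X (r n) 0 - l)"
      by (metis norm_minus_commute norm_triangle_sub dist_norm dist_triangle2)
    also have "nrm (\<lambda>k. ?Y (r m) k - ?Y (r n) k) \<le> nrm (\<lambda>k. ?Y (r m) k - h k) + nrm (\<lambda>k. ?Y (r n) k - h k)"
      using nrm_dist_triangle[OF lY[of "r m"] h lY[of "r n"]] nrm_commute[of h "?Y (r n)"] by simp
    finally have "nrm (\<lambda>k. X (r m) k - X (r n) k) \<le> ((norm (X (r m) 0 - l) + norm (X (r n) 0 - l)) +
        (nrm (\<lambda>k. ?Y (r m) k - h k) + nrm (\<lambda>k. ?Y (r n) k - h k))) / (1 - norm a)"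
      using a by (simp add: pos_le_divide_eq mult.commute)
    also have "\<dots> = d m + d n" by (simp add: d_def add_divide_distrib)
    finally show ?thesis .
  qed
  have "\<exists>g. l2 g \<and> (\<lambda>n. nrm (\<lambda>k. X (r n) k - g k)) \<longlonglongrightarrow> 0"
  proof (rule l2_complete)
    fix e :: real assume "e > 0"
    then obtain N where N: "\<forall>n\<ge>N. norm (d n - 0) < e / 2"
      using LIMSEQ_D[OF d, of "e/2"] by auto
    have "nrm (\<lambda>k. X (r m) k - X (r n) k) \<le> e" if "m \<ge> N" "n \<ge> N" for m n
      using le[of m n] N[rule_format, OF that(1)] N[rule_format, OF that(2)] by (simp add: abs_less_iff)
    then show "\<exists>N. \<forall>m\<ge>N. \<forall>n\<ge>N. nrm (\<lambda>k. X (r m) k - X (r n) k) \<le> e" by blast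
  qed (rule Cons.prems)
  then show ?case using r by blast
qed

text \<open>Denominators are cleared: the witness \<open>p\<close> is the product of the factors
  \<open>1 - cnj a * z\<close>, and \<open>C\<close> is the product of the unimodular
  constants.\<close>

lemma finite_blaschke_fraction:
  assumes "\<forall>B\<in>set Bs. single_blaschke_factor B"
  shows "\<exists>as p C. (\<forall>a\<in>set as. norm a < 1) \<and> C \<noteq> 0 \<and>
    (\<forall>z\<in>ball 0 1. (\<Prod>B\<leftarrow>Bs. B z) * poly p z = C * poly (\<Prod>a\<leftarrow>as. [:-a, 1:]) z)"
  using assms
proof (induction Bs)
  case Nil
  then show ?case by (intro exI[of _ "[]"] exI[of _ 1] exI[of _ 1]) simp
next
  case (Cons B Bs)
  then obtain as p C where IH: "\<forall>a\<in>set as. norm a < 1" "C \<noteq> 0"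
    "\<forall>z\<in>ball 0 1. (\<Prod>B\<leftarrow>Bs. B z) * poly p z = C * poly (\<Prod>a\<leftarrow>as. [:-a, 1:]) z"
    by auto
  obtain c a where B: "norm c = 1" "norm a < 1" "\<forall>z\<in>ball 0 1. B z = c * ((z - a) / (1 - cnj a * z))"
    using Cons.prems by (auto simp: single_blaschke_factor_def)
  have "(\<Prod>B\<leftarrow>B # Bs. B z) * poly ([:1, - cnj a:] * p) z = (c * C) * poly (\<Prod>a\<leftarrow>a # as. [:-a, 1:]) z"
    if z: "z \<in> ball 0 1" for z
  proof -
    have "(\<Prod>B\<leftarrow>B # Bs. B z) * poly ([:1, - cnj a:] * p) z
        = (B z * (1 - cnj a * z)) * ((\<Prod>B\<leftarrow>Bs. B z) * poly p z)"
      by (simp add: algebra_simps)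
    also have "B z * (1 - cnj a * z) = c * (z - a)"
      using B z blaschke_denom_nz[OF B(2), of z] by simp
    finally show ?thesis using IH(3) z by (simp add: algebra_simps)
  qed
  then show ?case using IH B
    by (intro exI[of _ "a # as"] exI[of _ "[:1, - cnj a:] * p"] exI[of _ "c * C"]) auto
qed

text \<open>For a finite Blaschke product with numerator q, psi times the denominator is a nonzero
  multiple of q. So q lies in psi H^2, the model space is annihilated by q, and
  \<open>annihilated_compact\<close> applies. Conversely, compactness forces |psi| to tend to 1 at
  the circle, as \<open>finite_blaschke_productI\<close> requires.\<close>

lemma finite_blaschke_iff_compact:
  assumes b: "inner_seq \<beta>" and psi: "\<And>z. norm z < 1 \<Longrightarrow> \<psi> z = ev (chr1 z) \<beta>"
    and hol: "\<psi> holomorphic_on ball 0 1"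
  shows "finite_blaschke_product \<psi> \<longleftrightarrow> compact_seq (modsp \<beta>) (\<lambda>f. f)"
proof
  assume comp: "compact_seq (modsp \<beta>) (\<lambda>f. f)"
  show "finite_blaschke_product \<psi>"
  proof (rule finite_blaschke_productI[OF hol])
    show "\<exists>R<1. \<forall>z. R \<le> norm z \<and> norm z < 1 \<longrightarrow> 1 - e \<le> norm (\<psi> z)" if "e > 0" for e
      using compact_imp_boundary_modulus[OF b comp that] psi by metis
    show "norm (\<psi> z) \<le> 1" if "norm z < 1" for z
      using norm_ev_inner_le[OF b that] psi[OF that] by simp
  qed
next
  assume "finite_blaschke_product \<psi>"
  then obtain c Bs where c: "norm c = 1" and Bs: "\<forall>B\<in>set Bs. single_blaschke_factor B"
    and eq: "\<forall>z\<in>ball 0 1. \<psi> z = c * (\<Prod>B\<leftarrow>Bs. B z)"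
    by (auto simp: finite_blaschke_product_def)
  obtain as p C where as: "\<forall>a\<in>set as. norm a < 1" "C \<noteq> 0"
    "\<forall>z\<in>ball 0 1. (\<Prod>B\<leftarrow>Bs. B z) * poly p z = C * poly (\<Prod>a\<leftarrow>as. [:-a, 1:]) z"
    using finite_blaschke_fraction[OF Bs] by blast
  define q where "q = (\<Prod>a\<leftarrow>as. [:-a, 1:])"
  have mq: "mul \<beta> (coeff p) = (\<lambda>n. (c * C) * coeff q n)"
  proof (rule ev_chr1_inj)
    show "l2 (mul \<beta> (coeff p))" by (intro l2_mul b l2_coeff)
    show "l2 (\<lambda>n. (c * C) * coeff q n)" by (intro l2_cmult l2_coeff)
    fix z :: complex assume z: "norm z < 1"
    have "ev (chr1 z) (mul \<beta> (coeff p)) = \<psi> z * poly p z"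
      by (simp add: ev_mul[OF character_chr1[OF z] b l2_coeff] ev_coeff psi[OF z])
    also have "\<dots> = c * C * poly q z" using eq as(3) z by (simp add: q_def)
    also have "\<dots> = ev (chr1 z) (\<lambda>n. (c * C) * coeff q n)"
      by (simp add: ev_ip ip_cmult_left flip: ev_coeff)
    finally show "ev (chr1 z) (mul \<beta> (coeff p)) = ev (chr1 z) (\<lambda>n. (c * C) * coeff q n)" .
  qed
  have ann: "coeff_annihilates q f" if f: "f \<in> modsp \<beta>" for f
    unfolding coeff_annihilates_def
  proof
    fix k
    note m = modspD[OF bshift_in_modsp[OF f, of k]]
    have "cnj (c * C) * ip (bshift k f) (coeff q) = ip (bshift k f) (mul \<beta> (coeff p))"
      unfolding mq by (simp only: ip_cmult_right)
    also have "\<dots> = 0" by (simp add: ip_mul_right b l2_coeff m)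
    finally show "ip (bshift k f) (coeff q) = 0" using as(2) c by auto
  qed
  show "compact_seq (modsp \<beta>) (\<lambda>f. f)"
    unfolding compact_seq_def
  proof (intro allI impI, elim conjE exE)
    fix X :: "nat \<Rightarrow> nat \<Rightarrow> complex" and B
    assume X: "range X \<subseteq> modsp \<beta>" and B: "\<forall>n. nrm (X n) \<le> B"
    have Xn: "X n \<in> modsp \<beta>" for n using X by auto
    have "\<exists>r g. strict_mono r \<and> l2 g \<and> (\<lambda>n. nrm (\<lambda>k. X (r n) k - g k)) \<longlonglongrightarrow> 0"
      by (rule annihilated_compact[of X B as])
        (use modspD(1)[OF Xn] B as(1) ann[OF Xn] in \<open>auto simp: q_def\<close>)
    then show "\<exists>r g. strict_mono r \<and> g \<in> modsp \<beta> \<and> (\<lambda>n. nrm (\<lambda>k. X (r n) k - g k)) \<longlonglongrightarrow> 0"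
      using modsp_closed[OF b Xn] by blast
  qed
qed

text \<open>Multiplied by z, the coefficient identity reads phi - phi(0) = c z (1 - cnj (phi 0)
  phi). Solving this for phi gives a Moebius map of the disk, and conversely.\<close>

lemma single_blaschke_iff_coeffs:
  assumes a: "inner_seq \<alpha>" and phi: "\<And>z. norm z < 1 \<Longrightarrow> \<phi> z = ev (chr1 z) \<alpha>"
    and a0: "norm (\<alpha> 0) < 1"
  shows "single_blaschke_factor \<phi> \<longleftrightarrow>
    (\<exists>c. norm c = 1 \<and> bshift (Suc 0) \<alpha> = (\<lambda>n. c * (unit_seq 0 n - cnj (\<alpha> 0) * \<alpha> n)))"
proof -
  note la = inner_seq_l2[OF a]
  define v where "v = (\<lambda>n. unit_seq 0 n - cnj (\<alpha> 0) * \<alpha> n)"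
  have lv: "l2 v" unfolding v_def by (intro l2_diff l2_unit l2_cmult la)
  have ev_unit: "ev (chr1 z) (unit_seq 0) = 1" if "norm z < 1" for z
    by (simp add: ev_ip ker_seq_def chr1_def)
  have ev_v: "ev (chr1 z) v = 1 - cnj (\<alpha> 0) * \<phi> z" if z: "norm z < 1" for z
    using l2_ker_seq[OF character_chr1[OF z]] ev_unit[OF z]
    by (simp add: v_def ev_ip ip_diff_left l2_cmult la ip_cmult_left phi[OF z] del: ip_unit_left)
  have sb: "shift (Suc 0) (bshift (Suc 0) \<alpha>) = (\<lambda>n. \<alpha> n - \<alpha> 0 * unit_seq 0 n)"
  proof
    show "shift (Suc 0) (bshift (Suc 0) \<alpha>) n = \<alpha> n - \<alpha> 0 * unit_seq 0 n" for n
      by (cases n) (auto simp: shift_def bshift_def unit_seq_def image_iff)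
  qed
  have ev_b: "z * ev (chr1 z) (bshift (Suc 0) \<alpha>) = \<phi> z - \<alpha> 0" if z: "norm z < 1" for z
  proof -
    have "z * ev (chr1 z) (bshift (Suc 0) \<alpha>) = ev (chr1 z) (shift (Suc 0) (bshift (Suc 0) \<alpha>))"
      by (simp add: ev_shift[OF character_chr1[OF z]]) (simp add: chr1_def)
    also have "\<dots> = \<phi> z - \<alpha> 0"
      unfolding sb using l2_ker_seq[OF character_chr1[OF z]] ev_unit[OF z]
      by (simp add: ev_ip ip_diff_left l2_cmult la ip_cmult_left phi[OF z] del: ip_unit_left)
    finally show ?thesis .
  qed
  have phi0: "\<phi> 0 = \<alpha> 0" using ev_b[of 0] by simp
  have iff: "bshift (Suc 0) \<alpha> = (\<lambda>n. c * v n) \<longleftrightarrow>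
      (\<forall>z. norm z < 1 \<longrightarrow> \<phi> z - \<alpha> 0 = c * z * (1 - cnj (\<alpha> 0) * \<phi> z))" for c
  proof
    assume eq: "bshift (Suc 0) \<alpha> = (\<lambda>n. c * v n)"
    show "\<forall>z. norm z < 1 \<longrightarrow> \<phi> z - \<alpha> 0 = c * z * (1 - cnj (\<alpha> 0) * \<phi> z)"
    proof (intro allI impI)
      fix z :: complex assume z: "norm z < 1"
      have "z * (c * (1 - cnj (\<alpha> 0) * \<phi> z)) = \<phi> z - \<alpha> 0"
        using ev_b[OF z] unfolding eq using ev_v[OF z] by (simp add: ev_ip ip_cmult_left)
      then show "\<phi> z - \<alpha> 0 = c * z * (1 - cnj (\<alpha> 0) * \<phi> z)" by (simp add: mult_ac)
    qed
  next
    assume eq: "\<forall>z. norm z < 1 \<longrightarrow> \<phi> z - \<alpha> 0 = c * z * (1 - cnj (\<alpha> 0) * \<phi> z)"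
    \<comment> \<open>The factor \<open>z\<close> is kept as a shift, because it cannot be divided
      out at the origin; \<open>bshift\<close> removes it afterwards.\<close>
    have "shift (Suc 0) (bshift (Suc 0) \<alpha>) = shift (Suc 0) (\<lambda>n. c * v n)"
    proof (rule ev_chr1_inj)
      show "l2 (shift (Suc 0) (bshift (Suc 0) \<alpha>))" "l2 (shift (Suc 0) (\<lambda>n. c * v n))"
        by (intro l2_shift l2_bshift l2_cmult la lv)+
      fix z :: complex assume z: "norm z < 1"
      have "ev (chr1 z) (\<lambda>n. c * v n) = c * ev (chr1 z) v" by (simp add: ev_ip ip_cmult_left)
      then show "ev (chr1 z) (shift (Suc 0) (bshift (Suc 0) \<alpha>)) = ev (chr1 z) (shift (Suc 0) (\<lambda>n. c * v n))"
        using ev_b[OF z] eq[rule_format, OF z] ev_v[OF z]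
        by (simp add: ev_shift[OF character_chr1[OF z]]) (simp add: chr1_def mult_ac)
    qed
    then have "bshift (Suc 0) (shift (Suc 0) (bshift (Suc 0) \<alpha>)) = bshift (Suc 0) (shift (Suc 0) (\<lambda>n. c * v n))"
      by simp
    then show "bshift (Suc 0) \<alpha> = (\<lambda>n. c * v n)" by (simp only: bshift_shift)
  qed
  have "single_blaschke_factor \<phi> \<longleftrightarrow>
      (\<exists>c. norm c = 1 \<and> (\<forall>z. norm z < 1 \<longrightarrow> \<phi> z - \<alpha> 0 = c * z * (1 - cnj (\<alpha> 0) * \<phi> z)))"
  proof
    assume "single_blaschke_factor \<phi>"
    then obtain c a where ca: "norm c = 1" "norm a < 1"
      and eq: "\<forall>z\<in>ball 0 1. \<phi> z = c * ((z - a) / (1 - cnj a * z))"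
      by (auto simp: single_blaschke_factor_def)
    have cc: "cnj c * c = 1" using ca(1) by (simp add: complex_norm_square[symmetric] mult.commute)
    have al0: "\<alpha> 0 = - c * a" using eq phi0 by simp
    have "\<phi> z - \<alpha> 0 = c * z * (1 - cnj (\<alpha> 0) * \<phi> z)" if z: "norm z < 1" for z
    proof -
      define D where "D = 1 - cnj a * z"
      have D: "D \<noteq> 0" unfolding D_def by (rule blaschke_denom_nz[OF ca(2) z])
      have f: "\<phi> z * D = c * (z - a)" using eq z D by (simp add: D_def)
      have "(\<phi> z - \<alpha> 0) * D = \<phi> z * D + c * a * D"
        by (simp add: al0 algebra_simps)
      also have "\<dots> = c * (z - a) + c * a * D" unfolding f ..
      also have "\<dots> = c * z * (1 - a * cnj a)" by (simp add: D_def algebra_simps)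
      also have "\<dots> = c * z * (D + (cnj c * c) * cnj a * (z - a))"
        unfolding cc by (simp add: D_def algebra_simps)
      also have "\<dots> = c * z * (D + cnj c * cnj a * (\<phi> z * D))"
        unfolding f by (simp add: algebra_simps)
      also have "\<dots> = c * z * (1 - cnj (\<alpha> 0) * \<phi> z) * D"
        by (simp add: al0 algebra_simps)
      finally show ?thesis using D by simp
    qed
    then show "\<exists>c. norm c = 1 \<and> (\<forall>z. norm z < 1 \<longrightarrow> \<phi> z - \<alpha> 0 = c * z * (1 - cnj (\<alpha> 0) * \<phi> z))"
      using ca(1) by blast
  next
    assume "\<exists>c. norm c = 1 \<and> (\<forall>z. norm z < 1 \<longrightarrow> \<phi> z - \<alpha> 0 = c * z * (1 - cnj (\<alpha> 0) * \<phi> z))"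
    then obtain c where c: "norm c = 1"
      and eq: "\<And>z. norm z < 1 \<Longrightarrow> \<phi> z - \<alpha> 0 = c * z * (1 - cnj (\<alpha> 0) * \<phi> z)" by blast
    have cc: "c * cnj c = 1" using c by (simp add: complex_norm_square[symmetric])
    \<comment> \<open>The zero of phi: collecting phi on one side of \<open>eq\<close> leaves
      \<open>c * z + \<alpha> 0\<close> on the other.\<close>
    define a where "a = - cnj c * \<alpha> 0"
    have na: "norm a < 1" using c a0 by (simp add: a_def norm_mult)
    have "\<phi> z = c * ((z - a) / (1 - cnj a * z))" if z: "norm z < 1" for z
    proof -
      define D where "D = 1 - cnj a * z"
      have D: "D \<noteq> 0" unfolding D_def by (rule blaschke_denom_nz[OF na z])
      have "\<phi> z * D = \<phi> z - \<alpha> 0 + c * z * cnj (\<alpha> 0) * \<phi> z + \<alpha> 0" by (simp add: D_def a_def algebra_simps)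
      also have "\<dots> = c * z + \<alpha> 0" unfolding eq[OF z] by (simp add: algebra_simps)
      also have "\<dots> = c * z + (c * cnj c) * \<alpha> 0" unfolding cc by simp
      also have "\<dots> = c * (z - a)" by (simp add: a_def algebra_simps)
      finally show ?thesis using D by (simp add: eq_divide_eq flip: D_def)
    qed
    then show "single_blaschke_factor \<phi>"
      unfolding single_blaschke_factor_def using c na by (intro exI[of _ c] exI[of _ a]) auto
  qed
  then show ?thesis unfolding iff[symmetric] by (simp add: v_def)
qed

text \<open>The coefficients have total norm 1, so a zeroth one of modulus at least 1 leaves nothing
  for the others.\<close>

lemma nonconstant_coeff_0:
  assumes a: "inner_seq \<alpha>" and phi: "\<And>z. norm z < 1 \<Longrightarrow> \<phi> z = ev (chr1 z) \<alpha>"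
    and nc: "\<not> \<phi> constant_on ball 0 1"
  shows "norm (\<alpha> 0) < 1"
proof (rule ccontr)
  assume "\<not> norm (\<alpha> 0) < 1"
  then have ge: "1 \<le> (norm (\<alpha> 0))\<^sup>2" by (simp add: one_le_power)
  note la = inner_seq_l2[OF a]
  have "\<alpha> n = 0" if "n \<noteq> 0" for n
  proof -
    have "L2_set (\<lambda>k. norm (\<alpha> k)) {0, n} \<le> 1"
      using L2_set_le_nrm[OF la, of "{0, n}"] inner_seq_nrm[OF a] by simp
    then have "(norm (\<alpha> 0))\<^sup>2 + (norm (\<alpha> n))\<^sup>2 \<le> 1"
      using that by (simp add: L2_set_def)
    then have "(norm (\<alpha> n))\<^sup>2 \<le> 0" using ge by linarith
    then show ?thesis by simp
  qed
  then have "\<alpha> = (\<lambda>n. \<alpha> 0 * unit_seq 0 n)" by (auto simp: unit_seq_def fun_eq_iff)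
  then have "\<phi> z = \<alpha> 0" if "norm z < 1" for z
    using phi[OF that] ip_cmult_left[of "\<alpha> 0" "unit_seq 0" "ker_seq (chr1 z)"]
    by (metis ev_ip ip_unit_left ker_seq_def chr1_def complex_cnj_cnj power_0 mult.right_neutral)
  then show False using nc by (auto simp: constant_on_def)
qed

section \<open>The criterion for the first variable and its transfer to the second\<close>

lemma essentially_normal_fst_iff:
  assumes a: "inner_seq \<alpha>" "\<And>z. norm z < 1 \<Longrightarrow> \<phi> z = ev (chr1 z) \<alpha>"
    and b: "inner_seq \<beta>" "\<And>z. norm z < 1 \<Longrightarrow> \<psi> z = ev (chr1 z) \<beta>"
    and hol: "\<psi> holomorphic_on ball 0 1" and nc: "\<not> \<phi> constant_on ball 0 1"
  shows "compact_seq (modsp (ten \<alpha> \<beta>)) (commutator (Suc 0, 0) (ten \<alpha> \<beta>)) \<longleftrightarrow>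
    finite_blaschke_product \<psi> \<and> single_blaschke_factor \<phi>"
proof -
  have a0: "norm (\<alpha> 0) < 1" by (rule nonconstant_coeff_0[OF a(1) _ nc]) (rule a(2))
  have "finite_blaschke_product \<psi> \<longleftrightarrow> compact_seq (modsp \<beta>) (\<lambda>f. f)"
    by (rule finite_blaschke_iff_compact[OF b(1) _ hol]) (rule b(2))
  moreover have "single_blaschke_factor \<phi> \<longleftrightarrow>
      (\<exists>c. norm c = 1 \<and> bshift (Suc 0) \<alpha> = (\<lambda>n. c * (unit_seq 0 n - cnj (\<alpha> 0) * \<alpha> n)))"
    by (rule single_blaschke_iff_coeffs[OF a(1) _ a0]) (rule a(2))
  ultimately show ?thesis
    unfolding compact_commutator_iff[OF a(1) b(1) a0] by blast
qed

lemma ev_chr2_ten: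
  assumes "z \<in> bidisk" "l2 \<alpha>" "l2 \<beta>"
  shows "ev (chr2 z) (ten \<alpha> \<beta>) = ev (chr1 (fst z)) \<alpha> * ev (chr1 (snd z)) \<beta>"
  using assms l2_ker_seq[OF character_chr1]
  by (simp add: ev_ip ker_seq_chr2 ip_ten bidisk_def mem_Times_iff)

theorem proposition2p3:
  fixes \<phi> \<psi> :: "complex \<Rightarrow> complex"
    and \<theta> :: "complex \<times> complex \<Rightarrow> complex"
  assumes "inner_function \<phi>"
    and "inner_function \<psi>"
    and "\<And>z. z \<in> bidisk \<Longrightarrow> \<theta> z = \<phi> (fst z) * \<psi> (snd z)"
  shows "(\<not> \<phi> constant_on ball 0 1 \<longrightarrow>
            (essentially_normal_on (model_space \<theta>) (S_z1 \<theta>) \<longleftrightarrow>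
             finite_blaschke_product \<psi> \<and> single_blaschke_factor \<phi>)) \<and>
         (\<not> \<psi> constant_on ball 0 1 \<longrightarrow>
            (essentially_normal_on (model_space \<theta>) (S_z2 \<theta>) \<longleftrightarrow>
             finite_blaschke_product \<phi> \<and> single_blaschke_factor \<psi>))"
proof -
  obtain \<alpha> where a: "inner_seq \<alpha>" "\<And>z. norm z < 1 \<Longrightarrow> \<phi> z = ev (chr1 z) \<alpha>"
    using inner_function_coeffs[OF assms(1)] by blast
  obtain \<beta> where b: "inner_seq \<beta>" "\<And>z. norm z < 1 \<Longrightarrow> \<psi> z = ev (chr1 z) \<beta>"
    using inner_function_coeffs[OF assms(2)] by blast
  have hol: "\<phi> holomorphic_on ball 0 1" "\<psi> holomorphic_on ball 0 1"
    using assms(1,2) by (auto simp: inner_function_def)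
  let ?t = "ten \<alpha> \<beta>"
  have t: "inner_seq ?t" by (rule inner_seq_ten[OF a(1) b(1)])
  have th: "\<theta> z = ev (chr2 z) ?t" if "z \<in> bidisk" for z
    using that by (simp add: assms(3) ev_chr2_ten inner_seq_l2 a b) (simp add: bidisk_def mem_Times_iff a b)
  have S1: "S_z1 \<theta> = (\<lambda>f. orth_proj (model_space \<theta>) (\<lambda>z. chr2 z (Suc 0, 0) * f z))"
    by (simp add: S_z1_def fun_eq_iff chr2_def chr1_def)
  have S2: "S_z2 \<theta> = (\<lambda>f. orth_proj (model_space \<theta>) (\<lambda>z. chr2 z (0, Suc 0) * f z))"
    by (simp add: S_z2_def fun_eq_iff chr2_def chr1_def)
  \<comment> \<open>Exchanging the variables exchanges the two factors, so the second claim is the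
    first with phi and psi interchanged.\<close>
  have "compact_seq (modsp ?t) (commutator (0, Suc 0) ?t) \<longleftrightarrow>
      compact_seq (modsp (ten \<beta> \<alpha>)) (commutator (Suc 0, 0) (ten \<beta> \<alpha>))"
    using compact_seq_swap[of ?t "(0, Suc 0)"] compact_seq_swap[of "ten \<beta> \<alpha>" "(Suc 0, 0)"]
    by (auto simp: swap_seq_ten)
  moreover have "essentially_normal_on (model_space \<theta>) (\<lambda>f. orth_proj (model_space \<theta>) (\<lambda>z. chr2 z d * f z))
      \<longleftrightarrow> compact_seq (modsp ?t) (commutator d ?t)" for d
    by (rule essentially_normal_iff[OF t]) (rule th)
  moreover have "compact_seq (modsp ?t) (commutator (Suc 0, 0) ?t) \<longleftrightarrow>
      finite_blaschke_product \<psi> \<and> single_blaschke_factor \<phi>" if "\<not> \<phi> constant_on ball 0 1"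
    by (rule essentially_normal_fst_iff[OF a(1) _ b(1) _ hol(2) that]) (rule a(2) b(2); assumption)+
  moreover have "compact_seq (modsp (ten \<beta> \<alpha>)) (commutator (Suc 0, 0) (ten \<beta> \<alpha>)) \<longleftrightarrow>
      finite_blaschke_product \<phi> \<and> single_blaschke_factor \<psi>" if "\<not> \<psi> constant_on ball 0 1"
    by (rule essentially_normal_fst_iff[OF b(1) _ a(1) _ hol(1) that]) (rule a(2) b(2); assumption)+
  ultimately show ?thesis unfolding S1 S2 by simp
qed

end
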